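(* Let $V$ be a complex vector space with $\dim V=k$ equipped with a nondegenerate symmetric bilinear form $b$, with orthogonal group $\mathrm{O}(V)$ and special orthogonal group $\mathrm{SO}(V)$. (1) $\mathbb{C}[V^n]^{\mathrm{SO}(V)}\cong\mathbb{C}[V^n]^{\mathrm{O}(V)}\oplus\mathbb{C}[V^n]^{\mathrm{O}(V),\det}$. (2) A basis for $\mathbb{C}[V^n]^{\mathrm{O}(V),\det}_d$ is obtained from the arc diagrams (with multiple edges and loops allowed) on $n$ vertices, with total degree $d-k$, whose arcs can be decomposed into at most $k$ weak nestings, by adding exactly one hyperedge (i.e., painting $k$ of the vertices) according to the painting rule: the $\ell$th painted vertex must lie weakly to the left of the arcs in $C_\ell$. (3) The corresponding $\mathrm{O}(V)$-semiinvariant is the product of the $f_{ij}$ corresponding to each arc $(i,j)$, multiplied by $\det(v_{i_1},\dots,v_{i_k})$, where $i_1<\dots<i_k$ are the painted vertices.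
   Context: $\mathbb{C}[V^n]^{\mathrm{O}(V),\det}$ is the space of polynomial functions $f$ on $V^n$ with $f(hw)=\det(h)f(w)$ for all $h\in\mathrm{O}(V)$, and the subscript $d$ denotes the homogeneous component of degree $d$. For $1\le i\le j\le n$, $f_{ij}(v_1,\dots,v_n)=b(v_i,v_j)$. Determinants are taken with respect to a fixed basis of $V$. An arc diagram on $n$ vertices is a multigraph on vertices $1,\dots,n$ (drawn left to right), with each edge (arc) written $(i,j)$, $i\le j$. Total degree is the sum of vertex degrees (each arc, including a loop, contributes 2). A weak nesting is a multiset of arcs that are pairwise weakly nested, where $(i,j),(i',j')$ are weakly nested if $i\le i'\le j'\le j$ or $i'\le i\le j\le j'$. Let $M$ be the multiset of arcs. Let $C_1(M)$ be the sub-multiset of those $(i,j)\in M$ for which there is no $(i',j')\in M$ with $i'<i$ and $j'<j$, and $C_{\ell+1}=C_1(M\setminus\bigcup_{s\le\ell}C_s)$, until $M$ is exhausted. Painting rule: if the painted vertices are $i_1<\dots<i_k$, then for each $\ell$ for which $C_\ell$ exists, $i_\ell\le i$ for every $(i,j)\in C_\ell$ (vacuous for other $\ell$).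
   Formalization: Part (1) is stated only for k ≥ 1: if V = 0, then O(V) = SO(V) is trivial and det = 1, so both summands equal C and the claimed isomorphism would read C ≅ C⊕C, which is false; parts (2) and (3) are stated for all k. *)

theory Defs
  imports
    Complex_Main
    "HOL-Library.Multiset"
    "HOL-Library.Function_Algebras"
    "Jordan_Normal_Form.Determinant"
begin

section \<open>Complex vector spaces with a bilinear form\<close>

definition ordered_basis :: "(complex \<Rightarrow> 'v::ab_group_add \<Rightarrow> 'v) \<Rightarrow> 'v list \<Rightarrow> bool" where
  "ordered_basis scale es \<longleftrightarrow>
     distinct es \<and> \<not> module.dependent scale (set es) \<and> module.span scale (set es) = UNIV"

definition symmetric_bilinear_form ::
    "(complex \<Rightarrow> 'v::ab_group_add \<Rightarrow> 'v) \<Rightarrow> ('v \<Rightarrow> 'v \<Rightarrow> complex) \<Rightarrow> bool" where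
  "symmetric_bilinear_form scale b \<longleftrightarrow>
     (\<forall>x. Vector_Spaces.linear scale (*) (\<lambda>y. b x y)) \<and>
     (\<forall>y. Vector_Spaces.linear scale (*) (\<lambda>x. b x y)) \<and>
     (\<forall>x y. b x y = b y x)"

definition nondegenerate_form :: "('v::zero \<Rightarrow> 'v \<Rightarrow> complex) \<Rightarrow> bool" where
  "nondegenerate_form b \<longleftrightarrow> (\<forall>x. (\<forall>y. b x y = 0) \<longrightarrow> x = 0)"

text \<open>Column \<open>c\<close> of the matrix holds the coordinates of \<open>vs ! c\<close> in the basis \<open>es\<close>;
  \<open>vs\<close> is meant to have the same length as \<open>es\<close>.\<close>

definition det_vectors ::
    "(complex \<Rightarrow> 'v::ab_group_add \<Rightarrow> 'v) \<Rightarrow> 'v list \<Rightarrow> 'v list \<Rightarrow> complex" where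
  "det_vectors scale es vs =
     det (mat (length es) (length es)
       (\<lambda>(r, c). module.representation scale (set es) (vs ! c) (es ! r)))"

definition det_endo ::
    "(complex \<Rightarrow> 'v::ab_group_add \<Rightarrow> 'v) \<Rightarrow> 'v list \<Rightarrow> ('v \<Rightarrow> 'v) \<Rightarrow> complex" where
  "det_endo scale es h = det_vectors scale es (map h es)"

definition orthogonal_group ::
    "(complex \<Rightarrow> 'v::ab_group_add \<Rightarrow> 'v) \<Rightarrow> ('v \<Rightarrow> 'v \<Rightarrow> complex) \<Rightarrow> ('v \<Rightarrow> 'v) set" where
  "orthogonal_group scale b =
     {h. Vector_Spaces.linear scale scale h \<and> bij h \<and> (\<forall>x y. b (h x) (h y) = b x y)}"

definition special_orthogonal_group ::
    "(complex \<Rightarrow> 'v::ab_group_add \<Rightarrow> 'v) \<Rightarrow> 'v list \<Rightarrow> ('v \<Rightarrow> 'v \<Rightarrow> complex) \<Rightarrow> ('v \<Rightarrow> 'v) set" where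
  "special_orthogonal_group scale es b =
     {h \<in> orthogonal_group scale b. det_endo scale es h = 1}"


section \<open>Spaces of complex-valued functions\<close>

definition fscale :: "complex \<Rightarrow> ('a \<Rightarrow> complex) \<Rightarrow> 'a \<Rightarrow> complex" where
  "fscale c f = (\<lambda>x. c * f x)"

global_interpretation fun_space: vector_space fscale
  by unfold_locales (auto simp: fscale_def fun_eq_iff algebra_simps)

definition internal_direct_sum ::
    "('a \<Rightarrow> complex) set \<Rightarrow> ('a \<Rightarrow> complex) set \<Rightarrow> ('a \<Rightarrow> complex) set \<Rightarrow> bool" where
  "internal_direct_sum U A B \<longleftrightarrow>
     fun_space.subspace A \<and> fun_space.subspace B \<and>
     A \<inter> B = {0} \<and> U = {f + g |f g. f \<in> A \<and> g \<in> B}"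

definition basis_family ::
    "'i set \<Rightarrow> ('i \<Rightarrow> 'a \<Rightarrow> complex) \<Rightarrow> ('a \<Rightarrow> complex) set \<Rightarrow> bool" where
  "basis_family I F W \<longleftrightarrow>
     inj_on F I \<and> fun_space.independent (F ` I) \<and> fun_space.span (F ` I) = W"


section \<open>Polynomial functions on \<open>V\<^sup>n\<close>, invariants and semi-invariants\<close>

text \<open>A point \<open>(v\<^sub>1, \<dots>, v\<^sub>n)\<close> of \<open>V\<^sup>n\<close> is represented by any \<open>w :: nat \<Rightarrow> 'v\<close> with
  \<open>w i = v\<^sub>i\<close> for \<open>1 \<le> i \<le> n\<close>. All functions below depend on these values only, so they are
  functions on \<open>V\<^sup>n\<close>. The polynomial functions form the algebra generated by
  the functions \<open>\<phi>(v\<^sub>i)\<close> with \<open>\<phi>\<close> a linear functional on \<open>V\<close>.\<close>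

inductive_set polynomial_functions ::
    "(complex \<Rightarrow> 'v::ab_group_add \<Rightarrow> 'v) \<Rightarrow> nat \<Rightarrow> ((nat \<Rightarrow> 'v) \<Rightarrow> complex) set"
  for scale :: "complex \<Rightarrow> 'v::ab_group_add \<Rightarrow> 'v" and n :: nat where
  const: "(\<lambda>w. c) \<in> polynomial_functions scale n"
| linear: "(\<lambda>w. \<phi> (w i)) \<in> polynomial_functions scale n"
    if "Vector_Spaces.linear scale (*) \<phi>" and "i \<in> {1..n}"
| add: "(\<lambda>w. f w + g w) \<in> polynomial_functions scale n"
    if "f \<in> polynomial_functions scale n" and "g \<in> polynomial_functions scale n"
| mult: "(\<lambda>w. f w * g w) \<in> polynomial_functions scale n"
    if "f \<in> polynomial_functions scale n" and "g \<in> polynomial_functions scale n"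

definition homogeneous_component ::
    "(complex \<Rightarrow> 'v::ab_group_add \<Rightarrow> 'v) \<Rightarrow> nat \<Rightarrow> ((nat \<Rightarrow> 'v) \<Rightarrow> complex) set
      \<Rightarrow> ((nat \<Rightarrow> 'v) \<Rightarrow> complex) set" where
  "homogeneous_component scale d A =
     {f \<in> A. \<forall>c w. f (\<lambda>i. scale c (w i)) = c ^ d * f w}"

definition invariants ::
    "(complex \<Rightarrow> 'v::ab_group_add \<Rightarrow> 'v) \<Rightarrow> nat \<Rightarrow> ('v \<Rightarrow> 'v) set
      \<Rightarrow> ((nat \<Rightarrow> 'v) \<Rightarrow> complex) set" where
  "invariants scale n G =
     {f \<in> polynomial_functions scale n. \<forall>h\<in>G. \<forall>w. f (\<lambda>i. h (w i)) = f w}"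

text \<open>If \<open>V = 0\<close>, then \<open>invariants\<close> and \<open>det_semiinvariants\<close> for the (trivial) orthogonal group
  coincide, so their sum is direct only for \<open>dim V \<ge> 1\<close>.\<close>

definition det_semiinvariants ::
    "(complex \<Rightarrow> 'v::ab_group_add \<Rightarrow> 'v) \<Rightarrow> 'v list \<Rightarrow> nat \<Rightarrow> ('v \<Rightarrow> 'v) set
      \<Rightarrow> ((nat \<Rightarrow> 'v) \<Rightarrow> complex) set" where
  "det_semiinvariants scale es n G =
     {f \<in> polynomial_functions scale n.
        \<forall>h\<in>G. \<forall>w. f (\<lambda>i. h (w i)) = det_endo scale es h * f w}"


section \<open>Arc diagrams\<close>

text \<open>An arc diagram is given by its multiset of arcs.\<close>

definition arc_diagram :: "nat \<Rightarrow> (nat \<times> nat) multiset \<Rightarrow> bool" where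
  "arc_diagram n M \<longleftrightarrow> (\<forall>(i, j)\<in>#M. 1 \<le> i \<and> i \<le> j \<and> j \<le> n)"

definition vertex_degree :: "(nat \<times> nat) multiset \<Rightarrow> nat \<Rightarrow> nat" where
  "vertex_degree M v = (\<Sum>(i, j)\<in>#M. of_bool (i = v) + of_bool (j = v))"

definition total_degree :: "nat \<Rightarrow> (nat \<times> nat) multiset \<Rightarrow> nat" where
  "total_degree n M = (\<Sum>v\<in>{1..n}. vertex_degree M v)"

fun weakly_nested :: "nat \<times> nat \<Rightarrow> nat \<times> nat \<Rightarrow> bool" where
  "weakly_nested (i, j) (i', j') \<longleftrightarrow>
     (i \<le> i' \<and> i' \<le> j' \<and> j' \<le> j) \<or> (i' \<le> i \<and> i \<le> j \<and> j \<le> j')"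

definition weak_nesting :: "(nat \<times> nat) multiset \<Rightarrow> bool" where
  "weak_nesting N \<longleftrightarrow> (\<forall>a\<in>#N. \<forall>a'\<in>#N. weakly_nested a a')"

definition decomposes_into_weak_nestings :: "nat \<Rightarrow> (nat \<times> nat) multiset \<Rightarrow> bool" where
  "decomposes_into_weak_nestings k M \<longleftrightarrow>
     (\<exists>Ns. length Ns \<le> k \<and> (\<forall>N\<in>set Ns. weak_nesting N) \<and> sum_list Ns = M)"

definition first_layer :: "(nat \<times> nat) multiset \<Rightarrow> (nat \<times> nat) multiset" where
  "first_layer M = {#(i, j) \<in># M. \<not> (\<exists>(i', j')\<in>#M. i' < i \<and> j' < j)#}"

text \<open>Layers are numbered from \<open>1\<close>; they are empty once \<open>M\<close> is exhausted.\<close>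

fun layer :: "(nat \<times> nat) multiset \<Rightarrow> nat \<Rightarrow> (nat \<times> nat) multiset" where
  "layer M l = first_layer (M - (\<Sum>s\<in>{1..<l}. layer M s))"

declare layer.simps [simp del]

text \<open>\<open>sorted_list_of_set S ! (l - 1)\<close> is the \<open>l\<close>th painted vertex from the left.\<close>

definition painting_rule :: "nat \<Rightarrow> (nat \<times> nat) multiset \<Rightarrow> nat set \<Rightarrow> bool" where
  "painting_rule k M S \<longleftrightarrow>
     (\<forall>l\<in>{1..k}. \<forall>(i, j)\<in>#layer M l. sorted_list_of_set S ! (l - 1) \<le> i)"

definition painted_diagrams :: "nat \<Rightarrow> nat \<Rightarrow> nat \<Rightarrow> ((nat \<times> nat) multiset \<times> nat set) set" where
  "painted_diagrams k n d =
     {(M, S). arc_diagram n M \<and> total_degree n M + k = d \<and>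
        decomposes_into_weak_nestings k M \<and>
        S \<subseteq> {1..n} \<and> card S = k \<and> painting_rule k M S}"

definition diagram_function ::
    "(complex \<Rightarrow> 'v::ab_group_add \<Rightarrow> 'v) \<Rightarrow> 'v list \<Rightarrow> ('v \<Rightarrow> 'v \<Rightarrow> complex)
      \<Rightarrow> (nat \<times> nat) multiset \<times> nat set \<Rightarrow> (nat \<Rightarrow> 'v) \<Rightarrow> complex" where
  "diagram_function scale es b = (\<lambda>(M, S) w.
     (\<Prod>(i, j)\<in>#M. b (w i) (w j)) * det_vectors scale es (map w (sorted_list_of_set S)))"

end

theory Submission
  imports Defs
begin

text \<open>
  The form has an orthonormal basis \<open>e\<^sub>0, \<dots>, e\<^sub>k\<^sub>-\<^sub>1\<close>, so \<open>b(u, v)\<close> is the sum of the products of coordinates,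
  and up to a nonzero constant the determinant in any basis is the determinant \<open>coord_det\<close> of coordinates
  in this one. The proof that painted diagrams form a basis has three parts.

  \<^bold>\<open>Generation.\<close> Let \<open>f\<close> be a polynomial function that changes sign under every reflection. Written in
  coordinates, \<open>f\<close> is a combination of products of pairings \<open>b(y, z)\<close> times one determinant, where the
  arguments are vectors \<open>v\<^sub>i\<close> or basis vectors \<open>e\<^sub>r\<close>. The basis vectors can be removed one at a time. A
  reflection carries \<open>e\<^sub>m\<close> to any given real unit vector \<open>u\<close> in the span of \<open>e\<^sub>0, \<dots>, e\<^sub>m\<close> and fixes the
  later \<open>e\<^sub>r\<close>; both \<open>f\<close> and the expression change sign under it, so \<open>u\<close> may replace \<open>e\<^sub>m\<close> in the expression
  for \<open>f\<close>. Hence \<open>f\<close> is also the average of the expression over the sphere of all \<open>u\<close>. The average of a product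
  of linear forms is a combination of products of their inner products (Wick's formula), and the inner
  product of two forms \<open>b(\<sqdot>, y)\<close>, or of such a form and the determinant as a function of one argument, is
  again a pairing or a determinant, now without \<open>e\<^sub>m\<close>. This is \<open>eliminate_basis_vector\<close>; the average is a
  finite weighted sum of values, constructed in \<open>sphere_cubature\<close>. The outcome,
  \<open>first_fundamental_theorem\<close>, is that \<open>f\<close> is a combination of terms \<open>\<Prod> b(v\<^sub>i, v\<^sub>j) det(v\<^sub>s)\<close>.

  \<^bold>\<open>Straightening.\<close> Give such a term the weight \<open>\<Sum> ij\<close> over its arcs plus \<open>n + 1\<close> times the sum of its
  painted vertices, as if a painted vertex \<open>s\<close> were an arc \<open>(s, n + 1)\<close>. An arc of layer \<open>l\<close> ends a chain of
  \<open>l\<close> arcs that increase at both ends. If it starts to the left of the \<open>l\<close>th painted vertex, then the left ends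
  of the chain and the painted vertices from the \<open>l\<close>th on are \<open>k + 1\<close> increasing vertices; a chain of \<open>k + 1\<close>
  arcs, which exists if the arcs are not \<open>k\<close> nestings, gives \<open>k + 1\<close> increasing vertices as well. Alternating
  over these \<open>k + 1\<close> vectors of a \<open>k\<close>-dimensional space gives zero, and by the rearrangement inequality the
  original term has the largest weight in this relation (\<open>exchange_smaller\<close>). Induction on the weight leaves
  only painted diagrams (\<open>straightening\<close>).

  \<^bold>\<open>Independence.\<close> For a painted diagram take the monomial in the coordinates whose row \<open>l\<close> contains the ends of
  the arcs of layer \<open>l\<close> and the \<open>l\<close>th painted vertex. By the painting rule each row, with the painted vertex
  \<open>s\<close> read as \<open>(s, n + 1)\<close>, is a nesting, and among all ways of pairing a given multiset of endpoints the
  nesting is the unique one of least weight (\<open>nesting_minimizes_arc_weight\<close>). So the monomial can occur in the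
  term of another diagram only if that diagram has larger weight, and the coefficient matrix is triangular
  (\<open>painted_terms_independent\<close>).

  The decomposition of the \<open>SO(V)\<close>-invariants is the splitting into the parts that are even and odd under
  one reflection, since for \<open>V \<noteq> 0\<close> the special orthogonal group has index two.
\<close>

section \<open>Nestings and layers of arcs\<close>

definition endpoints :: "(nat \<times> nat) multiset \<Rightarrow> nat multiset" where
  "endpoints N = image_mset fst N + image_mset snd N"

definition arc_weight :: "(nat \<times> nat) multiset \<Rightarrow> nat" where
  "arc_weight N = (\<Sum>(i, j)\<in>#N. i * j)"

lemma endpoints_simps [simp]:
  "endpoints {#} = {#}"
  "endpoints (add_mset p N) = {#fst p, snd p#} + endpoints N"
  "endpoints (N + N') = endpoints N + endpoints N'"
  by (auto simp: endpoints_def)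

lemma arc_weight_simps [simp]:
  "arc_weight {#} = 0"
  "arc_weight (add_mset p N) = fst p * snd p + arc_weight N"
  "arc_weight (N + N') = arc_weight N + arc_weight N'"
  by (auto simp: arc_weight_def case_prod_beta)

lemma set_endpoints: "set_mset (endpoints N) = fst ` set_mset N \<union> snd ` set_mset N"
  by (auto simp: endpoints_def)

text \<open>
  An arc of greatest length contains all others.
\<close>

lemma nesting_outermost_arc:
  assumes "N \<noteq> {#}" "weak_nesting N" "\<And>p. p \<in># N \<Longrightarrow> fst p \<le> snd p"
  obtains p where "p \<in># N" "\<And>q. q \<in># N \<Longrightarrow> fst p \<le> fst q \<and> snd q \<le> snd p"
proof -
  define len :: "nat \<times> nat \<Rightarrow> nat" where "len = (\<lambda>p. snd p - fst p)"
  have "Max (len ` set_mset N) \<in> len ` set_mset N"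
    using assms(1) by (intro Max_in) auto
  then obtain p where p: "p \<in># N" "len p = Max (len ` set_mset N)" by auto
  have "fst p \<le> fst q \<and> snd q \<le> snd p" if q: "q \<in># N" for q
  proof -
    have "len q \<le> len p" unfolding p(2) using q by (intro Max_ge) auto
    moreover have "weakly_nested p q" using assms(2) p(1) q by (auto simp: weak_nesting_def)
    ultimately show ?thesis
      using assms(3)[OF p(1)] assms(3)[OF q] unfolding len_def
      by (cases p; cases q) auto
  qed
  with p(1) show ?thesis using that by blast
qed

text \<open>
  Uncrossing. Let \<open>(a, z)\<close> be the outermost arc of the nesting. If \<open>N'\<close> does not contain it, then \<open>N'\<close> has
  arcs \<open>(a, y)\<close> and \<open>(x, z)\<close> with \<open>a < x\<close> and \<open>y < z\<close>, and replacing them by \<open>(a, z)\<close> and the arc between \<open>x\<close> and \<open>y\<close>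
  lowers the weight by \<open>(x - a)(z - y)\<close>. Once \<open>(a, z)\<close> is common to both, it can be removed.
\<close>

lemma nesting_minimizes_arc_weight:
  assumes "weak_nesting N" "\<And>p. p \<in># N \<Longrightarrow> fst p \<le> snd p"
    and "\<And>p. p \<in># N' \<Longrightarrow> fst p \<le> snd p" "endpoints N' = endpoints N"
  shows "arc_weight N < arc_weight N' \<or> N' = N"
  using assms
proof (induction "size N" arbitrary: N N')
  case 0
  then have "endpoints N' = {#}" by simp
  then have "N' = {#}" by (auto simp: endpoints_def)
  then show ?case using 0 by simp
next
  case (Suc m)
  from Suc.hyps(2) have "N \<noteq> {#}" by auto
  then obtain p where p: "p \<in># N" and outer: "\<And>q. q \<in># N \<Longrightarrow> fst p \<le> fst q \<and> snd q \<le> snd p"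
    using nesting_outermost_arc[OF _ Suc.prems(1,2)] by blast
  obtain a z where az: "p = (a, z)" by fastforce
  obtain N0 where N0: "N = add_mset p N0" using multi_member_split[OF p] by blast
  have N0_nest: "weak_nesting N0" "\<And>p. p \<in># N0 \<Longrightarrow> fst p \<le> snd p" "size N0 = m"
    using Suc.prems(1,2) Suc.hyps(2) by (auto simp: weak_nesting_def N0)
  have bounds: "a \<le> v \<and> v \<le> z" if "v \<in># endpoints N" for v
  proof -
    obtain q where q: "q \<in># N" "v = fst q \<or> v = snd q" using \<open>v \<in># endpoints N\<close> by (auto simp: set_endpoints)
    then show ?thesis using outer[OF q(1)] Suc.prems(2)[OF q(1)] az by auto
  qed
  have removal: "arc_weight N < arc_weight N2 \<or> N2 = N"
    if pN2: "p \<in># N2" and le: "\<And>q. q \<in># N2 \<Longrightarrow> fst q \<le> snd q" and e2: "endpoints N2 = endpoints N" for N2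
  proof -
    obtain N1 where N1: "N2 = add_mset p N1" using multi_member_split[OF pN2] by blast
    have "endpoints N1 = endpoints N0" using e2 by (simp add: N1 N0)
    then show ?thesis
      using Suc.hyps(1)[OF N0_nest(3)[symmetric] N0_nest(1,2), of N1] le by (auto simp: N1 N0)
  qed
  show ?case
  proof (cases "p \<in># N'")
    case True
    then show ?thesis using removal Suc.prems(3,4) by blast
  next
    case False
    have "a \<in># endpoints N'" "z \<in># endpoints N'" using az Suc.prems(4) by (simp_all add: N0)
    have bnd': "a \<le> fst q \<and> snd q \<le> z" if "q \<in># N'" for q
    proof -
      have "fst q \<in># endpoints N'" "snd q \<in># endpoints N'" using that by (auto simp: set_endpoints)
      then show ?thesis using bounds Suc.prems(4) by simp
    qed
    obtain y where y: "(a, y) \<in># N'"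
    proof -
      obtain q where "q \<in># N'" "a = fst q \<or> a = snd q"
        using \<open>a \<in># endpoints N'\<close> by (auto simp: set_endpoints)
      then have "fst q = a" using bnd'[of q] Suc.prems(3)[of q] by auto
      then show ?thesis using that \<open>q \<in># N'\<close> by (metis prod.collapse)
    qed
    obtain x where x: "(x, z) \<in># N'"
    proof -
      obtain q where "q \<in># N'" "z = fst q \<or> z = snd q"
        using \<open>z \<in># endpoints N'\<close> by (auto simp: set_endpoints)
      then have "snd q = z" using bnd'[of q] Suc.prems(3)[of q] by auto
      then show ?thesis using that \<open>q \<in># N'\<close> by (metis prod.collapse)
    qed
    have strict: "y < z" "a < x"
    proof -
      have "y \<noteq> z" "x \<noteq> a" using False az x y by auto
      then show "y < z" "a < x" using bnd'[OF x] bnd'[OF y] by auto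
    qed
    have "(a, y) \<noteq> (x, z)" using strict by auto
    obtain N3 where N3: "N' = add_mset (a, y) N3" using multi_member_split[OF y] by blast
    then have "(x, z) \<in># N3" using x \<open>(a, y) \<noteq> (x, z)\<close> by auto
    then obtain N4 where "N3 = add_mset (x, z) N4" by (blast dest: multi_member_split)
    then obtain N1 where N1: "N' = {#(a, y), (x, z)#} + N1" using N3 by simp
    define N2 where "N2 = {#(a, z), (min x y, max x y)#} + N1"
    have e: "endpoints N2 = endpoints N"
      using Suc.prems(4)[symmetric] by (auto simp: N2_def N1 min_def max_def)
    have le2: "fst q \<le> snd q" if "q \<in># N2" for q
      using that Suc.prems(3) bnd'[OF x] Suc.prems(3)[OF x] strict by (force simp: N2_def N1)
    have "a * z + x * y < a * y + x * z"
    proof -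
      have "0 < (int z - int y) * (int x - int a)" using strict by simp
      then have "int (a * z + x * y) < int (a * y + x * z)" by (simp add: algebra_simps)
      then show ?thesis by linarith
    qed
    then have "arc_weight N2 < arc_weight N'"
      by (auto simp: N2_def N1 min_def max_def mult.commute)
    moreover have "arc_weight N < arc_weight N2 \<or> N2 = N"
      by (rule removal[OF _ le2 e]) (simp add: N2_def az)
    ultimately show ?thesis by auto
  qed
qed

definition precedes :: "nat \<times> nat \<Rightarrow> nat \<times> nat \<Rightarrow> bool" (infix "\<lless>" 50) where
  "p \<lless> q \<longleftrightarrow> fst p < fst q \<and> snd p < snd q"

definition remainder :: "(nat \<times> nat) multiset \<Rightarrow> nat \<Rightarrow> (nat \<times> nat) multiset" where
  "remainder M l = M - (\<Sum>s\<in>{1..<l}. layer M s)"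

lemma first_layer_eq: "first_layer M = {#p \<in># M. \<not> (\<exists>q\<in>#M. q \<lless> p)#}"
  unfolding first_layer_def precedes_def
  by (rule filter_mset_cong) (auto split: prod.splits)

lemma layer_eq: "layer M l = first_layer (remainder M l)"
  unfolding remainder_def by (subst layer.simps) simp

lemma remainder_Suc:
  assumes "l \<ge> 1" shows "remainder M (Suc l) = remainder M l - layer M l"
  using assms by (simp add: remainder_def)

lemma remainder_1 [simp]: "remainder M (Suc 0) = M" by (simp add: remainder_def)

lemma layer_subset_remainder: "layer M l \<subseteq># remainder M l"
  by (simp add: layer_eq first_layer_eq)

lemma remainder_subset: "remainder M l \<subseteq># M"
  by (simp add: remainder_def)

lemma remainder_Suc_filter:
  assumes "l \<ge> 1"
  shows "remainder M (Suc l) = {#p \<in># remainder M l. \<exists>q\<in>#remainder M l. q \<lless> p#}"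
  unfolding remainder_Suc[OF assms] layer_eq[of M l] first_layer_eq
  by (rule multiset_eqI) auto

lemma layers_sum: "M = remainder M (Suc l) + (\<Sum>s\<in>{1..l}. layer M s)"
proof (induction l)
  case (Suc l)
  have "remainder M (Suc l) = remainder M (Suc (Suc l)) + layer M (Suc l)"
    using layer_subset_remainder[of M "Suc l"] by (simp add: remainder_Suc)
  then show ?case using Suc by (simp add: algebra_simps)
qed simp

lemma first_layer_below:
  assumes "p \<in># M" shows "\<exists>q\<in>#first_layer M. q = p \<or> q \<lless> p"
proof -
  define m where "m = (LEAST m. \<exists>q. q \<in># M \<and> (q = p \<or> q \<lless> p) \<and> fst q = m)"
  have ex: "\<exists>m q. q \<in># M \<and> (q = p \<or> q \<lless> p) \<and> fst q = m" using assms by blast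
  obtain q where q: "q \<in># M" "q = p \<or> q \<lless> p" "fst q = m"
    using LeastI_ex[OF ex] unfolding m_def by blast
  have "\<not> r \<lless> q" if "r \<in># M" for r
  proof
    assume r: "r \<lless> q"
    then have "r \<lless> p" using q(2) by (auto simp: precedes_def)
    then have "m \<le> fst r" unfolding m_def using that by (intro Least_le exI[of _ r]) auto
    then show False using r q(3) by (auto simp: precedes_def)
  qed
  then have "q \<in># first_layer M" using q(1) by (auto simp: first_layer_eq)
  then show ?thesis using q(2) by blast
qed

text \<open>
  An arc is left over after layer \<open>l\<close> has been taken only if some arc of layer \<open>l\<close> precedes it.
\<close>

lemma layer_chain:
  assumes "p \<in># layer M (Suc l)"
  shows "\<exists>cs. length cs = Suc l \<and> last cs = p \<and> set cs \<subseteq> set_mset M \<and> sorted_wrt (\<lless>) cs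
           \<and> (\<forall>q\<in>set cs. q = p \<or> q \<lless> p)"
  using assms
proof (induction l arbitrary: p)
  case 0
  then have "p \<in># M"
    using mset_subset_eqD[OF layer_subset_remainder] by fastforce
  then show ?case by (intro exI[of _ "[p]"]) auto
next
  case (Suc l)
  from Suc.prems have pR: "p \<in># remainder M (Suc (Suc l))"
    using mset_subset_eqD[OF layer_subset_remainder] by blast
  then obtain q where q: "q \<in># remainder M (Suc l)" "q \<lless> p"
    by (auto simp: remainder_Suc_filter)
  then obtain r where r: "r \<in># layer M (Suc l)" "r = q \<or> r \<lless> q"
    using first_layer_below[of q "remainder M (Suc l)"] unfolding layer_eq by blast
  then have rp: "r \<lless> p" using q(2) by (auto simp: precedes_def)
  obtain cs where cs: "length cs = Suc l" "set cs \<subseteq> set_mset M" "sorted_wrt (\<lless>) cs"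
    "\<forall>q\<in>set cs. q = r \<or> q \<lless> r" using Suc.IH[OF r(1)] by blast
  have "\<forall>q\<in>set cs. q \<lless> p" using cs(4) rp by (auto simp: precedes_def)
  moreover have "p \<in># M" by (rule mset_subset_eqD[OF remainder_subset pR])
  ultimately show ?case
    using cs by (intro exI[of _ "cs @ [p]"]) (auto simp: sorted_wrt_append)
qed

lemma first_layer_nesting:
  assumes "\<And>p. p \<in># M \<Longrightarrow> fst p \<le> snd p"
  shows "weak_nesting (first_layer M)"
  unfolding weak_nesting_def
proof (intro ballI)
  fix p q assume "p \<in># first_layer M" "q \<in># first_layer M"
  then have "\<not> p \<lless> q" "\<not> q \<lless> p" "fst p \<le> snd p" "fst q \<le> snd q"
    using assms by (auto simp: first_layer_eq)
  then show "weakly_nested p q" by (cases p; cases q) (auto simp: precedes_def)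
qed

lemma layer_nesting:
  assumes "\<And>p. p \<in># M \<Longrightarrow> fst p \<le> snd p"
  shows "weak_nesting (layer M l)"
  unfolding layer_eq by (intro first_layer_nesting assms) (rule mset_subset_eqD[OF remainder_subset])

text \<open>
  Arcs that increase at both ends are never weakly nested, so the arcs of a chain lie in different nestings.
  Together with \<open>layer_chain\<close> this identifies the number of layers with the least number of nestings.
\<close>

lemma chain_length_le:
  assumes "decomposes_into_weak_nestings k M" "sorted_wrt (\<lless>) cs" "set cs \<subseteq> set_mset M"
  shows "length cs \<le> k"
proof (rule ccontr)
  assume "\<not> length cs \<le> k"
  obtain Ns where Ns: "length Ns \<le> k" "\<forall>N\<in>set Ns. weak_nesting N" "sum_list Ns = M"
    using assms(1) by (auto simp: decomposes_into_weak_nestings_def)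
  have mem: "\<exists>c<length Ns. p \<in># Ns ! c" if "p \<in># M" for p
  proof -
    have "p \<in># sum_list Ns \<Longrightarrow> \<exists>N\<in>set Ns. p \<in># N" by (induction Ns) auto
    then show ?thesis using that Ns(3) by (metis in_set_conv_nth)
  qed
  define g where "g t = (SOME c. c < length Ns \<and> cs ! t \<in># Ns ! c)" for t
  have g: "g t < length Ns \<and> cs ! t \<in># Ns ! (g t)" if "t < length cs" for t
  proof -
    have "cs ! t \<in># M" using assms(3) that by auto
    from someI_ex[OF mem[OF this]] show ?thesis by (simp add: g_def)
  qed
  have "g ` {..<length cs} \<subseteq> {..<length Ns}" using g by auto
  then have "\<not> inj_on g {..<length cs}"
    using \<open>\<not> length cs \<le> k\<close> Ns(1) card_inj_on_le[of g "{..<length cs}" "{..<length Ns}"] by auto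
  then obtain t u where "t \<noteq> u" "t < length cs" "u < length cs" "g t = g u"
    unfolding inj_on_def by blast
  then obtain t u where tu: "t < u" "u < length cs" "g t = g u"
    by (cases t u rule: linorder_cases) (auto simp: eq_commute[of "g t"])
  have "weakly_nested (cs ! t) (cs ! u)"
  proof -
    have "weak_nesting (Ns ! g u)" using g[OF tu(2)] Ns(2) by simp
    moreover have "cs ! t \<in># Ns ! g u" "cs ! u \<in># Ns ! g u" using g[of t] g[of u] tu by auto
    ultimately show ?thesis unfolding weak_nesting_def by blast
  qed
  moreover have "cs ! t \<lless> cs ! u" using assms(2) tu by (auto simp: sorted_wrt_iff_nth_less)
  ultimately show False
    by (cases "cs ! t"; cases "cs ! u") (auto simp: precedes_def)
qed

lemma remainder_nonempty_chain:
  assumes "remainder M (Suc l) \<noteq> {#}"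
  shows "\<exists>cs. length cs = Suc l \<and> set cs \<subseteq> set_mset M \<and> sorted_wrt (\<lless>) cs"
proof -
  obtain p where "p \<in># remainder M (Suc l)" using assms by blast
  then obtain q where "q \<in># layer M (Suc l)"
    using first_layer_below by (metis layer_eq)
  then show ?thesis using layer_chain by blast
qed

lemma decomposition_into_layers:
  assumes "decomposes_into_weak_nestings k M"
  shows "M = (\<Sum>l\<in>{1..k}. layer M l)"
proof -
  have "remainder M (Suc k) = {#}"
    using remainder_nonempty_chain[of M k] chain_length_le[OF assms] by fastforce
  then show ?thesis using layers_sum[of M k, symmetric] by simp
qed

lemma long_chain_if_not_decomposable:
  assumes "\<not> decomposes_into_weak_nestings k M" "\<And>p. p \<in># M \<Longrightarrow> fst p \<le> snd p"
  shows "\<exists>cs. length cs = Suc k \<and> set cs \<subseteq> set_mset M \<and> sorted_wrt (\<lless>) cs"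
proof (rule remainder_nonempty_chain, rule notI)
  assume "remainder M (Suc k) = {#}"
  then have "sum_list (map (layer M) [1..<Suc k]) = M"
    using layers_sum[of M k, symmetric]
    by (simp only: interv_sum_list_conv_sum_set_nat set_upt atLeastLessThanSuc_atLeastAtMost) simp
  then have "decomposes_into_weak_nestings k M"
    unfolding decomposes_into_weak_nestings_def
    using layer_nesting[OF assms(2)] by (intro exI[of _ "map (layer M) [1..<Suc k]"]) (auto simp del: upt_Suc)
  then show False using assms(1) by simp
qed

section \<open>Averaging over the real unit sphere\<close>

lemma sum_PiE_insert:
  assumes "r \<notin> C"
  shows "(\<Sum>t\<in>PiE (insert r C) X. h t) = (\<Sum>s\<in>PiE C X. \<Sum>z\<in>X r. h (s(r := z)))"
proof -
  have "(\<Sum>t\<in>PiE (insert r C) X. h t) = (\<Sum>(z, s)\<in>X r \<times> PiE C X. h (s(r := z)))"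
    unfolding PiE_insert_eq
    by (subst sum.reindex[OF inj_combinator[OF assms]]) (intro sum.cong refl, clarify, simp only: o_def prod.case)
  also have "\<dots> = (\<Sum>s\<in>PiE C X. \<Sum>z\<in>X r. h (s(r := z)))"
    unfolding sum.cartesian_product[symmetric] by (rule sum.swap)
  finally show ?thesis .
qed

lemma prod_sum_PiE:
  fixes f :: "'i \<Rightarrow> 'j \<Rightarrow> 'c::comm_semiring_1"
  assumes "finite A"
  shows "(\<Prod>x\<in>A. \<Sum>y\<in>B x. f x y) = (\<Sum>g\<in>PiE A B. \<Prod>x\<in>A. f x (g x))"
  using assms
proof (induction A rule: finite_induct)
  case (insert a A)
  have "(\<Sum>g\<in>PiE (insert a A) B. \<Prod>x\<in>insert a A. f x (g x))
      = (\<Sum>s\<in>PiE A B. \<Sum>z\<in>B a. f a z * (\<Prod>x\<in>A. f x (s x)))"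
    unfolding sum_PiE_insert[OF insert(2)] prod.insert[OF insert(1,2)]
    using insert(2) by (intro sum.cong refl arg_cong2[of _ _ _ _ times] prod.cong) auto
  also have "\<dots> = (\<Sum>z\<in>B a. f a z) * (\<Sum>s\<in>PiE A B. \<Prod>x\<in>A. f x (s x))"
    by (simp only: sum_distrib_left sum_distrib_right)
  finally show ?case using insert by simp
qed simp

text \<open>
  The moments of the standard normal distribution. The mean over a sphere is obtained from a Gaussian mean,
  because the latter is a product over coordinates and obeys integration by parts in each of them.
\<close>

fun gauss_moment :: "nat \<Rightarrow> complex" where
  "gauss_moment 0 = 1"
| "gauss_moment (Suc 0) = 0"
| "gauss_moment (Suc (Suc j)) = of_nat (Suc j) * gauss_moment j"

text \<open>
  Gaussian integration of polynomials. The cut-off at a degree \<open>D\<close> makes linearity evident.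
\<close>

definition gauss_functional :: "nat \<Rightarrow> complex poly \<Rightarrow> complex" where
  "gauss_functional D p = (\<Sum>j\<le>D. coeff p j * gauss_moment j)"

lemma gauss_functional_sum: "gauss_functional D (\<Sum>i\<in>A. smult (c i) (f i)) = (\<Sum>i\<in>A. c i * gauss_functional D (f i))"
  unfolding gauss_functional_def coeff_sum sum_distrib_right sum_distrib_left coeff_smult
  by (subst sum.swap) (simp add: mult.assoc)

lemma gauss_functional_pderiv:
  assumes "degree p < D"
  shows "gauss_functional D ([:0, 1:] * p) = gauss_functional D (pderiv p)"
proof -
  obtain D' where D: "D = Suc D'" using assms by (cases D) auto
  have "gauss_functional D ([:0, 1:] * p) = (\<Sum>j\<le>D'. coeff p j * gauss_moment (Suc j))"
    unfolding gauss_functional_def D by (subst sum.atMost_Suc_shift) simp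
  also have "\<dots> = (\<Sum>j\<le>Suc D'. coeff p j * gauss_moment (Suc j))"
    using assms by (simp add: coeff_eq_0 D)
  also have "\<dots> = (\<Sum>j\<le>D'. coeff (pderiv p) j * gauss_moment j)"
    by (subst sum.atMost_Suc_shift) (simp add: coeff_pderiv mult_ac)
  also have "\<dots> = (\<Sum>j\<le>D. coeff (pderiv p) j * gauss_moment j)"
    using assms by (simp add: coeff_pderiv coeff_eq_0 D)
  finally show ?thesis by (simp add: gauss_functional_def)
qed

definition lagrange_poly :: "nat set \<Rightarrow> nat \<Rightarrow> complex poly" where
  "lagrange_poly X t = smult (1 / (\<Prod>s\<in>X - {t}. of_nat t - of_nat s)) (\<Prod>s\<in>X - {t}. [:- of_nat s, 1:])"

lemma poly_lagrange_poly:
  assumes "finite X" "t \<in> X" "s \<in> X"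
  shows "poly (lagrange_poly X t) (of_nat s) = of_bool (s = t)"
proof (cases "s = t")
  case True
  have "(\<Prod>s\<in>X - {t}. of_nat t - of_nat s :: complex) \<noteq> 0" using assms by auto
  then show ?thesis using True by (simp add: lagrange_poly_def poly_prod)
next
  case False
  then have "poly (\<Prod>s\<in>X - {t}. [:- of_nat s, 1:]) (of_nat s :: complex) = 0"
    using assms unfolding poly_prod by (intro prod_zero) auto
  then show ?thesis using False by (simp add: lagrange_poly_def)
qed

lemma degree_lagrange_poly:
  assumes "finite X" "t \<in> X"
  shows "degree (lagrange_poly X t) \<le> card X - 1"
proof -
  have "degree (\<Prod>s\<in>X - {t}. [:- of_nat s, 1 :: complex:]) \<le> (\<Sum>s\<in>X - {t}. degree [:- of_nat s, 1 :: complex:])"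
    using degree_prod_sum_le[of "X - {t}" "\<lambda>s. [:- of_nat s, 1 :: complex:]"] assms by (simp add: o_def)
  then show ?thesis using assms unfolding lagrange_poly_def by (intro degree_smult_le[THEN order.trans]) auto
qed

lemma lagrange_interpolation:
  assumes "finite X" "degree p < card X"
  shows "(\<Sum>t\<in>X. smult (poly p (of_nat t)) (lagrange_poly X t)) = p"
proof (rule poly_eqI_degree[where A = "of_nat ` X"])
  have card: "card (of_nat ` X :: complex set) = card X" by (intro card_image inj_onI) auto
  show "degree p < card (of_nat ` X :: complex set)" using assms(2) card by simp
  have "degree (\<Sum>t\<in>X. smult (poly p (of_nat t)) (lagrange_poly X t)) \<le> card X - 1"
    using degree_lagrange_poly[OF assms(1)]
    by (intro degree_sum_le assms(1)) (meson degree_smult_le order.trans)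
  then show "degree (\<Sum>t\<in>X. smult (poly p (of_nat t)) (lagrange_poly X t)) < card (of_nat ` X :: complex set)"
    using assms(2) card by linarith
  show "poly (\<Sum>t\<in>X. smult (poly p (of_nat t)) (lagrange_poly X t)) x = poly p x" if x: "x \<in> of_nat ` X" for x
  proof -
    obtain s where s: "s \<in> X" "x = of_nat s" using x by blast
    have "poly (\<Sum>t\<in>X. smult (poly p (of_nat t)) (lagrange_poly X t)) x
      = (\<Sum>t\<in>X. if t = s then poly p (of_nat t) else 0)"
      unfolding poly_sum s(2) poly_smult by (rule sum.cong) (auto simp: poly_lagrange_poly[OF assms(1) _ s(1)])
    also have "\<dots> = poly p x" using s assms(1) by (subst sum.delta) auto
    finally show ?thesis .
  qed
qed

text \<open>
  Weights of the quadrature with nodes \<open>1, \<dots>, D + 1\<close>, by Lagrange interpolation. Nonzero nodes keep the grid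
  points away from the origin, so that they can be projected to the unit sphere.
\<close>

definition gauss_weight :: "nat \<Rightarrow> nat \<Rightarrow> complex" where
  "gauss_weight D t = gauss_functional D (lagrange_poly {1..Suc D} t)"

lemma gauss_quadrature:
  assumes "degree p \<le> D"
  shows "(\<Sum>t\<in>{1..Suc D}. gauss_weight D t * poly p (of_nat t)) = gauss_functional D p"
proof -
  have "gauss_functional D p
      = gauss_functional D (\<Sum>t\<in>{1..Suc D}. smult (poly p (of_nat t)) (lagrange_poly {1..Suc D} t))"
    using assms by (subst lagrange_interpolation) auto
  then show ?thesis by (simp only: gauss_functional_sum gauss_weight_def mult.commute)
qed

lemma gauss_weight_by_parts:
  assumes "degree p < D"
  shows "(\<Sum>t\<in>{1..Suc D}. gauss_weight D t * (of_nat t * poly p (of_nat t)))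
       = (\<Sum>t\<in>{1..Suc D}. gauss_weight D t * poly (pderiv p) (of_nat t))"
proof -
  have "degree ([:0, 1:] * p) \<le> D"
    using assms degree_mult_le[of "[:0, 1:]" p] by simp
  then show ?thesis
    using gauss_quadrature[of "[:0, 1:] * p" D] gauss_quadrature[of "pderiv p" D] assms
      gauss_functional_pderiv[OF assms] by (simp add: degree_pderiv)
qed

lemma sum_gauss_weight: "(\<Sum>t\<in>{1..Suc D}. gauss_weight D t) = 1"
proof -
  have "gauss_functional D 1 = (\<Sum>j\<le>D. if j = 0 then 1 else 0)"
    unfolding gauss_functional_def by (intro sum.cong) auto
  also have "\<dots> = 1" by (subst sum.delta) auto
  finally show ?thesis using gauss_quadrature[of 1 D] by simp
qed

definition grid :: "nat \<Rightarrow> nat \<Rightarrow> (nat \<Rightarrow> nat) set" where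
  "grid D m = PiE {..<m} (\<lambda>_. {1..Suc D})"

definition gauss_sum :: "nat \<Rightarrow> nat \<Rightarrow> ((nat \<Rightarrow> complex) \<Rightarrow> complex) \<Rightarrow> complex" where
  "gauss_sum D m g = (\<Sum>t\<in>grid D m. (\<Prod>r<m. gauss_weight D (t r)) * g (\<lambda>r. of_nat (t r)))"

definition linear_form :: "nat \<Rightarrow> (nat \<Rightarrow> complex) \<Rightarrow> (nat \<Rightarrow> complex) \<Rightarrow> complex" where
  "linear_form m a t = (\<Sum>r<m. a r * t r)"

lemma gauss_sum_linear:
  "gauss_sum D m (\<lambda>t. c * g t) = c * gauss_sum D m g"
  "gauss_sum D m (\<lambda>t. g t + h t) = gauss_sum D m g + gauss_sum D m h"
  "gauss_sum D m (\<lambda>t. \<Sum>i\<in>A. f i t) = (\<Sum>i\<in>A. gauss_sum D m (f i))"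
  unfolding gauss_sum_def
    apply (simp add: sum_distrib_left mult_ac)
   apply (simp add: sum.distrib algebra_simps)
  unfolding sum_distrib_left by (rule sum.swap)

text \<open>
  Split off the coordinate \<open>r\<close>: for fixed values of the others, \<open>g\<close> is a polynomial in it, and the quadrature in
  this coordinate obeys integration by parts.
\<close>

lemma gauss_sum_by_parts:
  assumes r: "r < m"
    and P: "\<And>t z. g (t(r := z)) = poly (P t) z" "\<And>t. degree (P t) < D" "\<And>t z. P (t(r := z)) = P t"
  shows "gauss_sum D m (\<lambda>t. t r * g t) = gauss_sum D m (\<lambda>t. poly (pderiv (P t)) (t r))"
proof -
  let ?X = "{1..Suc D}" and ?C = "{..<m} - {r}"
  let ?w = "\<lambda>s. \<Prod>q\<in>?C. gauss_weight D (s q)"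
  define c :: "(nat \<Rightarrow> nat) \<Rightarrow> nat \<Rightarrow> complex" where "c = (\<lambda>t r. of_nat (t r))"
  have split: "gauss_sum D m h = (\<Sum>s\<in>PiE ?C (\<lambda>_. ?X). ?w s * (\<Sum>z\<in>?X. gauss_weight D z * h ((c s)(r := of_nat z))))"
    for h
  proof -
    have ins: "{..<m} = insert r ?C" using r by auto
    have "gauss_sum D m h = (\<Sum>s\<in>PiE ?C (\<lambda>_. ?X). \<Sum>z\<in>?X.
        (\<Prod>q<m. gauss_weight D ((s(r := z)) q)) * h (c (s(r := z))))"
      unfolding gauss_sum_def grid_def c_def by (subst ins, subst sum_PiE_insert) simp_all
    also have "\<dots> = (\<Sum>s\<in>PiE ?C (\<lambda>_. ?X). \<Sum>z\<in>?X. ?w s * (gauss_weight D z * h ((c s)(r := of_nat z))))"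
    proof (intro sum.cong refl)
      fix z s
      have "(\<Prod>q<m. gauss_weight D ((s(r := z)) q)) = gauss_weight D z * ?w s"
        using r by (simp add: prod.remove[of "{..<m}" r])
      moreover have "c (s(r := z)) = (c s)(r := of_nat z)" by (auto simp: c_def)
      ultimately show "(\<Prod>q<m. gauss_weight D ((s(r := z)) q)) * h (c (s(r := z)))
          = ?w s * (gauss_weight D z * h ((c s)(r := of_nat z)))" by simp
    qed
    also have "\<dots> = (\<Sum>s\<in>PiE ?C (\<lambda>_. ?X). ?w s * (\<Sum>z\<in>?X. gauss_weight D z * h ((c s)(r := of_nat z))))"
      unfolding sum_distrib_left by (rule refl)
    finally show ?thesis .
  qed
  show ?thesis
    unfolding split using gauss_weight_by_parts[OF P(2)] by (simp add: P(1,3))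
qed

lemma linear_form_upd: "r < m \<Longrightarrow> linear_form m a (t(r := z)) = linear_form m a (t(r := 0)) + a r * z"
proof -
  assume r: "r < m"
  have "linear_form m a (t(r := y)) = a r * y + (\<Sum>q\<in>{..<m} - {r}. a q * t q)" for y
    unfolding linear_form_def using r by (subst sum.remove[of _ r]) (auto intro!: sum.cong)
  from this[of z] this[of 0] show ?thesis by simp
qed

definition sum_squares :: "nat \<Rightarrow> (nat \<Rightarrow> complex) \<Rightarrow> complex" where "sum_squares m t = (\<Sum>r<m. t r * t r)"

lemma sum_squares_upd: "r < m \<Longrightarrow> sum_squares m (t(r := z)) = sum_squares m (t(r := 0)) + z * z"
proof -
  assume r: "r < m"
  have "sum_squares m (t(r := y)) = y * y + (\<Sum>q\<in>{..<m} - {r}. t q * t q)" for y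
    unfolding sum_squares_def using r by (subst sum.remove[of _ r]) (auto intro!: sum.cong)
  from this[of z] this[of 0] show ?thesis by simp
qed

definition form_product :: "nat \<Rightarrow> (nat \<Rightarrow> nat \<Rightarrow> complex) \<Rightarrow> nat set \<Rightarrow> (nat \<Rightarrow> complex) \<Rightarrow> complex" where
  "form_product m \<psi> S t = (\<Prod>i\<in>S. linear_form m (\<psi> i) t)"

lemma degree_prod_linear_le: "finite S \<Longrightarrow> degree (\<Prod>i\<in>S. [:a i, b i:]) \<le> card S"
proof -
  assume "finite S"
  then have "degree (\<Prod>i\<in>S. [:a i, b i:]) \<le> (\<Sum>i\<in>S. degree [:a i, b i:])"
    using degree_prod_sum_le[of S "\<lambda>i. [:a i, b i:]"] by (simp add: o_def)
  also have "\<dots> \<le> (\<Sum>i\<in>S. 1)" by (rule sum_mono) simp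
  finally show ?thesis by simp
qed

lemma poly_form_product:
  assumes "r < m"
  shows "form_product m \<psi> S (t(r := z)) = poly (\<Prod>i\<in>S. [:linear_form m (\<psi> i) (t(r := 0)), \<psi> i r:]) z"
  unfolding form_product_def poly_prod by (intro prod.cong refl) (subst linear_form_upd[OF assms], simp)

lemma poly_pderiv_form_product:
  assumes "r < m"
  shows "poly (pderiv (\<Prod>i\<in>S. [:linear_form m (\<psi> i) (t(r := 0)), \<psi> i r:])) (t r)
       = (\<Sum>i\<in>S. \<psi> i r * form_product m \<psi> (S - {i}) t)"
proof -
  have "poly (\<Prod>i\<in>T. [:linear_form m (\<psi> i) (t(r := 0)), \<psi> i r:]) (t r) = form_product m \<psi> T t" for T
    using poly_form_product[OF assms, of \<psi> T t "t r"] by simp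
  then show ?thesis by (simp add: pderiv_prod poly_sum pderiv_pCons mult.commute)
qed

text \<open>
  The gradient of a product of linear forms is the sum over the factor that is differentiated, and integrating
  by parts turns multiplication by \<open>\<phi>\<close> into the derivative along \<open>\<phi>\<close>.
\<close>

lemma gauss_sum_Wick:
  assumes "finite S" "card S < D"
  shows "gauss_sum D m (\<lambda>t. linear_form m \<phi> t * form_product m \<psi> S t)
       = (\<Sum>i\<in>S. linear_form m \<phi> (\<psi> i) * gauss_sum D m (form_product m \<psi> (S - {i})))"
proof -
  have "gauss_sum D m (\<lambda>t. linear_form m \<phi> t * form_product m \<psi> S t)
      = (\<Sum>r<m. \<phi> r * gauss_sum D m (\<lambda>t. t r * form_product m \<psi> S t))"
    by (simp add: linear_form_def sum_distrib_right mult.assoc gauss_sum_linear)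
  also have "\<dots> = (\<Sum>r<m. \<phi> r * (\<Sum>i\<in>S. \<psi> i r * gauss_sum D m (form_product m \<psi> (S - {i}))))"
  proof (intro sum.cong refl arg_cong2[of _ _ _ _ times])
    fix r assume "r \<in> {..<m}"
    then have r: "r < m" by simp
    show "gauss_sum D m (\<lambda>t. t r * form_product m \<psi> S t) = (\<Sum>i\<in>S. \<psi> i r * gauss_sum D m (form_product m \<psi> (S - {i})))"
      by (subst gauss_sum_by_parts[OF r, where P = "\<lambda>t. \<Prod>i\<in>S. [:linear_form m (\<psi> i) (t(r := 0)), \<psi> i r:]"])
         (simp_all add: poly_form_product[OF r] poly_pderiv_form_product[OF r] gauss_sum_linear
           le_less_trans[OF degree_prod_linear_le[OF assms(1)] assms(2)])
  qed
  also have "\<dots> = (\<Sum>i\<in>S. linear_form m \<phi> (\<psi> i) * gauss_sum D m (form_product m \<psi> (S - {i})))"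
    unfolding sum_distrib_left linear_form_def sum_distrib_right
    by (subst sum.swap) (simp add: mult.assoc)
  finally show ?thesis .
qed

text \<open>
  Multiplication by the sum of squares is integration by parts against the Euler field \<open>\<Sum> t\<^sub>r \<partial>\<^sub>r\<close>: its divergence
  contributes \<open>m\<close>, and homogeneity contributes the degree \<open>card S + 2q\<close>.
\<close>

lemma gauss_sum_sq:
  assumes "finite S" "card S + 2 * q + 1 < D"
  shows "gauss_sum D m (\<lambda>t. sum_squares m t ^ Suc q * form_product m \<psi> S t)
       = of_nat (m + card S + 2 * q) * gauss_sum D m (\<lambda>t. sum_squares m t ^ q * form_product m \<psi> S t)"
proof -
  let ?g = "\<lambda>t. sum_squares m t ^ q * form_product m \<psi> S t"
  have "gauss_sum D m (\<lambda>t. sum_squares m t ^ Suc q * form_product m \<psi> S t)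
      = (\<Sum>r<m. gauss_sum D m (\<lambda>t. t r * (t r * ?g t)))"
    unfolding gauss_sum_linear(3)[symmetric]
    by (simp add: sum_squares_def[of m] sum_distrib_right sum_distrib_left mult_ac)
  also have "\<dots> = (\<Sum>r<m. gauss_sum D m (\<lambda>t. ?g t + of_nat (2 * q) * (t r * t r * (sum_squares m t ^ (q - 1) * form_product m \<psi> S t))
      + (\<Sum>i\<in>S. sum_squares m t ^ q * ((\<psi> i r * t r) * form_product m \<psi> (S - {i}) t))))"
  proof (intro sum.cong refl)
    fix r assume "r \<in> {..<m}"
    then have r: "r < m" by simp
    define Q where "Q t = [:sum_squares m (t(r := 0)), 0, 1:]" for t :: "nat \<Rightarrow> complex"
    define L where "L t = (\<Prod>i\<in>S. [:linear_form m (\<psi> i) (t(r := 0)), \<psi> i r:])" for t :: "nat \<Rightarrow> complex"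
    have Q: "sum_squares m (t(r := z)) = poly (Q t) z" for t z
      by (subst sum_squares_upd[OF r]) (simp add: Q_def)
    have Q': "poly (Q t) (t r) = sum_squares m t" for t using Q[of t "t r"] by simp
    have L': "poly (L t) (t r) = form_product m \<psi> S t" for t
      using poly_form_product[OF r, of \<psi> S t "t r"] by (simp add: L_def)
    have dL: "degree (L t) \<le> card S" for t unfolding L_def by (rule degree_prod_linear_le[OF assms(1)])
    have dQ: "degree (Q t ^ q) \<le> 2 * q" for t
      using degree_power_le[of "Q t" q] by (simp add: Q_def)
    have "degree ([:0, 1:] * (Q t ^ q * L t)) \<le> 1 + (2 * q + card S)" for t
      using degree_mult_le[of "[:0, 1:]" "Q t ^ q * L t"] degree_mult_le[of "Q t ^ q" "L t"] dL[of t] dQ[of t] by simp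
    moreover have "1 + (2 * q + card S) < D" using assms(2) by simp
    ultimately have deg: "degree ([:0, 1:] * (Q t ^ q * L t)) < D" for t
      by (rule le_less_trans)
    have "gauss_sum D m (\<lambda>t. t r * (t r * ?g t)) = gauss_sum D m (\<lambda>t. poly (pderiv ([:0, 1:] * (Q t ^ q * L t))) (t r))"
      by (rule gauss_sum_by_parts[OF r _ deg]) (simp_all add: Q poly_form_product[OF r] L_def[symmetric], simp add: Q_def L_def)
    also have "\<dots> = gauss_sum D m (\<lambda>t. ?g t + of_nat (2 * q) * (t r * t r * (sum_squares m t ^ (q - 1) * form_product m \<psi> S t))
      + (\<Sum>i\<in>S. sum_squares m t ^ q * ((\<psi> i r * t r) * form_product m \<psi> (S - {i}) t)))"
    proof (rule arg_cong[where f = "gauss_sum D m"], rule ext)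
      fix t
      have dL': "poly (pderiv (L t)) (t r) = (\<Sum>i\<in>S. \<psi> i r * form_product m \<psi> (S - {i}) t)"
        unfolding L_def by (rule poly_pderiv_form_product[OF r])
      have dQ': "poly (pderiv (Q t ^ q)) (t r) = of_nat (2 * q) * (t r * sum_squares m t ^ (q - 1))"
        unfolding pderiv_power poly_mult poly_smult poly_power Q'
        by (simp add: Q_def pderiv_pCons)
      show "poly (pderiv ([:0, 1:] * (Q t ^ q * L t))) (t r)
          = ?g t + of_nat (2 * q) * (t r * t r * (sum_squares m t ^ (q - 1) * form_product m \<psi> S t))
      + (\<Sum>i\<in>S. sum_squares m t ^ q * ((\<psi> i r * t r) * form_product m \<psi> (S - {i}) t))"
        unfolding pderiv_mult[of "[:0, 1:]"] pderiv_mult[of "Q t ^ q"] poly_add poly_mult dL' dQ' L' poly_power Q'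
        by (simp add: pderiv_pCons algebra_simps sum_distrib_left)
    qed
    finally show "gauss_sum D m (\<lambda>t. t r * (t r * ?g t)) = \<dots>" .
  qed
  also have "\<dots> = gauss_sum D m (\<lambda>t. \<Sum>r<m. ?g t + of_nat (2 * q) * (t r * t r * (sum_squares m t ^ (q - 1) * form_product m \<psi> S t))
      + (\<Sum>i\<in>S. sum_squares m t ^ q * ((\<psi> i r * t r) * form_product m \<psi> (S - {i}) t)))"
    by (simp only: gauss_sum_linear(3))
  also have "\<dots> = gauss_sum D m (\<lambda>t. of_nat (m + card S + 2 * q) * ?g t)"
  proof (rule arg_cong[where f = "gauss_sum D m"], rule ext)
    fix t
    have a: "(\<Sum>r<m. of_nat (2 * q) * (t r * t r * (sum_squares m t ^ (q - 1) * form_product m \<psi> S t)))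
        = of_nat (2 * q) * (sum_squares m t * sum_squares m t ^ (q - 1) * form_product m \<psi> S t)"
      unfolding sum_distrib_left[symmetric] sum_distrib_right[symmetric] sum_squares_def[symmetric] by simp
    have b: "of_nat (2 * q) * (sum_squares m t * sum_squares m t ^ (q - 1) * form_product m \<psi> S t) = of_nat (2 * q) * ?g t"
      by (cases q) simp_all
    have "(\<Sum>r<m. \<Sum>i\<in>S. sum_squares m t ^ q * ((\<psi> i r * t r) * form_product m \<psi> (S - {i}) t))
        = (\<Sum>i\<in>S. sum_squares m t ^ q * (linear_form m (\<psi> i) t * form_product m \<psi> (S - {i}) t))"
      by (subst sum.swap) (simp add: sum_distrib_left sum_distrib_right linear_form_def)
    also have "\<dots> = (\<Sum>i\<in>S. ?g t)"
      by (intro sum.cong refl) (simp add: form_product_def prod.remove[OF assms(1)])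
    also have "\<dots> = of_nat (card S) * ?g t" by simp
    finally have d: "(\<Sum>r<m. \<Sum>i\<in>S. sum_squares m t ^ q * ((\<psi> i r * t r) * form_product m \<psi> (S - {i}) t)) = of_nat (card S) * ?g t" .
    show "(\<Sum>r<m. ?g t + of_nat (2 * q) * (t r * t r * (sum_squares m t ^ (q - 1) * form_product m \<psi> S t))
      + (\<Sum>i\<in>S. sum_squares m t ^ q * ((\<psi> i r * t r) * form_product m \<psi> (S - {i}) t))) = of_nat (m + card S + 2 * q) * ?g t"
      unfolding sum.distrib d a b by (simp add: algebra_simps)
  qed
  finally show ?thesis by (simp only: gauss_sum_linear(1))
qed

lemma gauss_sum_sq_power:
  assumes "finite S" "card S + 2 * q < D"
  shows "gauss_sum D m (\<lambda>t. sum_squares m t ^ q * form_product m \<psi> S t)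
       = (\<Prod>l<q. of_nat (m + card S + 2 * l)) * gauss_sum D m (form_product m \<psi> S)"
  using assms(2)
proof (induction q)
  case (Suc q)
  then show ?case using gauss_sum_sq[OF assms(1), of q D m \<psi>] by simp
qed simp

lemma gauss_sum_1: "gauss_sum D m (\<lambda>_. 1) = 1"
proof -
  have "gauss_sum D m (\<lambda>_. 1) = (\<Prod>r<m. \<Sum>t\<in>{1..Suc D}. gauss_weight D t)"
    unfolding gauss_sum_def grid_def by (subst prod_sum_PiE) auto
  then show ?thesis unfolding sum_gauss_weight by simp
qed

text \<open>
  Project the points of the grid to the sphere. On forms of degree \<open>2j \<le> 2N\<close>, a weight \<open>s ^ (2N)\<close> at a point of norm \<open>s\<close>
  compensates for the projection up to the factor \<open>s ^ (2N - 2j)\<close>, whose Gaussian effect is the constant computed in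
  \<open>gauss_sum_sq_power\<close>. Odd degrees involve odd powers of \<open>s\<close>, which are not polynomial; they are cancelled by
  giving antipodal points the same weight.
\<close>

lemma sphere_cubature:
  assumes "m \<ge> 1"
  obtains I :: "((nat \<Rightarrow> nat) \<times> bool) set" and u :: "(nat \<Rightarrow> nat) \<times> bool \<Rightarrow> nat \<Rightarrow> real"
    and c :: "(nat \<Rightarrow> nat) \<times> bool \<Rightarrow> complex"
  where "finite I" "\<And>i. i \<in> I \<Longrightarrow> (\<Sum>r<m. u i r * u i r) = 1" "(\<Sum>i\<in>I. c i) = 1"
    and "\<And>S \<psi>. finite S \<Longrightarrow> odd (card S) \<Longrightarrow> (\<Sum>i\<in>I. c i * form_product m \<psi> S (\<lambda>r. of_real (u i r))) = 0"
    and "\<And>S \<psi> j. finite S \<Longrightarrow> even (card S) \<Longrightarrow> card S \<le> 2 * N \<Longrightarrow> j \<in> S \<Longrightarrow>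
       of_nat (m + card S - 2) * (\<Sum>i\<in>I. c i * form_product m \<psi> S (\<lambda>r. of_real (u i r)))
       = (\<Sum>l\<in>S - {j}. linear_form m (\<psi> j) (\<psi> l) * (\<Sum>i\<in>I. c i * form_product m \<psi> (S - {j, l}) (\<lambda>r. of_real (u i r))))"
proof -
  define D where "D = 2 * N + 2"
  define I where "I = grid D m \<times> (UNIV :: bool set)"
  define C :: complex where "C = (\<Prod>l<N. of_nat (m + 2 * l))"
  define s :: "(nat \<Rightarrow> nat) \<Rightarrow> real" where "s t = sqrt (\<Sum>r<m. real (t r) * real (t r))" for t
  define u :: "(nat \<Rightarrow> nat) \<times> bool \<Rightarrow> nat \<Rightarrow> real"
    where "u = (\<lambda>(t, e) r. (if e then 1 else -1) * (real (t r) / s t))"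
  define w where "w t = (\<Prod>r<m. gauss_weight D (t r)) * sum_squares m (\<lambda>r. of_nat (t r)) ^ N / (2 * C)" for t
  define c where "c = (\<lambda>(t :: nat \<Rightarrow> nat, e :: bool). w t)"
  have C: "C \<noteq> 0" using assms unfolding C_def prod_zero_iff[OF finite_lessThan] of_nat_eq_0_iff by simp
  have finI: "finite I" unfolding I_def grid_def by (intro finite_SigmaI finite_PiE) auto
  have s2: "s t * s t = (\<Sum>r<m. real (t r) * real (t r))" for t
    unfolding s_def by (rule real_sqrt_mult_self[THEN trans]) (simp add: sum_nonneg)
  have spos: "s t > 0" if "t \<in> grid D m" for t
  proof -
    have "t 0 \<ge> 1" using that assms by (auto simp: grid_def PiE_iff)
    then have "0 < real (t 0) * real (t 0)" by simp
    also have "\<dots> \<le> (\<Sum>r<m. real (t r) * real (t r))"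
      using assms by (intro member_le_sum) auto
    finally show ?thesis by (simp add: s_def)
  qed
  have sqs: "sum_squares m (\<lambda>r. of_nat (t r)) = of_real (s t * s t)" for t
    unfolding s2 by (simp add: sum_squares_def)
  have unit: "(\<Sum>r<m. u i r * u i r) = 1" if "i \<in> I" for i
  proof -
    obtain t e where i: "i = (t, e)" "t \<in> grid D m" using \<open>i \<in> I\<close> unfolding I_def by blast
    have "(\<Sum>r<m. u i r * u i r) = (\<Sum>r<m. real (t r) * real (t r)) / (s t * s t)"
      unfolding sum_divide_distrib by (intro sum.cong) (auto simp: u_def i)
    then have "(\<Sum>r<m. u i r * u i r) = (s t * s t) / (s t * s t)" by (simp only: s2)
    then show ?thesis using spos[OF i(2)] by simp
  qed
  have lin_u: "form_product m \<psi> S (\<lambda>r. of_real (u (t, e) r))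
      = (if e then 1 else -1) ^ card S * (form_product m \<psi> S (\<lambda>r. of_nat (t r)) / of_real (s t) ^ card S)" for \<psi> S t e
  proof -
    have "linear_form m a (\<lambda>r. of_real (u (t, e) r)) = (if e then 1 else -1) * (linear_form m a (\<lambda>r. of_nat (t r)) / of_real (s t))" for a
      unfolding linear_form_def sum_divide_distrib sum_distrib_left by (intro sum.cong) (auto simp: u_def)
    then show ?thesis by (simp add: form_product_def prod.distrib prod_dividef)
  qed
  define E where "E \<psi> S = (\<Sum>i\<in>I. c i * form_product m \<psi> S (\<lambda>r. of_real (u i r)))" for \<psi> S
  have E_split: "E \<psi> S = (\<Sum>t\<in>grid D m. \<Sum>e\<in>UNIV. w t * form_product m \<psi> S (\<lambda>r. of_real (u (t, e) r)))" for \<psi> S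
    unfolding E_def I_def c_def by (subst sum.cartesian_product) (rule sum.cong, auto)
  have E_odd: "E \<psi> S = 0" if "odd (card S)" for \<psi> S
    unfolding E_split lin_u UNIV_bool using that by simp
  have E_even: "E \<psi> S = (\<Prod>l<N - j. of_nat (m + card S + 2 * l)) * gauss_sum D m (form_product m \<psi> S) / C"
    if "finite S" "card S = 2 * j" "j \<le> N" for \<psi> S j
  proof -
    have "E \<psi> S = (\<Sum>t\<in>grid D m. (\<Prod>r<m. gauss_weight D (t r)) *
        (sum_squares m (\<lambda>r. of_nat (t r)) ^ (N - j) * form_product m \<psi> S (\<lambda>r. of_nat (t r))) / C)"
      unfolding E_split lin_u UNIV_bool
    proof (intro sum.cong refl)
      fix t assume t: "t \<in> grid D m"
      define z :: complex where "z = of_real (s t)"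
      have z: "z \<noteq> 0" using spos[OF t] by (simp add: z_def)
      have zz: "sum_squares m (\<lambda>r. of_nat (t r)) = z ^ 2" by (simp add: sqs z_def power2_eq_square)
      have pw: "z ^ (2 * N) / z ^ (2 * j) = z ^ (2 * (N - j))"
        using z that(3) by (simp add: power_diff[symmetric] diff_mult_distrib2)
      show "(\<Sum>e\<in>{False, True}. w t * ((if e then 1 else -1) ^ card S * (form_product m \<psi> S (\<lambda>r. of_nat (t r)) / of_real (s t) ^ card S)))
          = (\<Prod>r<m. gauss_weight D (t r)) * (sum_squares m (\<lambda>r. of_nat (t r)) ^ (N - j) * form_product m \<psi> S (\<lambda>r. of_nat (t r))) / C"
        unfolding w_def zz that(2) power_mult[symmetric] z_def[symmetric] pw[symmetric] by (simp add: mult_ac)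
    qed
    also have "\<dots> = gauss_sum D m (\<lambda>t. sum_squares m t ^ (N - j) * form_product m \<psi> S t) / C"
      unfolding gauss_sum_def sum_divide_distrib ..
    also have "\<dots> = (\<Prod>l<N - j. of_nat (m + card S + 2 * l)) * gauss_sum D m (form_product m \<psi> S) / C"
      by (subst gauss_sum_sq_power[OF that(1)]) (use that in \<open>auto simp: D_def\<close>)
    finally show ?thesis .
  qed
  have E_1: "(\<Sum>i\<in>I. c i) = 1"
  proof -
    have "(\<Sum>i\<in>I. c i) = E (\<lambda>_ _. 0) {}" by (simp add: E_def form_product_def)
    also have "\<dots> = 1"
      using E_even[of "{}" 0] gauss_sum_1[of D m] C by (simp add: C_def form_product_def[abs_def])
    finally show ?thesis .
  qed
  have E_Wick: "of_nat (m + card S - 2) * E \<psi> S = (\<Sum>l\<in>S - {j}. linear_form m (\<psi> j) (\<psi> l) * E \<psi> (S - {j, l}))"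
    if S: "finite S" "even (card S)" "card S \<le> 2 * N" "j \<in> S" for \<psi> S j
  proof -
    have "card S > 0" using S by (auto simp: card_gt_0_iff)
    then obtain p where p: "card S = 2 * Suc p" using S(2) by (metis evenE gr0_implies_Suc mult_0_right not_gr0)
    have pN: "Suc p \<le> N" using p S(3) by simp
    define K :: complex where "K = (\<Prod>l<N - Suc p. of_nat (m + card S + 2 * l))"
    have K: "(\<Prod>l<N - p. of_nat (m + 2 * p + 2 * l)) = of_nat (m + 2 * p) * K"
    proof -
      have "N - p = Suc (N - Suc p)" using pN by simp
      then show ?thesis unfolding K_def p by (simp only: prod.lessThan_Suc_shift) (simp add: algebra_simps)
    qed
    have "E \<psi> S = K * gauss_sum D m (form_product m \<psi> S) / C"
      unfolding K_def by (rule E_even) (use S p pN in auto)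
    also have "gauss_sum D m (form_product m \<psi> S) = gauss_sum D m (\<lambda>t. linear_form m (\<psi> j) t * form_product m \<psi> (S - {j}) t)"
      by (simp add: form_product_def[abs_def] prod.remove[OF S(1,4)])
    also have "\<dots> = (\<Sum>l\<in>S - {j}. linear_form m (\<psi> j) (\<psi> l) * gauss_sum D m (form_product m \<psi> (S - {j} - {l})))"
      by (rule gauss_sum_Wick) (use S in \<open>auto simp: D_def\<close>)
    finally have "of_nat (m + 2 * p) * E \<psi> S
        = (\<Sum>l\<in>S - {j}. linear_form m (\<psi> j) (\<psi> l) * (of_nat (m + 2 * p) * K * gauss_sum D m (form_product m \<psi> (S - {j} - {l})) / C))"
      by (simp add: sum_distrib_left sum_divide_distrib mult_ac)
    also have "\<dots> = (\<Sum>l\<in>S - {j}. linear_form m (\<psi> j) (\<psi> l) * E \<psi> (S - {j, l}))"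
    proof (intro sum.cong refl arg_cong2[of _ _ _ _ times])
      fix l assume l: "l \<in> S - {j}"
      have "card (S - {j, l}) = 2 * p" using l S p by (subst card_Diff_subset) auto
      moreover have "S - {j} - {l} = S - {j, l}" by auto
      ultimately show "of_nat (m + 2 * p) * K * gauss_sum D m (form_product m \<psi> (S - {j} - {l})) / C = E \<psi> (S - {j, l})"
        using E_even[of "S - {j, l}" p \<psi>] S(1) pN K by simp
    qed
    finally show ?thesis using p by simp
  qed
  show ?thesis
    by (rule that[of I u c]) (use finI unit E_1 E_odd E_Wick in \<open>simp_all only: E_def\<close>)
qed

section \<open>Orthonormal bases, determinants and reflections\<close>

lemma vector_space_complex: "vector_space ((*) :: complex \<Rightarrow> complex \<Rightarrow> complex)"
  by unfold_locales (auto simp: algebra_simps)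

lemma ex_csqrt: "\<exists>z::complex. z * z = x"
  by (metis power2_csqrt power2_eq_square)

locale form_space = vector_space scale
  for scale :: "complex \<Rightarrow> 'v::ab_group_add \<Rightarrow> 'v" (infixr "*s" 75) +
  fixes b :: "'v \<Rightarrow> 'v \<Rightarrow> complex"
  assumes form: "symmetric_bilinear_form scale b"
begin

lemma b_commute: "b x y = b y x"
  using form by (simp add: symmetric_bilinear_form_def)

lemma b_add_right: "b x (y + z) = b x y + b x z" and b_scale_right: "b x (c *s y) = c * b x y"
  using form by (auto simp: symmetric_bilinear_form_def Vector_Spaces.linear_iff)

lemma b_add_left: "b (y + z) x = b y x + b z x" and b_scale_left: "b (c *s y) x = c * b y x"
  by (simp_all add: b_commute[of _ x] b_add_right b_scale_right)

lemma b_zero_right [simp]: "b x 0 = 0"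
  using b_add_right[of x 0 0] by simp

lemma b_zero_left [simp]: "b 0 x = 0"
  by (simp add: b_commute[of 0])

lemma b_sum_right: "b x (\<Sum>i\<in>A. f i) = (\<Sum>i\<in>A. b x (f i))"
  by (induction A rule: infinite_finite_induct) (simp_all add: b_add_right)

lemma b_sum_left: "b (\<Sum>i\<in>A. f i) x = (\<Sum>i\<in>A. b (f i) x)"
  by (simp add: b_commute[of _ x] b_sum_right)

lemma b_minus_right: "b x (- y) = - b x y"
  using b_scale_right[of x "-1" y] by simp

lemma b_minus_left: "b (- y) x = - b y x"
  by (simp add: b_commute[of _ x] b_minus_right)

lemma b_diff_right: "b x (y - z) = b x y - b x z"
  using b_add_right[of x y "- z"] by (simp add: b_minus_right)

lemma b_diff_left: "b (y - z) x = b y x - b z x"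
  by (simp add: b_commute[of _ x] b_diff_right)

lemmas b_simps = b_add_left b_add_right b_scale_left b_scale_right b_sum_left b_sum_right
  b_minus_left b_minus_right b_diff_left b_diff_right

definition orthonormal :: "'v list \<Rightarrow> bool" where
  "orthonormal xs \<longleftrightarrow> (\<forall>r<length xs. \<forall>s<length xs. b (xs ! r) (xs ! s) = of_bool (r = s))"

lemma orthonormal_distinct: "orthonormal xs \<Longrightarrow> distinct xs"
  unfolding orthonormal_def distinct_conv_nth by (metis of_bool_eq(1) of_bool_eq(2) zero_neq_one)

lemma orthonormal_independent:
  assumes "orthonormal xs" shows "independent (set xs)"
proof (rule independent_if_scalars_zero)
  fix f x assume sum: "(\<Sum>x\<in>set xs. f x *s x) = 0" and x: "x \<in> set xs"
  obtain r where r: "r < length xs" "x = xs ! r" using x by (auto simp: in_set_conv_nth)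
  have "b x y = of_bool (y = x)" if "y \<in> set xs" for y
  proof -
    obtain s where s: "s < length xs" "y = xs ! s" using \<open>y \<in> set xs\<close> by (auto simp: in_set_conv_nth)
    then show ?thesis
      using assms r orthonormal_distinct[OF assms] by (auto simp: orthonormal_def nth_eq_iff_index_eq)
  qed
  then have "b x (\<Sum>x\<in>set xs. f x *s x) = (\<Sum>y\<in>set xs. if y = x then f y else 0)"
    unfolding b_sum_right b_scale_right by (intro sum.cong) auto
  then show "f x = 0" using sum x by simp
qed simp

text \<open>
  Take a longest orthonormal extension. A vector orthogonal to all of it is isotropic, since otherwise it could
  be normalized (complex numbers have square roots) and added. By polarization the form then vanishes on the
  orthogonal complement, which is therefore zero by nondegeneracy.
\<close>

lemma orthonormal_extension:
  assumes nondeg: "nondegenerate_form b" and B: "finite B" "independent B" "span B = UNIV"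
    and xs: "orthonormal xs"
  obtains ys where "orthonormal (xs @ ys)" "length (xs @ ys) = card B"
    "\<And>v. v = (\<Sum>r<card B. b ((xs @ ys) ! r) v *s ((xs @ ys) ! r))"
proof -
  have bound: "length zs \<le> card B" if "orthonormal zs" for zs
    using independent_span_bound[OF B(1) orthonormal_independent[OF that]] B(3)
      distinct_card[OF orthonormal_distinct[OF that]] by simp
  define Q where "Q l \<longleftrightarrow> (\<exists>ys. orthonormal (xs @ ys) \<and> length (xs @ ys) = l)" for l
  have "Q (length xs)" using xs unfolding Q_def by (intro exI[of _ "[]"]) simp
  moreover have "\<And>l. Q l \<Longrightarrow> l \<le> card B" unfolding Q_def using bound by blast
  ultimately obtain l where l: "Q l" "\<And>l'. Q l' \<Longrightarrow> l' \<le> l"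
    by (metis Greatest_le_nat GreatestI_nat)
  then obtain ys where ys: "orthonormal (xs @ ys)" "length (xs @ ys) = l" by (auto simp: Q_def)
  define zs where "zs = xs @ ys"
  have zs: "orthonormal zs" "length zs = l" using ys by (simp_all add: zs_def)
  define pr where "pr v = (\<Sum>r<l. b (zs ! r) v *s (zs ! r))" for v
  have orth: "b (zs ! s) (v - pr v) = 0" if "s < l" for s v
  proof -
    have "b (zs ! s) (pr v) = (\<Sum>r<l. if r = s then b (zs ! r) v else 0)"
      unfolding pr_def b_sum_right b_scale_right using zs that
      by (intro sum.cong) (auto simp: orthonormal_def)
    then show ?thesis using that by (simp add: b_diff_right)
  qed
  have isotropic: "b w w = 0" if w: "\<And>s. s < l \<Longrightarrow> b (zs ! s) w = 0" for w
  proof (rule ccontr)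
    assume nz: "b w w \<noteq> 0"
    obtain c where c: "c * c = b w w" using ex_csqrt by blast
    then have c0: "c \<noteq> 0" using nz by auto
    have one: "b ((1 / c) *s w) ((1 / c) *s w) = 1" using c c0 by (simp add: b_scale_left b_scale_right c[symmetric])
    have zero: "b (zs ! s) ((1 / c) *s w) = 0" "b ((1 / c) *s w) (zs ! s) = 0" if "s < l" for s
      using w[OF that] by (simp_all add: b_scale_right b_scale_left b_commute[of w])
    have "orthonormal (zs @ [(1 / c) *s w])"
      unfolding orthonormal_def using zs one zero
      by (auto simp: nth_append less_Suc_eq orthonormal_def)
    then have "Q (Suc l)" using zs(2) unfolding Q_def zs_def by (intro exI[of _ "ys @ [(1 / c) *s w]"]) simp
    then show False using l(2)[of "Suc l"] by simp
  qed
  have expand: "v = pr v" for v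
  proof -
    define w where "w = v - pr v"
    have w: "b (zs ! s) w = 0" if "s < l" for s using orth[OF that] by (simp add: w_def)
    have "b w u = 0" for u
    proof -
      define u' where "u' = u - pr u"
      have u': "b (zs ! s) u' = 0" if "s < l" for s using orth[OF that] by (simp add: u'_def)
      have "b w (pr u) = 0" unfolding pr_def b_sum_right b_scale_right using w by (simp add: b_commute[of w])
      moreover have "b w u' = 0"
      proof -
        have "b (w + u') (w + u') = 0" by (rule isotropic) (simp add: b_add_right w u')
        moreover have "b w w = 0" "b u' u' = 0" by (rule isotropic, simp add: w u')+
        ultimately show ?thesis by (simp add: b_add_left b_add_right b_commute[of u' w])
      qed
      ultimately show ?thesis unfolding u'_def by (simp add: b_diff_right)
    qed
    then have "w = 0" using nondeg by (auto simp: nondegenerate_form_def)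
    then show ?thesis by (simp add: w_def)
  qed
  have "v \<in> span (set zs)" for v
    by (subst expand, unfold pr_def) (intro span_sum span_scale span_base nth_mem, simp add: zs(2))
  then have "B \<subseteq> span (set zs)" by auto
  then have "card B \<le> card (set zs)"
    using independent_span_bound[of "set zs" B] B(2) by simp
  then have "card B = l"
    using distinct_card[OF orthonormal_distinct[OF zs(1)]] bound[OF zs(1)] zs(2) by simp
  then show ?thesis using that[of ys] zs expand by (simp add: zs_def pr_def)
qed

end

locale orthonormal_space = form_space scale b
  for scale :: "complex \<Rightarrow> 'v::ab_group_add \<Rightarrow> 'v" (infixr "*s" 75)
    and b :: "'v \<Rightarrow> 'v \<Rightarrow> complex" +
  fixes e :: "nat \<Rightarrow> 'v" and k :: nat
  assumes e_orthonormal: "r < k \<Longrightarrow> s < k \<Longrightarrow> b (e r) (e s) = of_bool (r = s)"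
    and e_expand: "v = (\<Sum>r<k. b (e r) v *s e r)"
begin

lemma b_eq_sum: "b u v = (\<Sum>r<k. b (e r) u * b (e r) v)"
proof -
  have "b u v = b (\<Sum>r<k. b (e r) u *s e r) v" by (subst e_expand[of u]) (rule refl)
  then show ?thesis by (simp add: b_sum_left b_scale_left)
qed

lemma additive_homogeneous_expand:
  assumes add: "\<And>x y. \<phi> (x + y) = \<phi> x + (\<phi> y :: complex)" and scale: "\<And>c x. \<phi> (c *s x) = c * \<phi> x"
  shows "\<phi> v = (\<Sum>r<k. b (e r) v * \<phi> (e r))"
proof -
  have "\<phi> 0 = 0" using scale[of 0 0] by simp
  then have "\<phi> (\<Sum>r\<in>A. c r *s e r) = (\<Sum>r\<in>A. c r * \<phi> (e r))" for c A
    by (induction A rule: infinite_finite_induct) (simp_all add: add scale)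
  then show ?thesis by (subst e_expand[of v]) simp
qed

lemma linear_expand:
  assumes "Vector_Spaces.linear scale (*) \<phi>"
  shows "\<phi> v = (\<Sum>r<k. b (e r) v * \<phi> (e r))"
  using assms by (intro additive_homogeneous_expand) (simp_all add: Vector_Spaces.linear_iff)

lemma nondegenerate: "nondegenerate_form b"
  unfolding nondegenerate_form_def
proof (intro allI impI)
  fix x assume "\<forall>y. b x y = 0"
  then have "\<And>r. b (e r) x = 0" by (simp add: b_commute[of _ x])
  then show "x = 0" by (subst e_expand[of x]) simp
qed

lemma e_inj: "inj_on e {..<k}"
  using e_orthonormal by (intro inj_onI) (metis lessThan_iff of_bool_eq(1) of_bool_eq(2) zero_neq_one)

lemma e_basis: "finite (e ` {..<k})" "independent (e ` {..<k})" "span (e ` {..<k}) = UNIV" "card (e ` {..<k}) = k"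
proof -
  have "orthonormal (map e [0..<k])" using e_orthonormal by (simp add: orthonormal_def)
  from orthonormal_independent[OF this] show "independent (e ` {..<k})"
    by (simp add: atLeast0LessThan)
  have "v \<in> span (e ` {..<k})" for v
    by (subst e_expand) (intro span_sum span_scale span_base imageI)
  then show "span (e ` {..<k}) = UNIV" by blast
  show "card (e ` {..<k}) = k" using card_image[OF e_inj] by simp
qed simp

definition coord_det :: "(nat \<Rightarrow> 'v) \<Rightarrow> complex" where
  "coord_det y = det (mat k k (\<lambda>(c, r). b (e r) (y c)))"

lemma coord_det_cong: "(\<And>c. c < k \<Longrightarrow> y c = y' c) \<Longrightarrow> coord_det y = coord_det y'"
  unfolding coord_det_def by (intro arg_cong[where f = det] cong_mat) auto

lemma coord_det_leibniz: "coord_det y = (\<Sum>p | p permutes {0..<k}. signof p * (\<Prod>c<k. b (e (p c)) (y c)))"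
  unfolding coord_det_def
  by (subst det_def'[of _ k]) (auto intro!: sum.cong prod.cong simp: permutes_in_image atLeast0LessThan)

lemma coord_det_additive: "c < k \<Longrightarrow> coord_det (y(c := u + v)) = coord_det (y(c := u)) + coord_det (y(c := v))"
  and coord_det_scale: "c < k \<Longrightarrow> coord_det (y(c := a *s u)) = a * coord_det (y(c := u))"
proof -
  assume c: "c < k"
  have "coord_det (y(c := u)) = (\<Sum>p | p permutes {0..<k}. signof p * (b (e (p c)) u * (\<Prod>i\<in>{..<k} - {c}. b (e (p i)) (y i))))" for u
    unfolding coord_det_leibniz using c by (intro sum.cong refl arg_cong2[of _ _ _ _ times]) (auto simp: prod.remove[of _ c])
  note split = this
  show "coord_det (y(c := u + v)) = coord_det (y(c := u)) + coord_det (y(c := v))"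
    unfolding split sum.distrib[symmetric] by (intro sum.cong refl) (simp add: b_add_right algebra_simps)
  show "coord_det (y(c := a *s u)) = a * coord_det (y(c := u))"
    unfolding split sum_distrib_left by (intro sum.cong refl) (simp add: b_scale_right algebra_simps)
qed

lemma coord_det_upd_expand:
  assumes "c < k" shows "coord_det (y(c := u)) = (\<Sum>r<k. b (e r) u * coord_det (y(c := e r)))"
  by (rule additive_homogeneous_expand[where \<phi> = "\<lambda>u. coord_det (y(c := u))", OF coord_det_additive[OF assms] coord_det_scale[OF assms]])

lemma coord_det_identical:
  assumes "i < k" "j < k" "i \<noteq> j" "y i = y j" shows "coord_det y = 0"
  unfolding coord_det_def by (rule det_identical_rows[of _ k i j]) (use assms in auto)

lemma coord_det_permute:
  assumes "p permutes {0..<k}" shows "coord_det (\<lambda>c. y (p c)) = signof p * coord_det y"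
proof -
  have "coord_det (\<lambda>c. y (p c)) = det (mat k k (\<lambda>(c, r). mat k k (\<lambda>(c, r). b (e r) (y c)) $$ (p c, r)))"
    unfolding coord_det_def using permutes_in_image[OF assms] by (intro arg_cong[where f = det] cong_mat) auto
  then show ?thesis
    unfolding coord_det_def by (subst (asm) det_permute_rows[OF _ assms]) auto
qed

lemma coord_det_e [simp]: "coord_det e = 1"
proof -
  have "mat k k (\<lambda>(c, r). b (e r) (e c)) = 1\<^sub>m k" by (rule eq_matI) (auto simp: e_orthonormal)
  then show ?thesis by (simp add: coord_det_def)
qed

text \<open>
  The determinant with respect to the orthonormal basis; \<open>det_endo_eq\<close> identifies it with the one in any other
  basis.
\<close>

definition map_det :: "('v \<Rightarrow> 'v) \<Rightarrow> complex" where "map_det h = coord_det (\<lambda>r. h (e r))"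

lemma linear_map_expand:
  assumes "Vector_Spaces.linear scale scale h"
  shows "b u (h v) = (\<Sum>s<k. b (e s) v * b u (h (e s)))"
  using assms by (intro additive_homogeneous_expand) (simp_all add: Vector_Spaces.linear_iff b_simps)

lemma coord_det_map:
  assumes "Vector_Spaces.linear scale scale h"
  shows "coord_det (\<lambda>c. h (y c)) = map_det h * coord_det y"
proof -
  let ?Y = "mat k k (\<lambda>(c, r). b (e r) (y c))" and ?H = "mat k k (\<lambda>(c, r). b (e r) (h (e c)))"
  have "mat k k (\<lambda>(c, r). b (e r) (h (y c))) = ?Y * ?H"
    by (rule eq_matI) (auto simp: scalar_prod_def atLeast0LessThan linear_map_expand[OF assms, of _ "y _"])
  then show ?thesis
    unfolding map_det_def coord_det_def by (subst det_mult[of ?Y k ?H, symmetric, THEN trans[OF mult.commute]]) auto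
qed

lemma map_det_isometry:
  assumes "Vector_Spaces.linear scale scale h" "\<And>x y. b (h x) (h y) = b x y"
  shows "map_det h = 1 \<or> map_det h = -1"
proof -
  let ?H = "mat k k (\<lambda>(c, r). b (e r) (h (e c)))"
  have "?H * transpose_mat ?H = 1\<^sub>m k"
  proof (rule eq_matI)
    fix i j assume "i < dim_row (1\<^sub>m k)" "j < dim_col (1\<^sub>m k)"
    then have ij: "i < k" "j < k" by auto
    have "(?H * transpose_mat ?H) $$ (i, j) = (\<Sum>r<k. b (e r) (h (e i)) * b (e r) (h (e j)))"
      using ij by (simp add: scalar_prod_def atLeast0LessThan)
    also have "\<dots> = b (h (e i)) (h (e j))" by (rule b_eq_sum[symmetric])
    finally show "(?H * transpose_mat ?H) $$ (i, j) = 1\<^sub>m k $$ (i, j)"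
      using ij by (simp add: assms(2) e_orthonormal)
  qed auto
  then have "det ?H * det ?H = 1"
    using det_mult[of ?H k "transpose_mat ?H"] det_transpose[of ?H k] by simp
  then show ?thesis unfolding map_det_def coord_det_def by (metis mult.right_neutral mult_eq_0_iff square_eq_1_iff)
qed

definition reflection :: "'v \<Rightarrow> 'v \<Rightarrow> 'v" where
  "reflection a v = v - (2 * b v a / b a a) *s a"

lemma reflection_linear: "Vector_Spaces.linear scale scale (reflection a)"
proof -
  have "reflection a (x + y) = reflection a x + reflection a y" for x y
    by (simp add: reflection_def b_add_left add_divide_distrib distrib_left scale_left_distrib)
  moreover have "reflection a (c *s x) = c *s reflection a x" for c x
    by (simp add: reflection_def b_scale_left scale_right_diff_distrib mult.left_commute)
  ultimately show ?thesis using vector_space_axioms by (simp add: Vector_Spaces.linear_iff)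
qed

lemma reflection_isometry:
  assumes "b a a \<noteq> 0" shows "b (reflection a x) (reflection a y) = b x y"
  using assms by (simp add: reflection_def b_simps b_commute[of a x] b_commute[of a y] field_simps)

lemma reflection_involution:
  assumes "b a a \<noteq> 0" shows "reflection a (reflection a x) = x"
proof -
  have "b (reflection a x) a = - b x a" using assms by (simp add: reflection_def b_simps)
  then show ?thesis by (simp add: reflection_def[of a "reflection a x"]) (simp add: reflection_def)
qed

text \<open>
  Extend the normalized vector \<open>a\<close> to an orthonormal basis. The reflection negates its first vector and fixes the
  others, so it multiplies the determinant of this basis, which is not zero, by \<open>- 1\<close>.
\<close>

lemma map_det_reflection:
  assumes a: "b a a \<noteq> 0" shows "map_det (reflection a) = -1"
proof -
  obtain c where c: "c * c = b a a" using ex_csqrt by blast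
  have c0: "c \<noteq> 0" using c a by auto
  define a' where "a' = (1 / c) *s a"
  have "orthonormal [a']" using c0 by (simp add: orthonormal_def a'_def b_simps c[symmetric])
  then obtain ys where ys: "orthonormal ([a'] @ ys)" "length ([a'] @ ys) = k"
    "\<And>v. v = (\<Sum>r<k. b (([a'] @ ys) ! r) v *s (([a'] @ ys) ! r))"
    using orthonormal_extension[OF nondegenerate e_basis(1,2,3)] e_basis(4) by metis
  define f where "f r = ([a'] @ ys) ! r" for r
  have f: "b (f r) (f s) = of_bool (r = s)" if "r < k" "s < k" for r s
    using ys(1) that unfolding orthonormal_def ys(2) f_def by blast
  have f0: "f 0 = a'" and k: "0 < k" using ys(2) by (auto simp: f_def)
  interpret f: orthonormal_space scale b f k
    by unfold_locales (use f ys(3) in \<open>simp_all add: f_def\<close>)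
  have "coord_det f * f.coord_det e = 1"
  proof -
    let ?A = "mat k k (\<lambda>(c, r). b (e r) (f c))"
    have "mat k k (\<lambda>(c, r). b (f r) (e c)) = transpose_mat ?A"
      by (rule eq_matI) (auto simp: b_commute)
    then have "f.coord_det e = coord_det f" unfolding f.coord_det_def coord_det_def by (simp add: det_transpose[of ?A k])
    moreover have "?A * transpose_mat ?A = 1\<^sub>m k"
    proof (rule eq_matI)
      fix i j assume "i < dim_row (1\<^sub>m k)" "j < dim_col (1\<^sub>m k)"
      then show "(?A * transpose_mat ?A) $$ (i, j) = 1\<^sub>m k $$ (i, j)"
        using f[of i j] by (simp add: scalar_prod_def atLeast0LessThan b_eq_sum[symmetric])
    qed auto
    then have "det ?A * det ?A = 1"
      using det_mult[of ?A k "transpose_mat ?A"] det_transpose[of ?A k] by simp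
    ultimately show ?thesis by (simp add: coord_det_def)
  qed
  then have nz: "coord_det f \<noteq> 0" by auto
  have "reflection a (f r) = (f(0 := (-1) *s f 0)) r" if r: "r < k" for r
  proof (cases "r = 0")
    case True
    have "b a a = c * (c * b a' a')" using c0 by (simp add: a'_def b_simps)
    then show ?thesis using True a c0
      by (simp add: f0 reflection_def a'_def b_simps scale_left_diff_distrib[symmetric] flip: scale_minus_left)
  next
    case False
    then have "b (f r) a' = 0" using f[OF r k] f0 by simp
    then have "b (f r) a = 0" using c0 by (simp add: a'_def b_simps)
    then show ?thesis using False by (simp add: reflection_def)
  qed
  then have "map_det (reflection a) * coord_det f = coord_det (f(0 := (-1) *s f 0))"
    unfolding coord_det_map[OF reflection_linear, symmetric] by (rule coord_det_cong)
  also have "\<dots> = - coord_det f" by (subst coord_det_scale[OF k]) simp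
  finally show ?thesis using nz by (metis mult_cancel_right mult_minus1)
qed

end

section \<open>Semi-invariants are generated by pairings and one determinant\<close>

context orthonormal_space begin

text \<open>
  The span of all products of pairings times one determinant, with arguments taken from a set \<open>Y\<close> of
  vector-valued functions of a point. Arguments are functions, not vectors, so that fixed basis vectors,
  components of the point, and the vector to be averaged are treated alike.
\<close>

inductive_set det_module :: "('p \<Rightarrow> 'v) set \<Rightarrow> ('p \<Rightarrow> complex) set" for Y :: "('p \<Rightarrow> 'v) set" where
  zero: "(\<lambda>p. 0) \<in> det_module Y"
| coord_det: "(\<lambda>p. coord_det (\<lambda>c. y c p)) \<in> det_module Y" if "\<And>c. c < k \<Longrightarrow> y c \<in> Y"
| add: "(\<lambda>p. f p + g p) \<in> det_module Y" if "f \<in> det_module Y" "g \<in> det_module Y"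
| scale: "(\<lambda>p. c * f p) \<in> det_module Y" if "f \<in> det_module Y"
| mult: "(\<lambda>p. b (y p) (z p) * f p) \<in> det_module Y" if "y \<in> Y" "z \<in> Y" "f \<in> det_module Y"

lemma det_module_sum:
  "(\<And>i. i \<in> A \<Longrightarrow> f i \<in> det_module Y) \<Longrightarrow> (\<lambda>p. \<Sum>i\<in>A. f i p) \<in> det_module Y"
  by (induction A rule: infinite_finite_induct) (auto intro: det_module.intros)

lemma det_module_diff:
  assumes "f \<in> det_module Y" "g \<in> det_module Y"
  shows "(\<lambda>p. f p - g p) \<in> det_module Y"
  using det_module.add[OF assms(1) det_module.scale[OF assms(2), of "-1"]] by simp

text \<open>
  The arguments that may still occur when the basis vectors before \<open>e\<^sub>m\<close> have been eliminated.
\<close>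

definition configuration :: "nat \<Rightarrow> nat \<Rightarrow> ((nat \<Rightarrow> 'v) \<Rightarrow> 'v) set" where
  "configuration n m = (\<lambda>i w. w i) ` {1..n} \<union> (\<lambda>r w. e r) ` {m..<k}"

lemma polynomial_in_det_module:
  assumes "f \<in> polynomial_functions scale n"
  shows "f \<in> det_module (configuration n 0)"
proof -
  have mult: "(\<lambda>w. f w * g w) \<in> det_module (configuration n 0)" if "g \<in> det_module (configuration n 0)" for g
    using assms that
  proof (induction arbitrary: g)
    case (const c)
    then show ?case by (rule det_module.scale)
  next
    case (linear \<phi> i)
    have "(\<lambda>w. \<Sum>r<k. \<phi> (e r) * (b (e r) (w i) * g w)) \<in> det_module (configuration n 0)"
      by (intro det_module_sum det_module.scale det_module.mult linear.prems)
        (use linear.hyps in \<open>auto simp: configuration_def\<close>)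
    then show ?case
      by (subst linear_expand[OF linear.hyps(1)]) (simp add: sum_distrib_left sum_distrib_right mult_ac)
  next
    case (add f h)
    then show ?case by (simp add: distrib_right det_module.add)
  next
    case (mult f h)
    then show ?case by (simp add: mult.assoc)
  qed
  have "(\<lambda>w. coord_det e) \<in> det_module (configuration n 0)"
    by (rule det_module.coord_det) (auto simp: configuration_def)
  from mult[OF this] show ?thesis by simp
qed

text \<open>
  A weighted mean over finitely many real unit vectors \<open>u i\<close> in the span of the first \<open>m\<close> basis vectors which
  obeys Wick's recursion for products of at most \<open>2N\<close> linear forms. Its factor \<open>m + card S - 2\<close>, instead of the
  Gaussian factor \<open>1\<close>, comes from the restriction to the sphere.
\<close>

definition spherical_mean :: "nat \<Rightarrow> nat \<Rightarrow> 'i set \<Rightarrow> ('i \<Rightarrow> 'v) \<Rightarrow> ('i \<Rightarrow> complex) \<Rightarrow> bool" where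
  "spherical_mean m N I u c \<longleftrightarrow> (\<Sum>i\<in>I. c i) = 1 \<and>
     (\<forall>i\<in>I. \<exists>t :: nat \<Rightarrow> real. u i = (\<Sum>r<m. of_real (t r) *s e r) \<and> (\<Sum>r<m. t r * t r) = 1) \<and>
     (\<forall>S \<phi>. finite (S :: nat set) \<longrightarrow> (\<forall>j\<in>S. Vector_Spaces.linear scale (*) (\<phi> j)) \<longrightarrow> odd (card S) \<longrightarrow>
        (\<Sum>i\<in>I. c i * (\<Prod>j\<in>S. \<phi> j (u i))) = 0) \<and>
     (\<forall>S \<phi> a. finite (S :: nat set) \<longrightarrow> (\<forall>j\<in>S. Vector_Spaces.linear scale (*) (\<phi> j)) \<longrightarrow>
        even (card S) \<longrightarrow> card S \<le> 2 * N \<longrightarrow> a \<in> S \<longrightarrow>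
        of_nat (m + card S - 2) * (\<Sum>i\<in>I. c i * (\<Prod>j\<in>S. \<phi> j (u i)))
        = (\<Sum>l\<in>S - {a}. (\<Sum>r<m. \<phi> a (e r) * \<phi> l (e r)) * (\<Sum>i\<in>I. c i * (\<Prod>j\<in>S - {a, l}. \<phi> j (u i)))))"

lemma linear_apply_sum:
  assumes "Vector_Spaces.linear scale (*) \<phi>"
  shows "\<phi> (\<Sum>r\<in>A. c r *s e r) = (\<Sum>r\<in>A. c r * \<phi> (e r))"
proof -
  have "\<phi> 0 = 0" using assms by (simp add: Vector_Spaces.linear_iff) (metis mult_zero_left scale_zero_left)
  then show ?thesis
    using assms by (induction A rule: infinite_finite_induct) (simp_all add: Vector_Spaces.linear_iff)
qed

lemma spherical_mean_exists:
  assumes "m \<ge> 1"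
  shows "\<exists>(I :: ((nat \<Rightarrow> nat) \<times> bool) set) u c. spherical_mean m N I u c"
proof (rule sphere_cubature[OF assms, of N])
  fix I :: "((nat \<Rightarrow> nat) \<times> bool) set" and u c
  assume I: "finite I" "\<And>i. i \<in> I \<Longrightarrow> (\<Sum>r<m. u i r * u i r) = 1" "(\<Sum>i\<in>I. c i) = 1"
    and odd: "\<And>S \<psi>. finite S \<Longrightarrow> odd (card S) \<Longrightarrow> (\<Sum>i\<in>I. c i * form_product m \<psi> S (\<lambda>r. of_real (u i r))) = 0"
    and Wick: "\<And>S \<psi> j. finite S \<Longrightarrow> even (card S) \<Longrightarrow> card S \<le> 2 * N \<Longrightarrow> j \<in> S \<Longrightarrow>
       of_nat (m + card S - 2) * (\<Sum>i\<in>I. c i * form_product m \<psi> S (\<lambda>r. of_real (u i r)))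
       = (\<Sum>l\<in>S - {j}. linear_form m (\<psi> j) (\<psi> l) * (\<Sum>i\<in>I. c i * form_product m \<psi> (S - {j, l}) (\<lambda>r. of_real (u i r))))"
  define U where "U i = (\<Sum>r<m. of_real (u i r) *s e r)" for i
  have prod: "(\<Prod>j\<in>T. \<phi> j (U i)) = form_product m (\<lambda>j r. \<phi> j (e r)) T (\<lambda>r. of_real (u i r))"
    if "\<forall>j\<in>S. Vector_Spaces.linear scale (*) (\<phi> j)" "T \<subseteq> S" for \<phi> i and S T :: "nat set"
    unfolding form_product_def U_def linear_form_def using that
    by (intro prod.cong refl) (subst linear_apply_sum, auto simp: mult.commute)
  have "spherical_mean m N I U c"
    unfolding spherical_mean_def
  proof (intro conjI allI ballI impI)
    show "(\<Sum>i\<in>I. c i) = 1" by fact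
  next
    fix i assume "i \<in> I"
    then show "\<exists>t :: nat \<Rightarrow> real. U i = (\<Sum>r<m. of_real (t r) *s e r) \<and> (\<Sum>r<m. t r * t r) = 1"
      using I(2) by (intro exI[of _ "u i"]) (simp add: U_def)
  next
    fix S :: "nat set" and \<phi>
    assume S: "finite S" "\<forall>j\<in>S. Vector_Spaces.linear scale (*) (\<phi> j)"
    { assume "odd (card S)"
      then show "(\<Sum>i\<in>I. c i * (\<Prod>j\<in>S. \<phi> j (U i))) = 0"
        unfolding prod[OF S(2) order.refl] by (rule odd[OF S(1)]) }
    fix a
    assume "even (card S)" "card S \<le> 2 * N" "a \<in> S"
    then show "of_nat (m + card S - 2) * (\<Sum>i\<in>I. c i * (\<Prod>j\<in>S. \<phi> j (U i)))
        = (\<Sum>l\<in>S - {a}. (\<Sum>r<m. \<phi> a (e r) * \<phi> l (e r)) * (\<Sum>i\<in>I. c i * (\<Prod>j\<in>S - {a, l}. \<phi> j (U i))))"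
      unfolding prod[OF S(2) order.refl] prod[OF S(2) Diff_subset]
      using Wick[OF S(1), of a "\<lambda>j r. \<phi> j (e r)"] by (simp only: linear_form_def)
  qed
  then show ?thesis by blast
qed

text \<open>
  The new vector is made a component of the point, so that it can be varied.
\<close>

definition add_vector :: "('p \<Rightarrow> 'v) set \<Rightarrow> ('v \<times> 'p \<Rightarrow> 'v) set" where
  "add_vector Y = insert fst ((\<lambda>y q. y (snd q)) ` Y)"

lemma linear_b: "Vector_Spaces.linear scale (*) (\<lambda>u. b u y)"
  using form by (simp add: symmetric_bilinear_form_def)

lemma linear_coord_det: "c < k \<Longrightarrow> Vector_Spaces.linear scale (*) (\<lambda>u. coord_det (y(c := u)))"
  using vector_space_axioms vector_space_complex
  by (simp add: Vector_Spaces.linear_iff coord_det_additive coord_det_scale del: fun_upd_apply)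

context
  fixes Y :: "('p \<Rightarrow> 'v) set" and m N :: nat and I :: "'i set" and u :: "'i \<Rightarrow> 'v" and c :: "'i \<Rightarrow> complex"
  assumes mean: "spherical_mean m N I u c" and m: "1 \<le> m" "m \<le> k"
    and Y: "\<And>r. m \<le> r \<Longrightarrow> r < k \<Longrightarrow> (\<lambda>p. e r) \<in> Y"
begin

lemma split_sum_k: "(\<Sum>r<m. f r) = (\<Sum>r<k. f r) - (\<Sum>r\<in>{m..<k}. f r :: complex)"
  using m(2) by (simp add: sum_diff_nat_ivl[of 0 m k f, simplified atLeast0LessThan] algebra_simps
      sum.atLeastLessThan_concat[of 0 m k f, symmetric] flip: atLeast0LessThan)

lemmas mean_unfolded = mean[unfolded spherical_mean_def]
lemmas mean_odd = mean_unfolded[THEN conjunct2, THEN conjunct2, THEN conjunct1, rule_format]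
lemmas mean_Wick = mean_unfolded[THEN conjunct2, THEN conjunct2, THEN conjunct2, rule_format]

text \<open>
  One recursion for both parities: the mean of an odd number of forms is zero, which is the coefficient here.
\<close>

lemma mean_step:
  assumes "finite (S :: nat set)" "\<forall>j\<in>S. Vector_Spaces.linear scale (*) (\<phi> j)" "card S \<le> 2 * N" "a \<in> S"
  shows "(\<Sum>i\<in>I. c i * (\<Prod>j\<in>S. \<phi> j (u i)))
    = (if odd (card S) then 0 else 1 / of_nat (m + card S - 2)) *
      (\<Sum>l\<in>S - {a}. (\<Sum>r<m. \<phi> a (e r) * \<phi> l (e r)) * (\<Sum>i\<in>I. c i * (\<Prod>j\<in>S - {a, l}. \<phi> j (u i))))"
proof (cases "odd (card S)")
  case True
  then show ?thesis using mean_odd[of S \<phi>] assms(1,2) by simp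
next
  case False
  have "card S > 0" using assms(1,4) by (auto simp: card_gt_0_iff)
  with False have "card S \<ge> 2" by (cases "card S = 1") auto
  then have "m + card S - 2 \<noteq> 0" using m by simp
  then have "of_nat (m + card S - 2) \<noteq> (0 :: complex)" unfolding of_nat_eq_0_iff .
  moreover have "of_nat (m + card S - 2) * (\<Sum>i\<in>I. c i * (\<Prod>j\<in>S. \<phi> j (u i)))
     = (\<Sum>l\<in>S - {a}. (\<Sum>r<m. \<phi> a (e r) * \<phi> l (e r)) * (\<Sum>i\<in>I. c i * (\<Prod>j\<in>S - {a, l}. \<phi> j (u i))))"
    using False assms by (intro mean_Wick) auto
  ultimately show ?thesis
    using False by (simp add: nonzero_eq_divide_eq mult.commute del: of_nat_add of_nat_diff)
qed

text \<open>
  Wick's recursion removes two factors at a time. The inner product of the forms \<open>b(\<sqdot>, y)\<close> and \<open>b(\<sqdot>, z)\<close> over the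
  first \<open>m\<close> basis vectors is \<open>b(y, z)\<close> minus the contribution of the basis vectors from \<open>e\<^sub>m\<close> on, and these
  are still allowed as arguments.
\<close>

lemma mean_products_in_det_module:
  assumes "finite (S :: nat set)" "\<And>j. j \<in> S \<Longrightarrow> y j \<in> Y" "card S \<le> 2 * N" "g \<in> det_module Y"
  shows "(\<lambda>p. (\<Sum>i\<in>I. c i * (\<Prod>j\<in>S. b (u i) (y j p))) * g p) \<in> det_module Y"
  using assms
proof (induction "card S" arbitrary: S rule: less_induct)
  case less
  show ?case
  proof (cases "S = {}")
    case True
    then show ?thesis using mean less.prems(4) by (simp add: spherical_mean_def)
  next
    case False
    then obtain a where a: "a \<in> S" by blast
    let ?q = "if odd (card S) then 0 else 1 / of_nat (m + card S - 2) :: complex"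
    have eq: "(\<Sum>i\<in>I. c i * (\<Prod>j\<in>S. b (u i) (y j p))) = ?q *
      (\<Sum>l\<in>S - {a}. (\<Sum>r<m. b (e r) (y a p) * b (e r) (y l p)) * (\<Sum>i\<in>I. c i * (\<Prod>j\<in>S - {a, l}. b (u i) (y j p))))" for p
      by (rule mean_step[where \<phi> = "\<lambda>j u. b u (y j p)"]) (use less.prems a linear_b in auto)
    have "(\<lambda>p. ?q * (\<Sum>l\<in>S - {a}. \<Sum>r<m. b (e r) (y a p) * (b (e r) (y l p) *
        ((\<Sum>i\<in>I. c i * (\<Prod>j\<in>S - {a, l}. b (u i) (y j p))) * g p)))) \<in> det_module Y"
    proof (rule det_module.scale, rule det_module_sum)
      fix l assume l: "l \<in> S - {a}"
      define h where "h p = (\<Sum>i\<in>I. c i * (\<Prod>j\<in>S - {a, l}. b (u i) (y j p))) * g p" for p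
      have "card (S - {a, l}) < card S" using less.prems(1) a by (intro psubset_card_mono) auto
      then have h: "h \<in> det_module Y" unfolding h_def[abs_def]
        using less.prems by (intro less.hyps) auto
      have "(\<lambda>p. (\<Sum>r<m. b (e r) (y a p) * b (e r) (y l p)) * h p) \<in> det_module Y"
      proof -
        have "(\<lambda>p. b (y a p) (y l p) * h p - (\<Sum>r\<in>{m..<k}. b (e r) (y a p) * (b (e r) (y l p) * h p))) \<in> det_module Y"
          by (intro det_module_diff det_module_sum det_module.mult[of "\<lambda>p. e _"] det_module.mult[of "y a"] Y h less.prems)
            (use a l in auto)
        then show ?thesis
          unfolding split_sum_k b_eq_sum[of "y a _", symmetric]
          by (simp add: left_diff_distrib sum_distrib_right mult.assoc)
      qed
      then show "(\<lambda>p. \<Sum>r<m. b (e r) (y a p) * (b (e r) (y l p) *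
        ((\<Sum>i\<in>I. c i * (\<Prod>j\<in>S - {a, l}. b (u i) (y j p))) * g p))) \<in> det_module Y"
        by (simp add: h_def sum_distrib_right mult.assoc)
    qed
    then show ?thesis unfolding eq by (simp add: sum_distrib_right mult.assoc)
  qed
qed

text \<open>
  A determinant that contains the averaged vector in one place is one more linear form. Its inner product with
  \<open>b(\<sqdot>, y)\<close> over the whole space is the determinant with \<open>y\<close> in that place.
\<close>

lemma mean_det_in_det_module:
  assumes "finite (S :: nat set)" "\<And>j. j \<in> S \<Longrightarrow> y j \<in> Y" "card S < 2 * N"
    and c0: "c0 < k" and z: "\<And>c. c < k \<Longrightarrow> c \<noteq> c0 \<Longrightarrow> z c \<in> Y"
  shows "(\<lambda>p. \<Sum>i\<in>I. c i * ((\<Prod>j\<in>S. b (u i) (y j p)) * coord_det ((\<lambda>c. z c p)(c0 := u i)))) \<in> det_module Y"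
proof -
  obtain a where a: "a \<notin> S" using ex_new_if_finite[OF infinite_UNIV_nat assms(1)] by blast
  define \<phi> where "\<phi> p j = (if j = a then (\<lambda>u. coord_det ((\<lambda>c. z c p)(c0 := u))) else (\<lambda>u. b u (y j p)))" for p j
  let ?T = "insert a S"
  let ?q = "if odd (card ?T) then 0 else 1 / of_nat (m + card ?T - 2) :: complex"
  have lin: "\<forall>j\<in>?T. Vector_Spaces.linear scale (*) (\<phi> p j)" for p
    by (simp add: \<phi>_def linear_b linear_coord_det[OF c0] del: fun_upd_apply)
  have \<phi>S: "(\<Prod>j\<in>T. \<phi> p j v) = (\<Prod>j\<in>T. b v (y j p))" if "T \<subseteq> S" for T p v
    using a that by (intro prod.cong) (auto simp: \<phi>_def)
  have eq: "(\<Sum>i\<in>I. c i * ((\<Prod>j\<in>S. b (u i) (y j p)) * coord_det ((\<lambda>c. z c p)(c0 := u i))))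
      = ?q * (\<Sum>l\<in>S. (\<Sum>r<m. coord_det ((\<lambda>c. z c p)(c0 := e r)) * b (e r) (y l p))
          * (\<Sum>i\<in>I. c i * (\<Prod>j\<in>S - {l}. b (u i) (y j p))))" for p
  proof -
    have "(\<Sum>i\<in>I. c i * ((\<Prod>j\<in>S. b (u i) (y j p)) * coord_det ((\<lambda>c. z c p)(c0 := u i))))
      = (\<Sum>i\<in>I. c i * (\<Prod>j\<in>?T. \<phi> p j (u i)))"
      by (subst prod.insert[OF assms(1) a]) (simp add: \<phi>S, simp add: \<phi>_def mult.commute)
    also have "\<dots> = ?q * (\<Sum>l\<in>?T - {a}. (\<Sum>r<m. \<phi> p a (e r) * \<phi> p l (e r)) * (\<Sum>i\<in>I. c i * (\<Prod>j\<in>?T - {a, l}. \<phi> p j (u i))))"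
      by (rule mean_step[OF _ lin]) (use assms a in auto)
    also have "(\<Sum>l\<in>?T - {a}. (\<Sum>r<m. \<phi> p a (e r) * \<phi> p l (e r)) * (\<Sum>i\<in>I. c i * (\<Prod>j\<in>?T - {a, l}. \<phi> p j (u i))))
      = (\<Sum>l\<in>S. (\<Sum>r<m. coord_det ((\<lambda>c. z c p)(c0 := e r)) * b (e r) (y l p))
          * (\<Sum>i\<in>I. c i * (\<Prod>j\<in>S - {l}. b (u i) (y j p))))"
    proof (intro sum.cong arg_cong2[of _ _ _ _ times] refl)
      show "?T - {a} = S" using a by auto
      fix l assume l: "l \<in> S"
      show "\<phi> p a (e r) = coord_det ((\<lambda>c. z c p)(c0 := e r))" for r by (simp add: \<phi>_def)
      show "\<phi> p l (e r) = b (e r) (y l p)" for r using l a by (auto simp: \<phi>_def)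
      have "?T - {a, l} = S - {l}" using a by auto
      then show "(\<Prod>j\<in>?T - {a, l}. \<phi> p j (u i)) = (\<Prod>j\<in>S - {l}. b (u i) (y j p))" for i
        by (simp add: \<phi>S)
    qed
    finally show ?thesis .
  qed
  have "(\<lambda>p. ?q * (\<Sum>l\<in>S. (\<Sum>i\<in>I. c i * (\<Prod>j\<in>S - {l}. b (u i) (y j p))) *
      (\<Sum>r<m. coord_det ((\<lambda>c. z c p)(c0 := e r)) * b (e r) (y l p)))) \<in> det_module Y"
  proof (rule det_module.scale, rule det_module_sum, rule mean_products_in_det_module)
    fix l assume l: "l \<in> S"
    show "finite (S - {l})" "\<And>j. j \<in> S - {l} \<Longrightarrow> y j \<in> Y" "card (S - {l}) \<le> 2 * N"
      using assms(1,2,3) card_Diff1_le[of S l] by auto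
    have upd: "(\<lambda>c. z c p)(c0 := v p) = (\<lambda>c. (z(c0 := v)) c p)" for p v by auto
    have cdv: "(\<lambda>p. coord_det ((\<lambda>c. z c p)(c0 := v p))) \<in> det_module Y" if "v \<in> Y" for v
      unfolding upd using z that by (intro det_module.coord_det) auto
    have "(\<lambda>p. coord_det ((\<lambda>c. z c p)(c0 := y l p)) - (\<Sum>r\<in>{m..<k}. b (e r) (y l p) * coord_det ((\<lambda>c. z c p)(c0 := e r)))) \<in> det_module Y"
      by (intro det_module_diff det_module_sum det_module.mult[of "\<lambda>p. e _"] cdv[of "\<lambda>p. e _"] cdv Y assms(2)[OF l]) auto
    then show "(\<lambda>p. \<Sum>r<m. coord_det ((\<lambda>c. z c p)(c0 := e r)) * b (e r) (y l p)) \<in> det_module Y"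
      unfolding split_sum_k coord_det_upd_expand[OF c0, of _ "y l _"] by (simp add: mult.commute)
  qed
  then show ?thesis unfolding eq by (simp add: mult.commute)
qed

lemma mean_unit: "i \<in> I \<Longrightarrow> b (u i) (u i) = 1"
proof -
  assume "i \<in> I"
  then obtain t :: "nat \<Rightarrow> real" where t: "u i = (\<Sum>r<m. of_real (t r) *s e r)" "(\<Sum>r<m. t r * t r) = 1"
    using mean by (auto simp: spherical_mean_def)
  have "b (u i) (u i) = (\<Sum>r<m. \<Sum>s<m. of_real (t r) * (of_real (t s) * b (e r) (e s)))"
    unfolding t(1) b_sum_left b_scale_left unfolding b_sum_right b_scale_right sum_distrib_left by (rule refl)
  also have "\<dots> = (\<Sum>r<m. \<Sum>s<m. if s = r then of_real (t r * t r) else 0)"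
    using m(2) by (intro sum.cong refl) (auto simp: e_orthonormal)
  also have "\<dots> = of_real (\<Sum>r<m. t r * t r)" by simp
  finally show ?thesis using t(2) by simp
qed

lemma mean_one_det_in_det_module:
  assumes "finite (S :: nat set)" "\<And>j. j \<in> S \<Longrightarrow> y j \<in> Y" "card S + 1 \<le> 2 * N"
    and z: "\<And>c. c < k \<Longrightarrow> z c \<in> add_vector Y"
  shows "(\<lambda>p. \<Sum>i\<in>I. c i * ((\<Prod>j\<in>S. b (u i) (y j p)) * coord_det (\<lambda>c. z c (u i, p)))) \<in> det_module Y"
proof (cases "\<exists>c0 c1. c0 < k \<and> c1 < k \<and> c0 \<noteq> c1 \<and> z c0 = fst \<and> z c1 = fst")
  case True
  then obtain c0 c1 where "c0 < k" "c1 < k" "c0 \<noteq> c1" "z c0 = fst" "z c1 = fst" by blast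
  then have "coord_det (\<lambda>c. z c (v, p)) = 0" for v p by (intro coord_det_identical[of c0 c1]) auto
  then show ?thesis by (simp add: det_module.zero)
next
  case False
  have ex: "\<exists>z'. z' \<in> Y \<and> z c = (\<lambda>q. z' (snd q))" if "c < k" "z c \<noteq> fst" for c
    using z[OF that(1)] that(2) by (auto simp: add_vector_def)
  define z' where "z' c = (SOME z'. z' \<in> Y \<and> z c = (\<lambda>q. z' (snd q)))" for c
  have z': "z' c \<in> Y" "z c (v, p) = z' c p" if "c < k" "z c \<noteq> fst" for c v p
    using someI_ex[OF ex[OF that]] unfolding z'_def by (auto dest: fun_cong[of _ _ "(v, p)"])
  show ?thesis
  proof (cases "\<exists>c0<k. z c0 = fst")
    case True
    then obtain c0 where c0: "c0 < k" "z c0 = fst" by blast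
    then have other: "z c \<noteq> fst" if "c < k" "c \<noteq> c0" for c using False that by blast
    have "coord_det (\<lambda>c. z c (v, p)) = coord_det ((\<lambda>c. z' c p)(c0 := v))" for v p
      using c0 z'(2) other by (intro coord_det_cong) auto
    then show ?thesis
      using mean_det_in_det_module[OF assms(1,2) _ c0(1), where z = z'] z'(1) other assms(3) by simp
  next
    case False
    then have "coord_det (\<lambda>c. z c (v, p)) = coord_det (\<lambda>c. z' c p)" for v p
      using z'(2) by (intro coord_det_cong) auto
    moreover have g: "(\<lambda>p. coord_det (\<lambda>c. z' c p)) \<in> det_module Y"
      using z'(1) False by (intro det_module.coord_det) auto
    ultimately show ?thesis
      using mean_products_in_det_module[OF assms(1,2) _ g] assms(3)
      by (simp add: sum_distrib_right mult.assoc)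
  qed
qed

end

text \<open>
  Averaging out the new vector leads from the enlarged module back to \<open>det_module Y\<close>. The additional factors
  \<open>b (u i) (y j p)\<close> make the statement inductive, since a pairing with the new vector becomes one more of them. The
  number \<open>d\<close> bounds the degree of \<open>G\<close> in the new vector, which the exactness \<open>2N\<close> of the mean has to cover.
\<close>

definition mean_stays :: "nat \<Rightarrow> ('p \<Rightarrow> 'v) set \<Rightarrow> 'i itself \<Rightarrow> ('v \<times> 'p \<Rightarrow> complex) \<Rightarrow> nat \<Rightarrow> bool" where
  "mean_stays m Y (_ :: 'i itself) G d \<longleftrightarrow>
    (\<forall>N (I :: 'i set) u c S y. spherical_mean m N I u c \<longrightarrow> finite (S :: nat set) \<longrightarrow>
      (\<forall>j\<in>S. y j \<in> Y) \<longrightarrow> card S + d \<le> 2 * N \<longrightarrow>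
      (\<lambda>p. \<Sum>i\<in>I. c i * ((\<Prod>j\<in>S. b (u i) (y j p)) * G (u i, p))) \<in> det_module Y)"

lemma mean_staysD:
  fixes I :: "'i set" and S :: "nat set"
  assumes "mean_stays m Y TYPE('i) G d" "spherical_mean m N I u c" "finite S" "\<forall>j\<in>S. y j \<in> Y" "card S + d \<le> 2 * N"
  shows "(\<lambda>p. \<Sum>i\<in>I. c i * ((\<Prod>j\<in>S. b (u i) (y j p)) * G (u i, p))) \<in> det_module Y"
  by (rule assms(1)[unfolded mean_stays_def, THEN spec, THEN spec, THEN spec, THEN spec, THEN spec, THEN spec,
      THEN mp, OF assms(2), THEN mp, OF assms(3), THEN mp, OF assms(4), THEN mp, OF assms(5)])

lemma mean_in_det_module:
  assumes "1 \<le> m" "m \<le> k" and Y: "\<And>r. m \<le> r \<Longrightarrow> r < k \<Longrightarrow> (\<lambda>p. e r) \<in> Y"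
    and G: "G \<in> det_module (add_vector Y)"
  shows "\<exists>d. mean_stays m Y TYPE('i) G d"
  using G
proof induction
  case zero
  show ?case by (simp add: mean_stays_def det_module.zero)
next
  case (coord_det z)
  show ?case
    unfolding mean_stays_def
    using mean_one_det_in_det_module[OF _ assms(1,2) Y] coord_det by (intro exI[of _ 1]) blast
next
  case (add F G)
  then obtain d1 d2 where d: "mean_stays m Y TYPE('i) F d1" "mean_stays m Y TYPE('i) G d2" by blast
  show ?case
  proof (intro exI[of _ "d1 + d2"], unfold mean_stays_def, intro allI impI)
    fix N and I :: "'i set" and u c and S :: "nat set" and y
    assume h: "spherical_mean m N I u c" "finite S" "\<forall>j\<in>S. y j \<in> Y" and le: "card S + (d1 + d2) \<le> 2 * N"
    have "(\<lambda>p. (\<Sum>i\<in>I. c i * ((\<Prod>j\<in>S. b (u i) (y j p)) * F (u i, p)))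
       + (\<Sum>i\<in>I. c i * ((\<Prod>j\<in>S. b (u i) (y j p)) * G (u i, p)))) \<in> det_module Y"
      by (rule det_module.add) (rule mean_staysD[OF d(1) h], use le in simp, rule mean_staysD[OF d(2) h], use le in simp)
    then show "(\<lambda>p. \<Sum>i\<in>I. c i * ((\<Prod>j\<in>S. b (u i) (y j p)) * (F (u i, p) + G (u i, p)))) \<in> det_module Y"
      by (simp add: distrib_left sum.distrib)
  qed
next
  case (scale G c0)
  then obtain d where d: "mean_stays m Y TYPE('i) G d" by blast
  show ?case
  proof (intro exI[of _ d], unfold mean_stays_def, intro allI impI)
    fix N and I :: "'i set" and u c and S :: "nat set" and y
    assume h: "spherical_mean m N I u c" "finite S" "\<forall>j\<in>S. y j \<in> Y" "card S + d \<le> 2 * N"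
    have "(\<lambda>p. c0 * (\<Sum>i\<in>I. c i * ((\<Prod>j\<in>S. b (u i) (y j p)) * G (u i, p)))) \<in> det_module Y"
      by (rule det_module.scale, rule mean_staysD[OF d h])
    then show "(\<lambda>p. \<Sum>i\<in>I. c i * ((\<Prod>j\<in>S. b (u i) (y j p)) * (c0 * G (u i, p)))) \<in> det_module Y"
      by (simp add: sum_distrib_left mult_ac)
  qed
next
  case (mult x z G)
  then obtain d where d: "mean_stays m Y TYPE('i) G d" by blast
  show ?case
  proof (intro exI[of _ "Suc d"], unfold mean_stays_def, intro allI impI)
    fix N and I :: "'i set" and u c and S :: "nat set" and y
    assume h: "spherical_mean m N I u c" "finite S" "\<forall>j\<in>S. y j \<in> Y" and le: "card S + Suc d \<le> 2 * N"
    have one: "(\<lambda>p. \<Sum>i\<in>I. c i * ((\<Prod>j\<in>S. b (u i) (y j p)) * (b (u i) (x' p) * G (u i, p)))) \<in> det_module Y"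
      if x': "x' \<in> Y" for x'
    proof -
      obtain a where a: "a \<notin> S" using ex_new_if_finite[OF infinite_UNIV_nat h(2)] by blast
      have "(\<lambda>p. \<Sum>i\<in>I. c i * ((\<Prod>j\<in>insert a S. b (u i) ((y(a := x')) j p)) * G (u i, p))) \<in> det_module Y"
        by (rule mean_staysD[OF d h(1)]) (use h a x' le in auto)
      moreover have "(\<Prod>j\<in>insert a S. b v ((y(a := x')) j p)) = b v (x' p) * (\<Prod>j\<in>S. b v (y j p))" for v p
      proof -
        have "(\<Prod>j\<in>S. b v ((y(a := x')) j p)) = (\<Prod>j\<in>S. b v (y j p))"
          using a by (intro prod.cong) auto
        then show ?thesis by (subst prod.insert[OF h(2) a]) simp
      qed
      ultimately show ?thesis by (simp only: mult_ac)
    qed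
    have base: "(\<lambda>p. \<Sum>i\<in>I. c i * ((\<Prod>j\<in>S. b (u i) (y j p)) * G (u i, p))) \<in> det_module Y"
      by (rule mean_staysD[OF d h]) (use le in simp)
    consider "x = fst" "z = fst" | z' where "x = fst" "z' \<in> Y" "z = (\<lambda>q. z' (snd q))"
      | x' where "x' \<in> Y" "x = (\<lambda>q. x' (snd q))" "z = fst"
      | x' z' where "x' \<in> Y" "x = (\<lambda>q. x' (snd q))" "z' \<in> Y" "z = (\<lambda>q. z' (snd q))"
      using mult.hyps(1,2) unfolding add_vector_def by blast
    then show "(\<lambda>p. \<Sum>i\<in>I. c i * ((\<Prod>j\<in>S. b (u i) (y j p)) * (b (x (u i, p)) (z (u i, p)) * G (u i, p)))) \<in> det_module Y"
    proof cases
      case 1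
      have "(\<lambda>p. \<Sum>i\<in>I. c i * ((\<Prod>j\<in>S. b (u i) (y j p)) * (b (u i) (u i) * G (u i, p))))
          = (\<lambda>p. \<Sum>i\<in>I. c i * ((\<Prod>j\<in>S. b (u i) (y j p)) * G (u i, p)))"
        using mean_unit[OF h(1) assms(1,2) Y] by (intro ext sum.cong) auto
      then show ?thesis using base 1 by simp
    next
      case 2
      then show ?thesis using one by simp
    next
      case 3
      then show ?thesis using one by (simp add: b_commute[of "_ _" "u _"])
    next
      case 4
      have "(\<lambda>p. b (x' p) (z' p) * (\<Sum>i\<in>I. c i * ((\<Prod>j\<in>S. b (u i) (y j p)) * G (u i, p)))) \<in> det_module Y"
        by (rule det_module.mult[OF 4(1,3) base])
      then show ?thesis using 4 by (simp add: sum_distrib_left mult_ac)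
    qed
  qed
qed

lemma det_module_equivariant:
  assumes "G \<in> det_module Y" and h: "Vector_Spaces.linear scale scale h" "\<And>x y. b (h x) (h y) = b x y"
    and Y: "\<And>y p. y \<in> Y \<Longrightarrow> y (T p) = h (y p)"
  shows "G (T p) = map_det h * G p"
  using assms(1)
proof induction
  case (coord_det y)
  have "coord_det (\<lambda>c. y c (T p)) = coord_det (\<lambda>c. h (y c p))" using coord_det Y by (intro coord_det_cong) auto
  then show ?case by (simp add: coord_det_map[OF h(1)])
next
  case (mult y z f)
  then show ?case by (simp add: Y h(2))
qed (simp_all add: algebra_simps)

text \<open>
  Marks all occurrences of a fixed argument \<open>v\<close>, so that another vector can be substituted for it.
\<close>

lemma det_module_separate_vector:
  assumes "f \<in> det_module (insert (\<lambda>p. v) Y)"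
  shows "\<exists>G\<in>det_module (add_vector Y). \<forall>p. f p = G (v, p)"
proof -
  have ex: "\<exists>y'\<in>add_vector Y. \<forall>p. y p = y' (v, p)" if "y \<in> insert (\<lambda>p. v) Y" for y
    using that unfolding add_vector_def by (cases "y \<in> Y") (force, simp)
  then obtain lift where lift: "\<And>y. y \<in> insert (\<lambda>p. v) Y \<Longrightarrow> lift y \<in> add_vector Y \<and> (\<forall>p. y p = lift y (v, p))"
    by metis
  show ?thesis
    using assms
  proof induction
    case zero
    show ?case by (intro bexI[OF _ det_module.zero]) simp
  next
    case (coord_det y)
    have "(\<lambda>q. coord_det (\<lambda>c. lift (y c) q)) \<in> det_module (add_vector Y)"
      using coord_det lift by (intro det_module.coord_det) blast
    moreover have "coord_det (\<lambda>c. y c p) = coord_det (\<lambda>c. lift (y c) (v, p))" for p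
      using coord_det lift by (intro coord_det_cong) blast
    ultimately show ?case by (intro bexI) auto
  next
    case (add f g)
    then obtain F G where "F \<in> det_module (add_vector Y)" "\<forall>p. f p = F (v, p)"
      "G \<in> det_module (add_vector Y)" "\<forall>p. g p = G (v, p)" by blast
    then show ?case by (intro bexI[OF _ det_module.add[of F _ G]]) auto
  next
    case (scale f c)
    then obtain F where "F \<in> det_module (add_vector Y)" "\<forall>p. f p = F (v, p)" by blast
    then show ?case by (intro bexI[OF _ det_module.scale[of F _ c]]) auto
  next
    case (mult y z f)
    then obtain F where "F \<in> det_module (add_vector Y)" "\<forall>p. f p = F (v, p)" by blast
    then show ?case
      using lift[OF mult.hyps(1)] lift[OF mult.hyps(2)]
      by (intro bexI[OF _ det_module.mult[of "lift y" _ "lift z" F]]) auto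
  qed
qed

text \<open>
  The reflection along \<open>v - e\<^sub>m\<close>. Real coordinates matter here: a nonzero real vector is never isotropic.
\<close>

lemma exists_reflection:
  assumes "m < k" "v = (\<Sum>r<Suc m. of_real (t r) *s e r)" "(\<Sum>r<Suc m. t r * t r) = (1 :: real)" "v \<noteq> e m"
  obtains a where "b a a \<noteq> 0" "reflection a (e m) = v" "\<And>r. m < r \<Longrightarrow> r < k \<Longrightarrow> reflection a (e r) = e r"
proof -
  define a where "a = v - e m"
  define s where "s r = (if r = m then t r - 1 else t r)" for r
  have bem: "b (e r) v = (if r \<le> m then of_real (t r) else 0)" if "r < k" for r
  proof -
    have "b (e r) v = (\<Sum>q<Suc m. if q = r then of_real (t q) else 0)"
      unfolding assms(2) b_sum_right b_scale_right using that assms(1)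
      by (intro sum.cong refl) (auto simp: e_orthonormal)
    then show ?thesis by (simp add: less_Suc_eq_le)
  qed
  have ba: "b (e r) a = (if r \<le> m then of_real (s r) else 0)" if "r < k" for r
    using bem[OF that] that assms(1) by (auto simp: a_def s_def b_diff_right e_orthonormal)
  have "b a a = (\<Sum>r<k. if r \<le> m then of_real (s r * s r) else 0)"
    unfolding b_eq_sum[of a a] by (intro sum.cong refl) (auto simp: ba)
  also have "\<dots> = (\<Sum>r\<in>{..m}. of_real (s r * s r))"
    using assms(1) by (intro sum.mono_neutral_cong_right) auto
  finally have baa: "b a a = of_real (\<Sum>r\<in>{..m}. s r * s r)" by simp
  have nz: "b a a \<noteq> 0"
  proof
    assume "b a a = 0"
    then have "(\<Sum>r\<in>{..m}. s r * s r) = 0" unfolding baa of_real_eq_0_iff .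
    then have "\<forall>r\<in>{..m}. s r * s r = 0" by (subst (asm) sum_nonneg_eq_0_iff) auto
    then have "b (e r) a = 0" if "r < k" for r using ba[OF that] by auto
    then have "a = 0" by (subst e_expand[of a]) simp
    then show False using assms(4) by (simp add: a_def)
  qed
  have bvv: "b v v = 1"
  proof -
    have "b v v = (\<Sum>r<k. if r \<le> m then of_real (t r * t r) else 0)"
      unfolding b_eq_sum[of v v] by (intro sum.cong refl) (auto simp: bem)
    also have "\<dots> = (\<Sum>r<Suc m. of_real (t r * t r))"
      using assms(1) by (intro sum.mono_neutral_cong_right) auto
    also have "\<dots> = of_real (\<Sum>r<Suc m. t r * t r)" by simp
    finally show ?thesis unfolding assms(3) by simp
  qed
  have "b a a = 1 + 1 - 2 * b (e m) v"
    unfolding a_def using assms(1) by (simp add: b_diff_left b_diff_right bvv e_orthonormal b_commute[of v "e m"])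
  moreover have "b (e m) a = b (e m) v - 1"
    unfolding a_def using assms(1) by (simp add: b_diff_right e_orthonormal)
  ultimately have "2 * b (e m) a = - b a a" by simp
  then have "reflection a (e m) = e m - (- 1) *s a" using nz unfolding reflection_def by simp
  then have "reflection a (e m) = v" by (simp add: a_def)
  moreover have "reflection a (e r) = e r" if "m < r" "r < k" for r
    using ba[OF that(2)] that(1) by (simp add: reflection_def)
  ultimately show ?thesis using that nz by blast
qed

definition reflection_semiinvariant :: "((nat \<Rightarrow> 'v) \<Rightarrow> complex) \<Rightarrow> bool" where
  "reflection_semiinvariant f \<longleftrightarrow> (\<forall>a w. b a a \<noteq> 0 \<longrightarrow> f (\<lambda>i. reflection a (w i)) = - f w)"

text \<open>
  Let \<open>G(v, w)\<close> be the expression for \<open>f(w)\<close> with \<open>v\<close> in place of \<open>e\<^sub>m\<close>. A reflection that exchanges \<open>e\<^sub>m\<close> and a real unit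
  vector \<open>v\<close> and fixes the later basis vectors multiplies both \<open>f\<close> and \<open>G\<close> by \<open>- 1\<close>, so \<open>G(v, w) = f(w)\<close>. The mean
  over \<open>v\<close> of the left-hand side no longer contains \<open>e\<^sub>m\<close>.
\<close>

lemma eliminate_basis_vector:
  assumes "m < k" "f \<in> det_module (configuration n m)" "reflection_semiinvariant f"
  shows "f \<in> det_module (configuration n (Suc m))"
proof -
  let ?Y = "configuration n (Suc m)"
  have "{m..<k} = insert m {Suc m..<k}" using assms(1) by auto
  then have "configuration n m = insert (\<lambda>w. e m) ?Y" by (simp add: configuration_def)
  then obtain G where G: "G \<in> det_module (add_vector ?Y)" "\<And>w. f w = G (e m, w)"
    using det_module_separate_vector[of f "e m" ?Y] assms(2) by auto
  have Y: "(\<lambda>p. e r) \<in> ?Y" if "Suc m \<le> r" "r < k" for r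
    using that by (auto simp: configuration_def)
  have Gv: "G (v, w) = f w" if v: "v = (\<Sum>r<Suc m. of_real (t r) *s e r)" "(\<Sum>r<Suc m. t r * t r) = (1 :: real)" for v w t
  proof (cases "v = e m")
    case True
    then show ?thesis by (simp add: G(2))
  next
    case False
    (* This reflection fixes all basis vectors that G may still contain. *)
    obtain a where a: "b a a \<noteq> 0" "reflection a (e m) = v" "\<And>r. m < r \<Longrightarrow> r < k \<Longrightarrow> reflection a (e r) = e r"
      using exists_reflection[OF assms(1) v False] by blast
    let ?T = "\<lambda>(u, w). (reflection a u, \<lambda>i. reflection a (w i))"
    have "G (?T (v, w)) = map_det (reflection a) * G (v, w)"
    proof (rule det_module_equivariant[OF G(1) reflection_linear reflection_isometry[OF a(1)]])
      fix y :: "'v \<times> (nat \<Rightarrow> 'v) \<Rightarrow> 'v" and p assume "y \<in> add_vector ?Y"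
      then show "y (?T p) = reflection a (y p)"
        using a(3) by (cases p) (auto simp: add_vector_def configuration_def)
    qed
    moreover have "reflection a v = e m" using reflection_involution[OF a(1)] a(2) by blast
    ultimately have "f (\<lambda>i. reflection a (w i)) = - G (v, w)"
      by (simp add: map_det_reflection[OF a(1)] G(2))
    then show ?thesis using assms(3) a(1) by (simp add: reflection_semiinvariant_def)
  qed
  obtain d where d: "mean_stays (Suc m) ?Y TYPE((nat \<Rightarrow> nat) \<times> bool) G d"
    using mean_in_det_module[OF _ _ Y G(1), where m = "Suc m"] assms(1) by auto
  obtain I :: "((nat \<Rightarrow> nat) \<times> bool) set" and u c where mean: "spherical_mean (Suc m) d I u c"
    using spherical_mean_exists[of "Suc m" d] by auto
  have "(\<lambda>w. \<Sum>i\<in>I. c i * G (u i, w)) \<in> det_module ?Y"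
    using mean_staysD[OF d mean, of "{}"] by simp
  moreover have "(\<Sum>i\<in>I. c i * G (u i, w)) = f w" for w
  proof -
    have "G (u i, w) = f w" if "i \<in> I" for i
    proof -
      obtain t :: "nat \<Rightarrow> real" where t: "u i = (\<Sum>r<Suc m. of_real (t r) *s e r)" "(\<Sum>r<Suc m. t r * t r) = 1"
        using mean[unfolded spherical_mean_def, THEN conjunct2, THEN conjunct1, rule_format, OF \<open>i \<in> I\<close>] by blast
      then show ?thesis by (rule Gv)
    qed
    then have "(\<Sum>i\<in>I. c i * G (u i, w)) = (\<Sum>i\<in>I. c i) * f w"
      by (simp add: sum_distrib_right)
    then show ?thesis using mean by (simp add: spherical_mean_def)
  qed
  ultimately show ?thesis by simp
qed

theorem first_fundamental_theorem:
  assumes "f \<in> polynomial_functions scale n" "reflection_semiinvariant f"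
  shows "f \<in> det_module ((\<lambda>i w. w i) ` {1..n})"
proof -
  have "m \<le> k \<Longrightarrow> f \<in> det_module (configuration n m)" for m
  proof (induction m)
    case 0
    then show ?case using polynomial_in_det_module[OF assms(1)] by simp
  next
    case (Suc m)
    then show ?case using eliminate_basis_vector[OF _ _ assms(2)] by simp
  qed
  from this[of k] show ?thesis by (simp add: configuration_def)
qed

end

section \<open>Straightening\<close>

lemma sum_fun_apply: "(\<Sum>i\<in>A. f i) x = (\<Sum>i\<in>A. f i x :: complex)"
  by (induction A rule: infinite_finite_induct) auto

text \<open>
  Composing with a transposition so that the last index becomes fixed does not lower the sum, and keeps it only
  if the two values of \<open>p\<close> involved agree. The equality case matters: it decides which terms of the exchange
  relation have the same weight as the original one.
\<close>

lemma rearrangement: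
  fixes u p :: "nat \<Rightarrow> int"
  assumes "\<sigma> permutes {0..<N}" "\<And>s t. s < t \<Longrightarrow> t < N \<Longrightarrow> u s < u t" "\<And>s t. s < t \<Longrightarrow> t < N \<Longrightarrow> p s \<le> p t"
  shows "(\<Sum>t<N. u (\<sigma> t) * p t) < (\<Sum>t<N. u t * p t) \<or>
    (\<Sum>t<N. u (\<sigma> t) * p t) = (\<Sum>t<N. u t * p t) \<and> (\<forall>t<N. p (\<sigma> t) = p t)"
  using assms
proof (induction N arbitrary: \<sigma>)
  case (Suc N)
  have fixed_last: "(\<Sum>t<Suc N. u (\<tau> t) * p t) < (\<Sum>t<Suc N. u t * p t) \<or>
    (\<Sum>t<Suc N. u (\<tau> t) * p t) = (\<Sum>t<Suc N. u t * p t) \<and> (\<forall>t<Suc N. p (\<tau> t) = p t)"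
    if \<tau>: "\<tau> permutes {0..<Suc N}" "\<tau> N = N" for \<tau>
  proof -
    have "\<tau> permutes {0..<N}"
      by (rule permutes_superset[OF \<tau>(1)]) (use \<tau>(2) in \<open>auto simp: less_Suc_eq\<close>)
    from Suc.IH[OF this] Suc.prems(2,3) show ?thesis using \<tau>(2) by (auto simp: less_Suc_eq)
  qed
  show ?case
  proof (cases "\<sigma> N = N")
    case True
    then show ?thesis using fixed_last Suc.prems(1) by blast
  next
    case False
    define a c where "a = \<sigma> N" and "c = Hilbert_Choice.inv \<sigma> N"
    have \<sigma>c: "\<sigma> c = N" using Suc.prems(1) by (simp add: c_def permutes_inverses)
    have "a \<in> {0..<Suc N}" "c \<in> {0..<Suc N}"
      using permutes_in_image[OF Suc.prems(1)] permutes_in_image[OF permutes_inv[OF Suc.prems(1)]]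
      by (auto simp: a_def c_def)
    then have ac: "a < N" "c < N" using False \<sigma>c by (auto simp: a_def less_Suc_eq)
    define \<tau> where "\<tau> = \<sigma> \<circ> transpose c N"
    have \<tau>: "\<tau> permutes {0..<Suc N}" unfolding \<tau>_def
      using ac by (intro permutes_compose permutes_swap_id Suc.prems(1)) auto
    have \<tau>v: "\<tau> N = N" "\<tau> c = a" "\<And>t. t \<noteq> c \<Longrightarrow> t \<noteq> N \<Longrightarrow> \<tau> t = \<sigma> t"
      using \<sigma>c by (auto simp: \<tau>_def a_def transpose_def)
    have split: "(\<Sum>t<Suc N. h t) = h N + (h c + (\<Sum>t\<in>{..<N} - {c}. h t))" for h :: "nat \<Rightarrow> int"
      using ac by (simp add: sum.remove[of _ c])
    have "(\<Sum>t\<in>{..<N} - {c}. u (\<tau> t) * p t) = (\<Sum>t\<in>{..<N} - {c}. u (\<sigma> t) * p t)"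
      using \<tau>v(3) by (intro sum.cong) auto
    then have diff: "(\<Sum>t<Suc N. u (\<tau> t) * p t) - (\<Sum>t<Suc N. u (\<sigma> t) * p t) = (u N - u a) * (p N - p c)"
      unfolding split \<tau>v \<sigma>c a_def[symmetric] by (simp add: algebra_simps)
    have pos: "0 < u N - u a" "0 \<le> p N - p c" using Suc.prems(2)[of a N] Suc.prems(3)[of c N] ac by auto
    show ?thesis
    (* The swap changes the sum by (u N - u a) * (p N - p c), which vanishes only for p N = p c. *)
    proof (cases "p N = p c")
      case True
      then have eq: "(\<Sum>t<Suc N. u (\<tau> t) * p t) = (\<Sum>t<Suc N. u (\<sigma> t) * p t)" using diff by simp
      have "p (\<sigma> t) = p t" if "t < Suc N" "\<forall>t<Suc N. p (\<tau> t) = p t" for t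
      proof (cases "t = c \<or> t = N")
        case True
        then show ?thesis using \<open>p N = p c\<close> \<sigma>c a_def \<tau>v(2) that(2) ac by (metis less_SucI)
      next
        case False
        then show ?thesis using \<tau>v(3) that by metis
      qed
      then show ?thesis using fixed_last[OF \<tau> \<tau>v(1)] unfolding eq by blast
    next
      case False
      then have "0 < (u N - u a) * (p N - p c)" using pos by simp
      then show ?thesis using fixed_last[OF \<tau> \<tau>v(1)] diff by linarith
    qed
  qed
qed simp

lemma total_degree_eq:
  assumes "arc_diagram n M" shows "total_degree n M = 2 * size M"
  using assms
proof (induction M)
  case empty
  then show ?case by (simp add: total_degree_def vertex_degree_def)
next
  case (add a M)
  obtain i j where a: "a = (i, j)" by fastforce
  have ij: "i \<in> {1..n}" "j \<in> {1..n}" using add.prems by (auto simp: arc_diagram_def a)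
  have "total_degree n (add_mset a M) = (\<Sum>v\<in>{1..n}. of_bool (i = v) + of_bool (j = v)) + total_degree n M"
    by (simp add: total_degree_def vertex_degree_def a sum.distrib)
  also have "(\<Sum>v\<in>{1..n}. of_bool (i = v) + of_bool (j = v)) = (2 :: nat)"
    using ij by (simp add: sum.distrib of_bool_def)
  finally show ?case using add by (simp add: arc_diagram_def)
qed

context orthonormal_space begin

definition diagram_term :: "(nat \<times> nat) multiset \<Rightarrow> nat list \<Rightarrow> (nat \<Rightarrow> 'v) \<Rightarrow> complex" where
  "diagram_term M s w = (\<Prod>(i, j)\<in>#M. b (w i) (w j)) * coord_det (\<lambda>c. w (s ! c))"

definition valid_term :: "nat \<Rightarrow> (nat \<times> nat) multiset \<Rightarrow> nat list \<Rightarrow> bool" where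
  "valid_term n M s \<longleftrightarrow> length s = k \<and> set s \<subseteq> {1..n} \<and> set_mset M \<subseteq> {1..n} \<times> {1..n}"

lemma det_module_span_terms:
  assumes "f \<in> det_module ((\<lambda>i w. w i) ` {1..n})"
  shows "f \<in> fun_space.span {diagram_term M s | M s. valid_term n M s}"
  using assms
proof induction
  case zero
  have "0 \<in> fun_space.span {diagram_term M s | M s. valid_term n M s}" by (rule fun_space.span_zero)
  then show ?case by (simp add: zero_fun_def)
next
  case (coord_det y)
  then have "\<forall>c. \<exists>i. c < k \<longrightarrow> i \<in> {1..n} \<and> y c = (\<lambda>w. w i)" by blast
  then obtain i where i: "\<And>c. c < k \<Longrightarrow> i c \<in> {1..n} \<and> y c = (\<lambda>w. w (i c))" by metis
  have "(\<lambda>w. coord_det (\<lambda>c. y c w)) = diagram_term {#} (map i [0..<k])"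
    using i by (auto simp: diagram_term_def fun_eq_iff intro!: coord_det_cong)
  moreover have "valid_term n {#} (map i [0..<k])" using i by (auto simp: valid_term_def)
  ultimately show ?case by (auto intro: fun_space.span_base)
next
  case (add f g)
  then show ?case using fun_space.span_add[of f _ g] by (simp add: plus_fun_def)
next
  case (scale f c)
  moreover have "(\<lambda>p. c * f p) = fscale c f" by (simp add: fscale_def fun_eq_iff)
  ultimately show ?case by (simp only: fun_space.span_scale)
next
  case (mult y z f)
  then obtain i j where ij: "i \<in> {1..n}" "j \<in> {1..n}" "y = (\<lambda>w. w i)" "z = (\<lambda>w. w j)" by blast
  let ?A = "{diagram_term M s | M s. valid_term n M s}"
  from mult.IH show ?case
  proof (induction rule: fun_space.span_induct_alt)
    case base
    have "0 \<in> fun_space.span ?A" by (rule fun_space.span_zero)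
    then show ?case by (simp add: zero_fun_def)
  next
    case (step c x f)
    then obtain M s where Ms: "x = diagram_term M s" "valid_term n M s" by blast
    have "valid_term n (add_mset (i, j) M) s" using Ms(2) ij by (auto simp: valid_term_def)
    then have "diagram_term (add_mset (i, j) M) s \<in> fun_space.span ?A"
      by (intro fun_space.span_base) blast
    then have "fscale c (diagram_term (add_mset (i, j) M) s) + (\<lambda>p. b (y p) (z p) * f p) \<in> fun_space.span ?A"
      by (intro fun_space.span_add fun_space.span_scale step.IH)
    moreover have "fscale c (diagram_term (add_mset (i, j) M) s) + (\<lambda>p. b (y p) (z p) * f p)
        = (\<lambda>p. b (y p) (z p) * (fscale c x + f) p)"
      by (auto simp: fun_eq_iff fscale_def diagram_term_def Ms(1) ij algebra_simps)
    ultimately show ?case by simp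
  qed
qed

text \<open>
  The sum is the determinant of a product of a \<open>(k + 1) \<times> k\<close> and a \<open>k \<times> (k + 1)\<close> matrix, here padded by a zero column
  and a zero row.
\<close>

lemma alternating_sum_zero:
  assumes "\<And>t. t < Suc k \<Longrightarrow> Vector_Spaces.linear scale (*) (\<psi> t)"
  shows "(\<Sum>\<sigma> | \<sigma> permutes {0..<Suc k}. signof \<sigma> * (\<Prod>t<Suc k. \<psi> t (U (\<sigma> t)))) = 0"
proof -
  let ?n = "Suc k"
  let ?A = "mat ?n ?n (\<lambda>(t, r). if r < k then \<psi> t (e r) else 0)"
  let ?B = "mat ?n ?n (\<lambda>(r, s). if r < k then b (e r) (U s) else 0)"
  have "(\<Sum>\<sigma> | \<sigma> permutes {0..<?n}. signof \<sigma> * (\<Prod>t<?n. \<psi> t (U (\<sigma> t))))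
      = det (mat ?n ?n (\<lambda>(t, s). \<psi> t (U s)))"
    by (subst det_def'[of _ ?n])
      (auto intro!: sum.cong prod.cong simp: permutes_in_image atLeast0LessThan simp del: prod.lessThan_Suc)
  also have "mat ?n ?n (\<lambda>(t, s). \<psi> t (U s)) = ?A * ?B"
    by (rule eq_matI)
      (auto simp: scalar_prod_def atLeast0LessThan linear_expand[OF assms, of _ "U _"] mult.commute intro!: sum.cong)
  also have "det (?A * ?B) = det ?A * det ?B" by (rule det_mult[of _ ?n]) auto
  also have "det ?B = 0"
  proof -
    have "det ?B = (\<Sum>p | p permutes {0..<?n}. signof p * (\<Prod>i = 0..<?n. ?B $$ (i, p i)))"
      by (rule det_def') auto
    also have "\<dots> = (\<Sum>p | p permutes {0..<?n}. 0)"
    proof (intro sum.cong refl)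
      fix p assume "p \<in> {p. p permutes {0..<?n}}"
      then have "?B $$ (k, p k) = 0" using permutes_in_image[of p "{0..<?n}" k] by auto
      then have "(\<Prod>i = 0..<?n. ?B $$ (i, p i)) = 0" by (intro prod_zero) (auto intro: bexI[of _ k])
      then show "signof p * (\<Prod>i = 0..<?n. ?B $$ (i, p i)) = 0" by simp
    qed
    finally show ?thesis by simp
  qed
  finally show ?thesis by simp
qed

text \<open>
  By the Leibniz formula for the determinant, this is a sum of instances of \<open>alternating_sum_zero\<close>. For \<open>l = k + 1\<close> no
  alternated vector enters the determinant, and the relation is the vanishing of a Gram minor of size \<open>k + 1\<close>.
\<close>

lemma exchange_relation:
  assumes l: "1 \<le> l" "l \<le> Suc k"
  shows "(\<Sum>\<sigma> | \<sigma> permutes {0..<Suc k}. signof \<sigma> * ((\<Prod>t<l. b (U (\<sigma> t)) (Z t)) *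
    coord_det (\<lambda>c. if c < Suc k - l then U (\<sigma> (l + c)) else Y c))) = 0"
proof -
  let ?q = "Suc k - l" and ?S = "\<lambda>N. {\<sigma> :: nat \<Rightarrow> nat. \<sigma> permutes {0..<N}}"
  define \<psi> where "\<psi> p t = (if t < l then (\<lambda>v. b v (Z t)) else (\<lambda>v. b (e (p (t - l))) v))" for p t
  define C where "C p = signof p * (\<Prod>c\<in>{?q..<k}. b (e (p c)) (Y c))" for p
  have lin: "Vector_Spaces.linear scale (*) (\<psi> p t)" for p t
    using linear_b[of "Z t"] form by (auto simp: \<psi>_def symmetric_bilinear_form_def)
  have "(\<Prod>t<l. b (U (\<sigma> t)) (Z t)) * coord_det (\<lambda>c. if c < ?q then U (\<sigma> (l + c)) else Y c)
      = (\<Sum>p\<in>?S k. C p * (\<Prod>t<Suc k. \<psi> p t (U (\<sigma> t))))" for \<sigma>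
  proof -
    have "(\<Prod>t<l. b (U (\<sigma> t)) (Z t)) * (\<Prod>c<k. b (e (p c)) (if c < ?q then U (\<sigma> (l + c)) else Y c))
       = (\<Prod>c\<in>{?q..<k}. b (e (p c)) (Y c)) * (\<Prod>t<Suc k. \<psi> p t (U (\<sigma> t)))" for p
    proof -
      have "{..<k} = {..<?q} \<union> {?q..<k}" using l by auto
      then have "(\<Prod>c<k. b (e (p c)) (if c < ?q then U (\<sigma> (l + c)) else Y c))
        = (\<Prod>c<?q. b (e (p c)) (U (\<sigma> (l + c)))) * (\<Prod>c\<in>{?q..<k}. b (e (p c)) (Y c))"
        by (simp add: prod.union_disjoint[of "{..<?q}"] ivl_disj_int)
      moreover have "(\<Prod>c<?q. b (e (p c)) (U (\<sigma> (l + c)))) = (\<Prod>t\<in>{l..<Suc k}. \<psi> p t (U (\<sigma> t)))"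
        by (rule prod.reindex_bij_witness[of _ "\<lambda>t. t - l" "\<lambda>c. l + c"]) (auto simp: \<psi>_def)
      moreover have "(\<Prod>t<l. b (U (\<sigma> t)) (Z t)) = (\<Prod>t<l. \<psi> p t (U (\<sigma> t)))" by (simp add: \<psi>_def)
      moreover have "(\<Prod>t<Suc k. \<psi> p t (U (\<sigma> t))) = (\<Prod>t<l. \<psi> p t (U (\<sigma> t))) * (\<Prod>t\<in>{l..<Suc k}. \<psi> p t (U (\<sigma> t)))"
      proof -
        have "{..<Suc k} = {..<l} \<union> {l..<Suc k}" using l by auto
        then show ?thesis by (simp add: prod.union_disjoint[of "{..<l}"] ivl_disj_int del: prod.lessThan_Suc)
      qed
      ultimately show ?thesis by (simp add: mult_ac del: prod.lessThan_Suc)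
    qed
    then show ?thesis
      unfolding coord_det_leibniz sum_distrib_left C_def
      by (intro sum.cong refl) (simp add: mult_ac del: prod.lessThan_Suc)
  qed
  then have "(\<Sum>\<sigma>\<in>?S (Suc k). signof \<sigma> * ((\<Prod>t<l. b (U (\<sigma> t)) (Z t)) * coord_det (\<lambda>c. if c < ?q then U (\<sigma> (l + c)) else Y c)))
      = (\<Sum>\<sigma>\<in>?S (Suc k). \<Sum>p\<in>?S k. C p * (signof \<sigma> * (\<Prod>t<Suc k. \<psi> p t (U (\<sigma> t)))))"
    by (simp add: sum_distrib_left mult_ac del: prod.lessThan_Suc)
  also have "\<dots> = (\<Sum>p\<in>?S k. C p * (\<Sum>\<sigma>\<in>?S (Suc k). signof \<sigma> * (\<Prod>t<Suc k. \<psi> p t (U (\<sigma> t)))))"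
    unfolding sum_distrib_left by (rule sum.swap)
  also have "\<dots> = 0" 
  proof (rule sum.neutral, rule ballI)
    fix p
    show "C p * (\<Sum>\<sigma>\<in>?S (Suc k). signof \<sigma> * (\<Prod>t<Suc k. \<psi> p t (U (\<sigma> t)))) = 0"
      using alternating_sum_zero[of "\<psi> p" U, OF lin] by (simp only: mult_zero_right)
  qed
  finally show ?thesis .
qed

text \<open>
  Permutations of the vectors inside the determinant reproduce the identity term with the same sign, so these
  terms add up and do not cancel.
\<close>

lemma coord_det_permute_tail:
  assumes l: "1 \<le> l" "l \<le> Suc k" and \<sigma>: "\<sigma> permutes {0..<Suc k}" "\<And>t. t < l \<Longrightarrow> \<sigma> t = t"
  shows "signof \<sigma> * coord_det (\<lambda>c. if c < Suc k - l then V (\<sigma> (l + c)) else Y c)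
    = coord_det (\<lambda>c. if c < Suc k - l then V (l + c) else Y c)"
proof -
  let ?q = "Suc k - l" and ?A = "{l..<Suc k}" and ?f = "\<lambda>t. t - l"
  have \<sigma>A: "\<sigma> permutes ?A"
    by (rule permutes_superset[OF \<sigma>(1)]) (use \<sigma>(2) in auto)
  have inj: "inj_on ?f ?A" by (auto simp: inj_on_def)
  have bij: "bij_betw ?f ?A {0..<?q}"
    by (rule bij_betw_byWitness[where f' = "\<lambda>c. c + l"]) auto
  define \<pi> where "\<pi> = map_permutation ?A ?f \<sigma>"
  have \<pi>q: "\<pi> permutes {0..<?q}" unfolding \<pi>_def by (rule map_permutation_permutes[OF bij \<sigma>A])
  have \<pi>k: "\<pi> permutes {0..<k}" by (rule permutes_subset[OF \<pi>q]) (use l in auto)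
  have sign: "sign \<pi> = sign \<sigma>" unfolding \<pi>_def by (rule sign_map_permutation[OF inj \<sigma>A]) simp
  have \<pi>c: "l + \<pi> c = \<sigma> (l + c)" if "c < ?q" for c
  proof -
    have "\<pi> (?f (l + c)) = ?f (\<sigma> (l + c))"
      unfolding \<pi>_def by (rule map_permutation_apply[OF inj]) (use that in auto)
    moreover have "\<sigma> (l + c) \<in> ?A" using permutes_in_image[OF \<sigma>A] that by auto
    ultimately show ?thesis by auto
  qed
  define y where "y c = (if c < ?q then V (l + c) else Y c)" for c
  have "y (\<pi> c) = (if c < ?q then V (\<sigma> (l + c)) else Y c)" for c
    using permutes_in_image[OF \<pi>q, of c] permutes_not_in[OF \<pi>q, of c] by (auto simp: y_def \<pi>c)
  then have "coord_det (\<lambda>c. if c < ?q then V (\<sigma> (l + c)) else Y c) = signof \<pi> * coord_det y"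
    using coord_det_permute[OF \<pi>k, of y] by simp
  then have "signof \<sigma> * coord_det (\<lambda>c. if c < ?q then V (\<sigma> (l + c)) else Y c) = of_int (sign \<sigma> * sign \<sigma>) * coord_det y"
    unfolding sign by (simp del: sign_idempotent)
  then show ?thesis by (simp add: y_def[abs_def])
qed

lemma coord_det_rearrange:
  assumes "length s = k" "mset s' = mset s"
  shows "\<exists>\<epsilon>. (\<epsilon> = 1 \<or> \<epsilon> = -1) \<and> (\<forall>w. coord_det (\<lambda>c. w (s' ! c)) = \<epsilon> * coord_det (\<lambda>c. w (s ! c)))"
proof -
  obtain p where p: "p permutes {..<length s}" "permute_list p s = s'"
    using mset_eq_permutation[OF assms(2)] by blast
  have "coord_det (\<lambda>c. w (s' ! c)) = signof p * coord_det (\<lambda>c. w (s ! c))" for w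
  proof -
    have "coord_det (\<lambda>c. w (s' ! c)) = coord_det (\<lambda>c. w (s ! p c))"
      using p assms(1) by (intro coord_det_cong) (auto simp: permute_list_nth)
    also have "\<dots> = signof p * coord_det (\<lambda>c. w (s ! c))"
      using p(1) assms(1) by (intro coord_det_permute) (simp add: atLeast0LessThan)
    finally show ?thesis .
  qed
  then show ?thesis by (intro exI[of _ "signof p"]) (auto simp: sign_def)
qed

lemma diagram_term_rearrange:
  assumes "length s = k" "mset s' = mset s"
  shows "\<exists>\<epsilon>. (\<epsilon> = 1 \<or> \<epsilon> = -1) \<and> diagram_term M s' = fscale \<epsilon> (diagram_term M s)"
  using coord_det_rearrange[OF assms] by (auto simp: diagram_term_def fscale_def fun_eq_iff)

definition orient :: "nat \<times> nat \<Rightarrow> nat \<times> nat" where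
  "orient a = (min (fst a) (snd a), max (fst a) (snd a))"

lemma diagram_term_orient: "diagram_term (image_mset orient M) s = diagram_term M s"
proof -
  have "(case orient a of (i, j) \<Rightarrow> b (w i) (w j)) = (case a of (i, j) \<Rightarrow> b (w i) (w j))" for a w
    by (cases a) (auto simp: orient_def min_def max_def b_commute)
  then show ?thesis by (simp add: diagram_term_def fun_eq_iff image_mset.compositionality o_def)
qed

definition term_weight :: "nat \<Rightarrow> (nat \<times> nat) multiset \<Rightarrow> nat list \<Rightarrow> nat" where
  "term_weight n M s = arc_weight M + Suc n * sum_list s"

lemma arc_weight_orient: "arc_weight (image_mset orient M) = arc_weight M"
  by (induction M) (auto simp: orient_def min_def max_def)

text \<open>
  The \<open>k + 1\<close> vertices \<open>u\<close> are the left ends of the chain and the painted vertices from the \<open>l\<close>th on; their partners \<open>p\<close>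
  are the right ends of the chain, and \<open>n + 1\<close> for a painted vertex. Both sequences increase, so the given
  term is the heaviest one of the exchange relation, and the terms of equal weight are copies of it.
\<close>

lemma exchange_smaller:
  assumes valid: "valid_term n M s" and sorted: "sorted_wrt (<) s"
    and l: "1 \<le> l" "l \<le> Suc k" "length cs = l" and cs: "set cs \<subseteq> set_mset M" "sorted_wrt (\<lless>) cs"
    and left: "l \<le> k \<Longrightarrow> fst (cs ! (l - 1)) < s ! (l - 1)"
  shows "diagram_term M s \<in> fun_space.span {diagram_term M' s' | M' s'.
    valid_term n M' s' \<and> size M' = size M \<and> term_weight n M' s' < term_weight n M s}"
    (is "_ \<in> fun_space.span ?A")
proof -
  let ?q = "Suc k - l" and ?P = "{\<sigma> :: nat \<Rightarrow> nat. \<sigma> permutes {0..<Suc k}}"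
  have s: "length s = k" "set s \<subseteq> {1..n}" and M: "set_mset M \<subseteq> {1..n} \<times> {1..n}"
    using valid by (auto simp: valid_term_def)
  define u where "u t = (if t < l then fst (cs ! t) else s ! (t - 1))" for t
  define p where "p t = (if t < l then snd (cs ! t) else Suc n)" for t
  have csM: "cs ! t \<in># M" if "t < l" for t using cs(1) l(3) that by auto
  have csR: "fst (cs ! t) \<in> {1..n}" "snd (cs ! t) \<in> {1..n}" if "t < l" for t
    using subsetD[OF M csM[OF that]] by (simp_all only: mem_Times_iff)
  have u_range: "u t \<in> {1..n}" if "t < Suc k" for t
  proof (cases "t < l")
    case True
    then show ?thesis using csR by (simp only: u_def if_True)
  next
    case False
    then have "s ! (t - 1) \<in> set s" using that s(1) l(1) by (intro nth_mem) auto
    then show ?thesis using False s(2) by (simp only: u_def if_False) blast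
  qed
  have chain: "cs ! t \<lless> cs ! t'" if "t < t'" "t' < l" for t t'
    using cs(2) l(3) that by (auto simp: sorted_wrt_iff_nth_less)
  have s_mono: "s ! t < s ! t'" if "t < t'" "t' < k" for t t'
    using sorted s(1) that by (auto simp: sorted_wrt_iff_nth_less)
  have u_mono: "u t < u t'" if "t < t'" "t' < Suc k" for t t'
  proof -
    consider "t' < l" | "t < l" "l \<le> t'" | "l \<le> t" by linarith
    then show ?thesis
    proof cases
      case 1
      then show ?thesis using chain[OF that(1)] that by (simp add: u_def precedes_def)
    next
      case 2
      have "fst (cs ! t) \<le> fst (cs ! (l - 1))"
      proof (cases "t = l - 1")
        case False
        then have "t < l - 1" using 2 by linarith
        then show ?thesis using chain[of t "l - 1"] l(1) by (simp add: precedes_def)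
      qed simp
      also have "\<dots> < s ! (l - 1)" using left 2 that by simp
      also have "\<dots> \<le> s ! (t' - 1)"
      proof (cases "l = t'")
        case False
        then have "l - 1 < t' - 1" "t' - 1 < k" using 2 that(2) l(1) by linarith+
        then show ?thesis using s_mono by (metis less_imp_le)
      qed simp
      finally show ?thesis using 2 by (simp add: u_def)
    next
      case 3
      then show ?thesis using s_mono[of "t - 1" "t' - 1"] that l(1) by (simp add: u_def)
    qed
  qed
  have p_le: "p t < Suc n" if "t < l" for t using csR(2)[OF that] that by (simp add: p_def)
  have p_mono: "p t \<le> p t'" if "t < t'" for t t'
    using chain[OF that] p_le[of t] that by (cases "t' < l") (auto simp: p_def precedes_def)
  have p_strict: "p t \<noteq> p t'" if "t < l" "t \<noteq> t'" for t t'
    using chain[of t t'] chain[of t' t] p_le[of t] that by (cases "t' < l"; cases "t < t'") (auto simp: p_def precedes_def)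
  have "distinct cs"
    unfolding distinct_conv_nth using chain l(3) by (metis linorder_neqE_nat less_irrefl precedes_def)
  have "mset cs \<subseteq># M"
  proof (rule mset_subset_eqI)
    fix a show "count (mset cs) a \<le> count M a"
    proof (cases "a \<in> set cs")
      case True
      then have "count (mset cs) a = 1"
        using spec[OF distinct_count_atmost_1[THEN iffD1, OF \<open>distinct cs\<close>], of a] by simp
      moreover have "0 < count M a" using True cs(1) by auto
      ultimately show ?thesis by simp
    next
      case False
      then have "count (mset cs) a = 0" by (simp add: count_eq_zero_iff)
      then show ?thesis by (simp only: le0)
    qed
  qed
  define R where "R = M - mset cs"
  have R: "M = R + mset cs" using \<open>mset cs \<subseteq># M\<close> by (simp add: R_def)
  define M' where "M' \<sigma> = R + mset (map (\<lambda>t. (u (\<sigma> t), p t)) [0..<l])" for \<sigma>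
  define s' where "s' \<sigma> = map (\<lambda>t. u (\<sigma> t)) [l..<Suc k] @ take (l - 1) s" for \<sigma>
  have cs_map: "cs = map (\<lambda>t. (u t, p t)) [0..<l]"
    using l(3) by (intro nth_equalityI) (auto simp: u_def p_def)
  have M_id: "M' id = M" unfolding M'_def R by (subst cs_map) (simp only: id_apply)
  have s'_id: "s' id = drop (l - 1) s @ take (l - 1) s"
  proof -
    have "map u [l..<Suc k] = drop (l - 1) s"
      using s(1) l(1) by (intro nth_equalityI) (auto simp: u_def simp del: upt_Suc)
    then show ?thesis by (simp add: s'_def)
  qed
  have valid': "valid_term n (M' \<sigma>) (s' \<sigma>)" and size': "size (M' \<sigma>) = size M" if "\<sigma> \<in> ?P" for \<sigma>
  proof -
    have \<sigma>: "\<sigma> t < Suc k" if "t < Suc k" for t using permutes_in_image[of \<sigma> "{0..<Suc k}" t] \<open>\<sigma> \<in> ?P\<close> that by auto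
    have "set (s' \<sigma>) \<subseteq> {1..n}"
    proof -
      have "u (\<sigma> t) \<in> {1..n}" if "t \<in> {l..<Suc k}" for t using u_range[OF \<sigma>] that by auto
      then show ?thesis using s(2) set_take_subset[of "l - 1" s] by (auto simp: s'_def simp del: upt_Suc)
    qed
    moreover have "set_mset (M' \<sigma>) \<subseteq> {1..n} \<times> {1..n}"
    proof -
      have "p t \<in> {1..n}" if "t < l" for t using csR(2)[OF that] that by (simp add: p_def)
      moreover have "u (\<sigma> t) \<in> {1..n}" if "t < l" for t using u_range[OF \<sigma>] that l(2) by auto
      ultimately show ?thesis using M R by (auto simp: M'_def)
    qed
    moreover have "length (s' \<sigma>) = k" using s(1) l by (simp add: s'_def del: upt_Suc)
    ultimately show "valid_term n (M' \<sigma>) (s' \<sigma>)" by (simp add: valid_term_def)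
    show "size (M' \<sigma>) = size M" using l(3) by (simp add: M'_def R)
  qed
  have weight: "term_weight n (M' \<sigma>) (s' \<sigma>) = arc_weight R + Suc n * sum_list (take (l - 1) s) + (\<Sum>t<Suc k. u (\<sigma> t) * p t)" for \<sigma>
  proof -
    have "arc_weight (M' \<sigma>) = arc_weight R + (\<Sum>t<l. u (\<sigma> t) * p t)"
      by (simp add: M'_def arc_weight_def[of "mset _"] sum_mset_sum_list o_def interv_sum_list_conv_sum_set_nat atLeast0LessThan
          flip: mset_map)
    moreover have "Suc n * sum_list (map (\<lambda>t. u (\<sigma> t)) [l..<Suc k]) = (\<Sum>t\<in>{l..<Suc k}. u (\<sigma> t) * p t)"
      unfolding interv_sum_list_conv_sum_set_nat set_upt sum_distrib_left
      by (intro sum.cong refl) (simp add: p_def mult.commute)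
    moreover have "(\<Sum>t<Suc k. u (\<sigma> t) * p t) = (\<Sum>t<l. u (\<sigma> t) * p t) + (\<Sum>t\<in>{l..<Suc k}. u (\<sigma> t) * p t)"
    proof -
      have "{..<Suc k} = {..<l} \<union> {l..<Suc k}" using l(2) by auto
      then show ?thesis by (simp add: sum.union_disjoint[of "{..<l}"] ivl_disj_int del: sum.lessThan_Suc)
    qed
    ultimately show ?thesis
      by (simp add: term_weight_def s'_def algebra_simps del: upt_Suc sum.lessThan_Suc)
  qed
  have weight_id: "term_weight n (M' id) (s' id) = term_weight n M s"
    unfolding M_id s'_id term_weight_def by (metis append_take_drop_id add.commute sum_list_append)
  define T where "T \<sigma> = diagram_term (M' \<sigma>) (s' \<sigma>)" for \<sigma>
  have T_eq: "T \<sigma> w = (\<Prod>(i, j)\<in>#R. b (w i) (w j)) * ((\<Prod>t<l. b (w (u (\<sigma> t))) (w (p t))) *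
      coord_det (\<lambda>c. if c < ?q then w (u (\<sigma> (l + c))) else w (s ! (c - ?q))))" for \<sigma> w
  proof -
    have "(\<Prod>(i, j)\<in>#mset (map (\<lambda>t. (u (\<sigma> t), p t)) [0..<l]). b (w i) (w j)) = (\<Prod>t<l. b (w (u (\<sigma> t))) (w (p t)))"
    proof -
      have "prod_list (map f [0..<m]) = (\<Prod>t<m. f t)" for f :: "nat \<Rightarrow> complex" and m
        by (induction m) auto
      then show ?thesis by (simp add: prod_mset_prod_list o_def flip: mset_map)
    qed
    moreover have "coord_det (\<lambda>c. w (s' \<sigma> ! c)) = coord_det (\<lambda>c. if c < ?q then w (u (\<sigma> (l + c))) else w (s ! (c - ?q)))"
    proof (rule coord_det_cong)
      fix c assume c: "c < k"
      show "w (s' \<sigma> ! c) = (if c < ?q then w (u (\<sigma> (l + c))) else w (s ! (c - ?q)))"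
        using c l by (auto simp: s'_def nth_append simp del: upt_Suc)
    qed
    ultimately show ?thesis by (simp add: T_def diagram_term_def M'_def)
  qed
  have relation: "(\<Sum>\<sigma>\<in>?P. signof \<sigma> * T \<sigma> w) = 0" for w
  proof -
    have "(\<Sum>\<sigma>\<in>?P. signof \<sigma> * T \<sigma> w) = (\<Prod>(i, j)\<in>#R. b (w i) (w j)) *
      (\<Sum>\<sigma>\<in>?P. signof \<sigma> * ((\<Prod>t<l. b (w (u (\<sigma> t))) (w (p t))) *
      coord_det (\<lambda>c. if c < ?q then w (u (\<sigma> (l + c))) else w (s ! (c - ?q)))))"
      unfolding T_eq sum_distrib_left by (simp only: mult_ac)
    then show ?thesis using exchange_relation[OF l(1,2), of "\<lambda>t. w (u t)" "\<lambda>t. w (p t)" "\<lambda>c. w (s ! (c - ?q))"] by simp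
  qed
  (* The permutations that only move vertices inside the determinant. *)
  define E where "E = {\<sigma> \<in> ?P. \<forall>t<l. \<sigma> t = t}"
  have finP: "finite ?P" by (rule finite_permutations) simp
  have E: "E \<subseteq> ?P" "id \<in> E" by (auto simp: E_def permutes_id)
  have "card E > 0" using E finP by (metis card_gt_0_iff empty_iff finite_subset)
  have in_E: "signof \<sigma> * T \<sigma> w = T id w" if "\<sigma> \<in> E" for \<sigma> w
  proof -
    have \<sigma>: "\<sigma> permutes {0..<Suc k}" "\<And>t. t < l \<Longrightarrow> \<sigma> t = t" using that by (auto simp: E_def)
    have "(\<Prod>t<l. b (w (u (\<sigma> t))) (w (p t))) = (\<Prod>t<l. b (w (u t)) (w (p t)))"
      using \<sigma>(2) by simp
    then show ?thesis
      unfolding T_eq id_apply using coord_det_permute_tail[OF l(1,2) \<sigma>, of "\<lambda>t. w (u t)" "\<lambda>c. w (s ! (c - ?q))"]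
      by (simp add: mult.left_commute)
  qed
  have smaller: "T \<sigma> \<in> ?A" if "\<sigma> \<in> ?P - E" for \<sigma>
  proof -
    have "(\<Sum>t<Suc k. int (u (\<sigma> t)) * int (p t)) < (\<Sum>t<Suc k. int (u t) * int (p t)) \<or>
      (\<Sum>t<Suc k. int (u (\<sigma> t)) * int (p t)) = (\<Sum>t<Suc k. int (u t) * int (p t)) \<and> (\<forall>t<Suc k. int (p (\<sigma> t)) = int (p t))"
      by (rule rearrangement) (use that u_mono p_mono in auto)
    moreover have "\<not> (\<forall>t<Suc k. int (p (\<sigma> t)) = int (p t))"
    proof
      assume *: "\<forall>t<Suc k. int (p (\<sigma> t)) = int (p t)"
      have "\<sigma> t = t" if "t < l" for t
      proof (rule ccontr)
        assume "\<sigma> t \<noteq> t"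
        then have "p t \<noteq> p (\<sigma> t)" using p_strict[OF \<open>t < l\<close>, of "\<sigma> t"] by simp
        then show False using * that l(2) by auto
      qed
      then show False using \<open>\<sigma> \<in> ?P - E\<close> by (auto simp: E_def)
    qed
    ultimately have "int (\<Sum>t<Suc k. u (\<sigma> t) * p t) < int (\<Sum>t<Suc k. u t * p t)"
      unfolding of_nat_sum of_nat_mult by blast
    then have "(\<Sum>t<Suc k. u (\<sigma> t) * p t) < (\<Sum>t<Suc k. u t * p t)" unfolding of_nat_less_iff .
    then have "term_weight n (M' \<sigma>) (s' \<sigma>) < term_weight n M s"
      unfolding weight_id[symmetric] weight id_apply by (rule add_strict_left_mono)
    then show ?thesis using valid'[of \<sigma>] size'[of \<sigma>] that unfolding T_def by blast
  qed
  have relation': "of_nat (card E) * T id w = - (\<Sum>\<sigma>\<in>?P - E. signof \<sigma> * T \<sigma> w)" for w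
  proof -
    have "(\<Sum>\<sigma>\<in>?P. signof \<sigma> * T \<sigma> w) = (\<Sum>\<sigma>\<in>?P - E. signof \<sigma> * T \<sigma> w) + (\<Sum>\<sigma>\<in>E. signof \<sigma> * T \<sigma> w)"
      by (rule sum.subset_diff[OF E(1) finP])
    also have "(\<Sum>\<sigma>\<in>E. signof \<sigma> * T \<sigma> w) = of_nat (card E) * T id w" by (simp add: in_E)
    finally show ?thesis using relation[of w] by (simp add: eq_neg_iff_add_eq_0 add.commute)
  qed
  have "T id = fscale (- 1 / of_nat (card E)) (\<Sum>\<sigma>\<in>?P - E. fscale (signof \<sigma>) (T \<sigma>))"
  proof
    fix w
    have "T id w = - 1 / of_nat (card E) * - (of_nat (card E) * T id w)" using \<open>card E > 0\<close> by simp
    then show "T id w = fscale (- 1 / of_nat (card E)) (\<Sum>\<sigma>\<in>?P - E. fscale (signof \<sigma>) (T \<sigma>)) w"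
      unfolding relation' by (simp add: fscale_def sum_fun_apply)
  qed
  also have "\<dots> \<in> fun_space.span ?A"
    by (intro fun_space.span_scale fun_space.span_sum fun_space.span_base smaller)
  finally have T_id: "T id \<in> fun_space.span ?A" .
  have "mset s = mset (s' id)" unfolding s'_id by (metis append_take_drop_id mset_append union_commute)
  moreover have "length (s' id) = k" using valid'[of id] by (simp add: valid_term_def permutes_id)
  ultimately obtain \<epsilon> where "diagram_term M s = fscale \<epsilon> (diagram_term M (s' id))"
    using diagram_term_rearrange by blast
  then have "diagram_term M s = fscale \<epsilon> (T id)" by (simp add: T_def M_id)
  then show ?thesis using T_id by (simp add: fun_space.span_scale)
qed

lemma painting_violation:
  assumes "arc_diagram n M" "S \<subseteq> {1..n}" "card S = k" "(M, S) \<notin> painted_diagrams k n (2 * size M + k)"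
  obtains l cs where "1 \<le> l" "l \<le> Suc k" "length cs = l" "set cs \<subseteq> set_mset M" "sorted_wrt (\<lless>) cs"
    "l \<le> k \<Longrightarrow> fst (cs ! (l - 1)) < sorted_list_of_set S ! (l - 1)"
proof (cases "decomposes_into_weak_nestings k M")
  case False
  have "\<And>p. p \<in># M \<Longrightarrow> fst p \<le> snd p" using assms(1) by (auto simp: arc_diagram_def)
  from long_chain_if_not_decomposable[OF False this] show ?thesis using that[of "Suc k"] by auto
next
  case True
  then have "\<not> painting_rule k M S"
    using assms total_degree_eq[OF assms(1)] by (simp add: painted_diagrams_def)
  then obtain l a where l: "l \<in> {1..k}" "a \<in># layer M l" "fst a < sorted_list_of_set S ! (l - 1)"
    by (auto simp: painting_rule_def not_le)
  then obtain l' where l': "l = Suc l'" by (cases l) auto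
  obtain cs where "length cs = l" "last cs = a" "set cs \<subseteq> set_mset M" "sorted_wrt (\<lless>) cs"
    using layer_chain[of a M l'] l(2) l' by auto
  moreover from this have "cs ! (l - 1) = a" using l(1) by (simp add: last_conv_nth flip: length_0_conv)
  ultimately show ?thesis using that[of l cs] l by auto
qed

lemma straightening:
  assumes "valid_term n M s"
  shows "diagram_term M s \<in> fun_space.span ((\<lambda>(M, S). diagram_term M (sorted_list_of_set S)) ` painted_diagrams k n (2 * size M + k))"
  using assms
proof (induction "term_weight n M s" arbitrary: M s rule: less_induct)
  case less
  let ?B = "(\<lambda>(M, S). diagram_term M (sorted_list_of_set S)) ` painted_diagrams k n (2 * size M + k)"
  have s: "length s = k" "set s \<subseteq> {1..n}" and M: "set_mset M \<subseteq> {1..n} \<times> {1..n}"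
    using less.prems by (auto simp: valid_term_def)
  show ?case
  proof (cases "distinct s")
    case False
    then obtain i j where ij: "i < k" "j < k" "i \<noteq> j" "s ! i = s ! j" using s(1) by (auto simp: distinct_conv_nth)
    then have "diagram_term M s = 0"
      by (simp add: diagram_term_def fun_eq_iff) (metis coord_det_identical)
    then show ?thesis by (simp add: fun_space.span_zero)
  next
    case True
    (* Neither the orientation of arcs nor the order of painted vertices affects the weight. *)
    define M0 S where "M0 = image_mset orient M" and "S = set s"
    define s0 where "s0 = sorted_list_of_set S"
    have mset_s0: "mset s0 = mset s" using True by (simp add: s0_def S_def sorted_list_of_set_sort_remdups distinct_remdups_id)
    have sorted: "sorted_wrt (<) s0" unfolding s0_def S_def by simp
    have S: "S \<subseteq> {1..n}" "card S = k" using s True by (auto simp: S_def distinct_card)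
    have arcs: "arc_diagram n M0" using M by (auto simp: arc_diagram_def M0_def orient_def min_def max_def)
    have valid0: "valid_term n M0 s0"
    proof -
      have "set s0 = set s" "length s0 = length s"
        using mset_eq_setD[OF mset_s0] mset_eq_length[OF mset_s0] by auto
      moreover have "set_mset M0 \<subseteq> {1..n} \<times> {1..n}" using M by (auto simp: M0_def orient_def min_def max_def)
      ultimately show ?thesis using s by (simp add: valid_term_def)
    qed
    have weight0: "term_weight n M0 s0 = term_weight n M s"
      unfolding term_weight_def M0_def arc_weight_orient using mset_s0 by (metis sum_mset_sum_list)
    have size0: "size M0 = size M" by (simp add: M0_def)
    have "diagram_term M0 s0 \<in> fun_space.span ?B"
    proof (cases "(M0, S) \<in> painted_diagrams k n (2 * size M0 + k)")
      case True
      then show ?thesis unfolding s0_def size0 by (intro fun_space.span_base) force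
    next
      case False
      obtain l cs where lcs: "1 \<le> l" "l \<le> Suc k" "length cs = l" "set cs \<subseteq> set_mset M0" "sorted_wrt (\<lless>) cs"
        "l \<le> k \<Longrightarrow> fst (cs ! (l - 1)) < s0 ! (l - 1)"
        using painting_violation[OF arcs S False] unfolding s0_def by blast
      have "{diagram_term M' s' | M' s'. valid_term n M' s' \<and> size M' = size M0 \<and> term_weight n M' s' < term_weight n M0 s0}
        \<subseteq> fun_space.span ?B"
        using less.hyps unfolding weight0 size0 by (auto simp: size0) metis
      then have "fun_space.span {diagram_term M' s' | M' s'. valid_term n M' s' \<and> size M' = size M0 \<and> term_weight n M' s' < term_weight n M0 s0}
        \<subseteq> fun_space.span ?B"
        by (intro fun_space.span_minimal fun_space.subspace_span)
      then show ?thesis using exchange_smaller[OF valid0 sorted lcs] by blast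
    qed
    moreover obtain \<epsilon> where "diagram_term M s = fscale \<epsilon> (diagram_term M s0)"
      using diagram_term_rearrange[of s0 s M] mset_s0 valid0 by (auto simp: valid_term_def)
    ultimately show ?thesis
      using diagram_term_orient[of M s0] by (simp add: M0_def fun_space.span_scale)
  qed
qed

end

section \<open>Linear independence of painted diagrams\<close>

text \<open>
  Compare coefficients in one variable at a time.
\<close>

lemma monomials_independent:
  fixes c :: "'a \<Rightarrow> complex" and \<beta> :: "'a \<Rightarrow> 'v \<Rightarrow> nat"
  assumes "finite V" "finite A" "\<And>x. (\<Sum>a\<in>A. c a * (\<Prod>v\<in>V. x v ^ \<beta> a v)) = 0"
  shows "(\<Sum>a | a \<in> A \<and> (\<forall>v\<in>V. \<beta> a v = \<gamma> v). c a) = 0"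
  using assms
proof (induction V arbitrary: A rule: finite_induct)
  case empty
  then show ?case by simp
next
  case (insert v V)
  let ?A = "{a \<in> A. \<beta> a v = \<gamma> v}"
  have "(\<Sum>a\<in>?A. c a * (\<Prod>v\<in>V. x v ^ \<beta> a v)) = 0" for x
  proof -
    define P where "P = (\<Sum>a\<in>A. monom (c a * (\<Prod>v\<in>V. x v ^ \<beta> a v)) (\<beta> a v))"
    have "poly P z = 0" for z
    proof -
      have "poly P z = (\<Sum>a\<in>A. c a * (\<Prod>u\<in>insert v V. (x(v := z)) u ^ \<beta> a u))"
        unfolding P_def poly_sum
      proof (intro sum.cong refl)
        fix a
        have "(\<Prod>u\<in>V. (x(v := z)) u ^ \<beta> a u) = (\<Prod>u\<in>V. x u ^ \<beta> a u)"
          using insert.hyps(2) by (intro prod.cong) auto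
        then show "poly (monom (c a * (\<Prod>v\<in>V. x v ^ \<beta> a v)) (\<beta> a v)) z
            = c a * (\<Prod>u\<in>insert v V. (x(v := z)) u ^ \<beta> a u)"
          by (subst prod.insert[OF insert.hyps(1,2)]) (simp add: poly_monom)
      qed
      then show ?thesis by (simp only: insert.prems(2))
    qed
    then have "P = 0" using poly_all_0_iff_0 by blast
    then have "coeff P (\<gamma> v) = 0" by simp
    moreover have "coeff P (\<gamma> v) = (\<Sum>a\<in>A. if \<beta> a v = \<gamma> v then c a * (\<Prod>v\<in>V. x v ^ \<beta> a v) else 0)"
      by (simp add: P_def coeff_sum)
    ultimately show ?thesis using insert.prems(1) by (simp add: sum.inter_filter)
  qed
  then have "(\<Sum>a | a \<in> ?A \<and> (\<forall>v\<in>V. \<beta> a v = \<gamma> v). c a) = 0"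
    using insert.prems(1) by (intro insert.IH) auto
  then show ?case by (simp add: conj_assoc)
qed

lemma prod_mset_image_count:
  fixes f :: "'a \<Rightarrow> complex"
  assumes "finite X" "set_mset E \<subseteq> X"
  shows "(\<Prod>i\<in>#E. f i) = (\<Prod>i\<in>X. f i ^ count E i)"
  unfolding image_prod_mset_multiplicity using assms
  by (intro prod.mono_neutral_left) (auto simp: not_in_iff)

definition row_arcs :: "'a list \<Rightarrow> (nat \<Rightarrow> nat) \<Rightarrow> nat \<Rightarrow> 'a multiset" where
  "row_arcs L \<rho> r = image_mset ((!) L) {#q \<in># mset [0..<length L]. \<rho> q = r#}"

lemma sum_filter_mset_fibres:
  assumes "\<And>q. q \<in># X \<Longrightarrow> g q < (k :: nat)"
  shows "(\<Sum>r<k. {#q \<in># X. g q = r#}) = X"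
proof (rule multiset_eqI)
  fix q
  have "count (\<Sum>r<k. {#q \<in># X. g q = r#}) q = (\<Sum>r<k. if r = g q then count X q else 0)"
    unfolding count_sum by (intro sum.cong) auto
  also have "\<dots> = count X q"
    using assms[of q] by (cases "q \<in># X") (auto simp: not_in_iff)
  finally show "count (\<Sum>r<k. {#q \<in># X. g q = r#}) q = count X q" .
qed

lemma image_mset_sum_lessThan: "(\<Sum>r<k. image_mset f (F r)) = image_mset f (\<Sum>r<(k :: nat). F r)"
  by (induction k) auto

lemma sum_row_arcs:
  assumes "\<rho> \<in> PiE {..<length L} (\<lambda>_. {..<k})"
  shows "(\<Sum>r<k. row_arcs L \<rho> r) = mset L"
proof -
  have "(\<Sum>r<k. {#q \<in># mset [0..<length L]. \<rho> q = r#}) = mset [0..<length L]"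
    by (rule sum_filter_mset_fibres) (use assms in \<open>auto simp: PiE_iff\<close>)
  then have "(\<Sum>r<k. row_arcs L \<rho> r) = mset (map ((!) L) [0..<length L])"
    unfolding row_arcs_def image_mset_sum_lessThan by (simp only: mset_map)
  then show ?thesis by (simp only: map_nth)
qed

lemma row_arcs_fibre:
  assumes "\<And>q. q < length L \<Longrightarrow> \<rho> q = g (L ! q)"
  shows "row_arcs L \<rho> r = {#a \<in># mset L. g a = r#}"
proof -
  have "{#q \<in># mset [0..<length L]. \<rho> q = r#} = {#q \<in># mset [0..<length L]. g (L ! q) = r#}"
    by (rule filter_mset_cong) (auto simp: assms)
  then have "row_arcs L \<rho> r = {#a \<in># mset (map ((!) L) [0..<length L]). g a = r#}"
    unfolding row_arcs_def mset_map by (simp only: filter_mset_image_mset)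
  then show ?thesis by (simp only: map_nth)
qed

lemma layer_disjoint:
  assumes "1 \<le> l" "l < l'" "a \<in># layer M l" shows "a \<notin># layer M l'"
proof
  assume "a \<in># layer M l'"
  then have "a \<in># remainder M l'" using mset_subset_eqD[OF layer_subset_remainder] by blast
  moreover have "remainder M l' \<subseteq># remainder M (Suc l)"
    using assms(2)
  proof (induction l' rule: less_induct)
    case (less l')
    show ?case
    proof (cases "l' = Suc l")
      case False
      then obtain l'' where l'': "l' = Suc l''" "l < l''" using less.prems by (cases l') auto
      then have "remainder M l' \<subseteq># remainder M l''"
        using assms(1) by (simp add: remainder_Suc)
      then show ?thesis using less.IH[of l''] l'' by (auto intro: subset_mset.order_trans)
    qed simp
  qed
  ultimately have "a \<in># remainder M (Suc l)" by (rule mset_subset_eqD[rotated])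
  then show False using assms(1,3) by (auto simp: remainder_Suc_filter layer_eq first_layer_eq)
qed

lemma rows_realizing_layers:
  assumes "decomposes_into_weak_nestings k (mset L)"
  obtains \<rho> where "\<rho> \<in> PiE {..<length L} (\<lambda>_. {..<k})" "\<And>r. r < k \<Longrightarrow> row_arcs L \<rho> r = layer (mset L) (Suc r)"
proof -
  let ?M = "mset L"
  have M: "?M = (\<Sum>r<k. layer ?M (Suc r))"
    using decomposition_into_layers[OF assms] by (simp add: sum.atLeast1_atMost_eq)
  define g where "g a = (SOME r. r < k \<and> a \<in># layer ?M (Suc r))" for a
  have g_unique: "g a = r" if "a \<in># layer ?M (Suc r)" "r < k" for a r
  proof -
    have ga: "g a < k \<and> a \<in># layer ?M (Suc (g a))" unfolding g_def by (rule someI[of _ r]) (use that in simp)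
    show ?thesis
      using layer_disjoint[of "Suc r" "Suc (g a)" a] layer_disjoint[of "Suc (g a)" "Suc r" a] ga that
      by (cases r "g a" rule: linorder_cases) auto
  qed
  have ex: "g a < k" if "a \<in># ?M" for a
  proof -
    have "a \<in># (\<Sum>r<k. layer ?M (Suc r))" using that M by simp
    then obtain r where "r < k" "a \<in># layer ?M (Suc r)"
      by (subst (asm) set_mset_sum) auto
    then show ?thesis using g_unique by simp
  qed
  define \<rho> where "\<rho> = (\<lambda>q\<in>{..<length L}. g (L ! q))"
  have "\<rho> \<in> PiE {..<length L} (\<lambda>_. {..<k})" using ex by (auto simp: \<rho>_def)
  moreover have "row_arcs L \<rho> r = layer ?M (Suc r)" if r: "r < k" for r
  proof -
    have "row_arcs L \<rho> r = {#a \<in># ?M. g a = r#}" by (rule row_arcs_fibre) (simp add: \<rho>_def)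
    also have "\<dots> = (\<Sum>r'<k. {#a \<in># layer ?M (Suc r'). g a = r#})"
      by (subst M) (induction k; simp)
    also have "\<dots> = (\<Sum>r'<k. if r' = r then layer ?M (Suc r') else {#})"
    proof (intro sum.cong refl)
      fix r' assume "r' \<in> {..<k}"
      then have "{#a \<in># layer ?M (Suc r'). g a = r#} = {#a \<in># layer ?M (Suc r'). r' = r#}"
        using g_unique by (intro filter_mset_cong) auto
      then show "{#a \<in># layer ?M (Suc r'). g a = r#} = (if r' = r then layer ?M (Suc r') else {#})" by simp
    qed
    also have "\<dots> = layer ?M (Suc r)" using r by simp
    finally show ?thesis .
  qed
  ultimately show ?thesis using that by blast
qed

context orthonormal_space begin

lemma coord_det_leibniz_columns: "coord_det y = (\<Sum>p | p permutes {0..<k}. signof p * (\<Prod>r<k. b (e r) (y (p r))))"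
proof -
  let ?Y = "mat k k (\<lambda>(c, r). b (e r) (y c))"
  have "coord_det y = det (transpose_mat ?Y)" unfolding coord_det_def by (rule det_transpose[of _ k, symmetric]) simp
  then show ?thesis
    by (subst (asm) det_def'[of _ k]) (auto intro!: sum.cong prod.cong simp: permutes_in_image atLeast0LessThan)
qed

definition point :: "(nat \<times> nat \<Rightarrow> complex) \<Rightarrow> nat \<Rightarrow> 'v" where
  "point x i = (\<Sum>r<k. x (i, r) *s e r)"

lemma b_e_point: "r < k \<Longrightarrow> b (e r) (point x i) = x (i, r)"
proof -
  assume r: "r < k"
  have "b (e r) (point x i) = (\<Sum>q<k. if q = r then x (i, q) else 0)"
    unfolding point_def b_sum_right b_scale_right using r by (intro sum.cong) (auto simp: e_orthonormal)
  then show ?thesis using r by simp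
qed

text \<open>
  Expanding a term in coordinates means choosing a coordinate \<open>\<rho> q\<close> for every arc \<open>q\<close> and a permutation \<open>p\<close> for the
  determinant. The resulting monomial contains in coordinate \<open>r\<close> the variables of these vertices.
\<close>

definition row_content :: "(nat \<times> nat) list \<Rightarrow> nat list \<Rightarrow> (nat \<Rightarrow> nat) \<Rightarrow> (nat \<Rightarrow> nat) \<Rightarrow> nat \<Rightarrow> nat multiset" where
  "row_content L s \<rho> p r = endpoints (row_arcs L \<rho> r) + {#s ! p r#}"

definition row_choices :: "'a list \<Rightarrow> ((nat \<Rightarrow> nat) \<times> (nat \<Rightarrow> nat)) set" where
  "row_choices L = PiE {..<length L} (\<lambda>_. {..<k}) \<times> {p. p permutes {0..<k}}"

lemma finite_row_choices: "finite (row_choices L)"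
  unfolding row_choices_def by (intro finite_SigmaI finite_PiE finite_permutations) auto

lemma prod_endpoints: "(\<Prod>i\<in>#endpoints N. f i) = (\<Prod>(i, j)\<in>#N. f i * f j :: complex)"
  by (induction N) (auto simp: mult.assoc split: prod.splits)

lemma diagram_term_expansion:
  assumes "mset L = M"
  shows "diagram_term M s (point x) = (\<Sum>(\<rho>, p)\<in>row_choices L. signof p * (\<Prod>r<k. \<Prod>i\<in>#row_content L s \<rho> p r. x (i, r)))"
proof -
  let ?R = "PiE {..<length L} (\<lambda>_. {..<k})"
  have bx: "b (point x i) (point x j) = (\<Sum>r<k. x (i, r) * x (j, r))" for i j
    unfolding b_eq_sum[of "point x i"] by (intro sum.cong) (auto simp: b_e_point)
  have prod_L: "(\<Prod>a\<in>#mset L. f a) = (\<Prod>q<length L. f (L ! q))" for f :: "nat \<times> nat \<Rightarrow> complex"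
  proof -
    have "prod_list (map g [0..<m]) = (\<Prod>t<m. g t)" for g :: "nat \<Rightarrow> complex" and m
      by (induction m) auto
    from this[of "\<lambda>q. f (L ! q)" "length L"] show ?thesis
      by (metis (no_types, lifting) map_map map_nth mset_map prod_mset_prod_list comp_apply list.map_cong)
  qed
  have "(\<Prod>(i, j)\<in>#M. b (point x i) (point x j))
      = (\<Prod>q<length L. \<Sum>r<k. x (fst (L ! q), r) * x (snd (L ! q), r))"
    unfolding assms[symmetric] prod_L by (simp add: bx case_prod_beta)
  also have "\<dots> = (\<Sum>\<rho>\<in>?R. \<Prod>q<length L. x (fst (L ! q), \<rho> q) * x (snd (L ! q), \<rho> q))"
    by (rule prod_sum_PiE) simp
  also have "\<dots> = (\<Sum>\<rho>\<in>?R. \<Prod>r<k. \<Prod>i\<in>#endpoints (row_arcs L \<rho> r). x (i, r))"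
  proof (intro sum.cong refl)
    fix \<rho> assume \<rho>: "\<rho> \<in> ?R"
    have "(\<Prod>q<length L. x (fst (L ! q), \<rho> q) * x (snd (L ! q), \<rho> q))
      = (\<Prod>r<k. \<Prod>q\<in>{q \<in> {..<length L}. \<rho> q = r}. x (fst (L ! q), \<rho> q) * x (snd (L ! q), \<rho> q))"
      using \<rho> by (intro prod.group[symmetric]) (auto simp: PiE_iff)
    also have "\<dots> = (\<Prod>r<k. \<Prod>i\<in>#endpoints (row_arcs L \<rho> r). x (i, r))"
    proof (intro prod.cong refl)
      fix r
      have "{#q \<in># mset [0..<length L]. \<rho> q = r#} = mset_set {q \<in> {..<length L}. \<rho> q = r}"
        by (simp add: filter_mset_mset_set atLeast0LessThan)
      then show "(\<Prod>q\<in>{q \<in> {..<length L}. \<rho> q = r}. x (fst (L ! q), \<rho> q) * x (snd (L ! q), \<rho> q))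
        = (\<Prod>i\<in>#endpoints (row_arcs L \<rho> r). x (i, r))"
        unfolding prod_endpoints row_arcs_def
        by (simp add: image_mset.compositionality o_def case_prod_beta prod_unfold_prod_mset[symmetric])
    qed
    finally show "(\<Prod>q<length L. x (fst (L ! q), \<rho> q) * x (snd (L ! q), \<rho> q))
      = (\<Prod>r<k. \<Prod>i\<in>#endpoints (row_arcs L \<rho> r). x (i, r))" .
  qed
  finally have arcs: "(\<Prod>(i, j)\<in>#M. b (point x i) (point x j))
      = (\<Sum>\<rho>\<in>?R. \<Prod>r<k. \<Prod>i\<in>#endpoints (row_arcs L \<rho> r). x (i, r))" .
  have det: "coord_det (\<lambda>c. point x (s ! c)) = (\<Sum>p | p permutes {0..<k}. signof p * (\<Prod>r<k. x (s ! p r, r)))"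
    unfolding coord_det_leibniz_columns by (intro sum.cong refl arg_cong2[of _ _ _ _ times] prod.cong) (auto simp: b_e_point)
  show ?thesis
    unfolding diagram_term_def arcs det row_choices_def sum_product sum.cartesian_product
    by (intro sum.cong refl) (auto simp: row_content_def prod.distrib mult_ac)
qed

text \<open>
  Among the diagrams with nonzero coefficient choose one of largest weight \<open>W\<close> and look at the monomial whose row
  \<open>r\<close> consists of layer \<open>r + 1\<close> and the corresponding painted vertex. If another diagram or permutation produced this monomial, its
  rows would have the same endpoints but a different pairing, hence larger total weight, against the choice of
  the diagram. So only expansions of the chosen diagram contribute, with the identity permutation and therefore
  without cancellation.
\<close>

theorem painted_terms_independent:
  assumes A: "finite A" "A \<subseteq> painted_diagrams k n d"
    and zero: "\<And>w. (\<Sum>a\<in>A. c a * diagram_term (fst a) (sorted_list_of_set (snd a)) w) = 0"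
    and a: "a \<in> A"
  shows "c a = 0"
proof (rule ccontr)
  assume "c a \<noteq> 0"
  define A' where "A' = {a \<in> A. c a \<noteq> 0}"
  define W where "W a = arc_weight (fst a) + Suc n * sum_list (sorted_list_of_set (snd a))" for a
  have A': "finite A'" "A' \<noteq> {}" using A(1) a \<open>c a \<noteq> 0\<close> unfolding A'_def by (simp, blast)
  then have "Max (W ` A') \<in> W ` A'" by (intro Max_in) auto
  then obtain a0 where a0: "a0 \<in> A'" "W a0 = Max (W ` A')" by auto
  have max: "W a \<le> W a0" if "a \<in> A'" for a unfolding a0(2) using A'(1) that by (intro Max_ge) auto
  define L where "L M = (SOME L. mset L = (M :: (nat \<times> nat) multiset))" for M
  have L: "mset (L M) = M" for M unfolding L_def using ex_mset by (rule someI_ex)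
  define srt where "srt a = sorted_list_of_set (snd a :: nat set)" for a :: "(nat \<times> nat) multiset \<times> nat set"
  define LL where "LL a = L (fst a)" for a :: "(nat \<times> nat) multiset \<times> nat set"
  have LL: "mset (LL a) = fst a" for a by (simp add: LL_def L)
  define Q where "Q = Sigma A' (\<lambda>a. row_choices (LL a))"
  have finQ: "finite Q" unfolding Q_def using A'(1) finite_row_choices by (intro finite_SigmaI) auto
  define ct where "ct q r = row_content (LL (fst q)) (srt (fst q)) (fst (snd q)) (snd (snd q)) r"
    for q :: "((nat \<times> nat) multiset \<times> nat set) \<times> (nat \<Rightarrow> nat) \<times> (nat \<Rightarrow> nat)" and r
  have painted: "arc_diagram n (fst a)" "decomposes_into_weak_nestings k (fst a)" "snd a \<subseteq> {1..n}" "card (snd a) = k"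
    "painting_rule k (fst a) (snd a)" if "a \<in> A'" for a
  proof -
    have "a \<in> painted_diagrams k n d" using that A(2) by (auto simp only: A'_def)
    then have "arc_diagram n (fst a) \<and> decomposes_into_weak_nestings k (fst a) \<and> snd a \<subseteq> {1..n} \<and> card (snd a) = k
      \<and> painting_rule k (fst a) (snd a)" by (simp add: painted_diagrams_def case_prod_beta)
    then show "arc_diagram n (fst a)" "decomposes_into_weak_nestings k (fst a)" "snd a \<subseteq> {1..n}" "card (snd a) = k"
      "painting_rule k (fst a) (snd a)" by blast+
  qed
  have srt: "set (srt a) = snd a" "length (srt a) = k" if "a \<in> A'" for a
    using painted(3,4)[OF that] finite_subset[OF painted(3)[OF that]] by (auto simp: srt_def)
  have row_sub: "a' \<in># fst a" if "a' \<in># row_arcs (LL a) \<rho> r" for a' a \<rho> r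
  proof -
    have "a' \<in> set (LL a)" using that by (auto simp: row_arcs_def)
    then show ?thesis by (metis LL set_mset_mset)
  qed
  have arc: "1 \<le> fst a' \<and> fst a' \<le> snd a' \<and> snd a' \<le> n" if "a \<in> A'" "a' \<in># fst a" for a a'
    using painted(1)[OF that(1)] that(2) by (auto simp: arc_diagram_def)
  have srt_range: "srt a ! p r \<in> {1..n}" if "a \<in> A'" "r < k" "p permutes {0..<k}" for a p r
  proof -
    have "p r < k" using permutes_in_image[OF that(3), of r] that(2) by simp
    then have "srt a ! p r \<in> snd a" using srt[OF that(1)] nth_mem[of "p r" "srt a"] by simp
    then show ?thesis using painted(3)[OF that(1)] by blast
  qed
  have ct_range: "set_mset (ct q r) \<subseteq> {1..n}" if "q \<in> Q" "r < k" for q r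
  proof
    fix v assume v: "v \<in># ct q r"
    obtain a \<rho> p where q: "q = (a, \<rho>, p)" "a \<in> A'" "p permutes {0..<k}" using \<open>q \<in> Q\<close> by (auto simp: Q_def row_choices_def)
    from v consider "v = srt a ! p r" | a' where "a' \<in># row_arcs (LL a) \<rho> r" "v = fst a' \<or> v = snd a'"
      by (auto simp: ct_def q(1) row_content_def set_endpoints)
    then show "v \<in> {1..n}"
    proof cases
      case 1
      then show ?thesis using srt_range[OF q(2) that(2) q(3)] by simp
    next
      case 2
      then show ?thesis using arc[OF q(2) row_sub[OF 2(1)]] by auto
    qed
  qed
  have expand: "(\<Sum>q\<in>Q. (c (fst q) * signof (snd (snd q))) * (\<Prod>v\<in>{1..n} \<times> {..<k}. x v ^ count (ct q (snd v)) (fst v))) = 0" for x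
  proof -
    have "(\<Sum>q\<in>Q. (c (fst q) * signof (snd (snd q))) * (\<Prod>v\<in>{1..n} \<times> {..<k}. x v ^ count (ct q (snd v)) (fst v)))
      = (\<Sum>q\<in>Q. c (fst q) * (signof (snd (snd q)) * (\<Prod>r<k. \<Prod>i\<in>#ct q r. x (i, r))))"
    proof (intro sum.cong refl)
      fix q assume q: "q \<in> Q"
      have "(\<Prod>v\<in>{1..n} \<times> {..<k}. x v ^ count (ct q (snd v)) (fst v))
        = (\<Prod>r<k. \<Prod>i\<in>{1..n}. x (i, r) ^ count (ct q r) i)"
        by (subst prod.swap) (simp add: prod.cartesian_product case_prod_beta)
      also have "\<dots> = (\<Prod>r<k. \<Prod>i\<in>#ct q r. x (i, r))"
        by (intro prod.cong refl prod_mset_image_count[symmetric]) (use ct_range[OF q] in auto)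
      finally show "(c (fst q) * signof (snd (snd q))) * (\<Prod>v\<in>{1..n} \<times> {..<k}. x v ^ count (ct q (snd v)) (fst v))
        = c (fst q) * (signof (snd (snd q)) * (\<Prod>r<k. \<Prod>i\<in>#ct q r. x (i, r)))" by (simp add: mult.assoc)
    qed
    also have "\<dots> = (\<Sum>a\<in>A'. \<Sum>y\<in>row_choices (LL a). c a * (signof (snd y) * (\<Prod>r<k. \<Prod>i\<in>#ct (a, y) r. x (i, r))))"
      unfolding Q_def by (subst sum.Sigma) (use A'(1) finite_row_choices in \<open>auto simp: case_prod_beta\<close>)
    also have "\<dots> = (\<Sum>a\<in>A'. c a * diagram_term (fst a) (srt a) (point x))"
      unfolding diagram_term_expansion[OF LL] sum_distrib_left by (intro sum.cong refl) (auto simp: ct_def case_prod_beta)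
    also have "\<dots> = (\<Sum>a\<in>A. c a * diagram_term (fst a) (srt a) (point x))"
      using A(1) by (intro sum.mono_neutral_left) (auto simp: A'_def)
    finally show ?thesis using zero[of "point x"] by (simp add: srt_def)
  qed
  obtain \<rho>0 where \<rho>0: "\<rho>0 \<in> PiE {..<length (LL a0)} (\<lambda>_. {..<k})" "\<And>r. r < k \<Longrightarrow> row_arcs (LL a0) \<rho>0 r = layer (fst a0) (Suc r)"
    using rows_realizing_layers[of k "LL a0"] painted(2)[OF a0(1)] unfolding LL by blast
  define q0 where "q0 = (a0, \<rho>0, id :: nat \<Rightarrow> nat)"
  have q0: "q0 \<in> Q" using a0(1) \<rho>0(1) by (auto simp: q0_def Q_def row_choices_def permutes_id)
  define Z where "Z = {q \<in> Q. \<forall>v\<in>{1..n} \<times> {..<k}. count (ct q (snd v)) (fst v) = count (ct q0 (snd v)) (fst v)}"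
  have sum0: "(\<Sum>q\<in>Z. c (fst q) * signof (snd (snd q))) = 0"
    unfolding Z_def using monomials_independent[OF _ finQ expand, where \<gamma> = "\<lambda>v. count (ct q0 (snd v)) (fst v)"] by simp
  (* The painted vertex of a row enters as an arc that ends at n + 1, beyond all vertices. *)
  define N where "N q r = row_arcs (LL (fst q)) (fst (snd q)) r + {#(srt (fst q) ! snd (snd q) r, Suc n)#}"
    for q :: "((nat \<times> nat) multiset \<times> nat set) \<times> (nat \<Rightarrow> nat) \<times> (nat \<Rightarrow> nat)" and r
  have weight: "(\<Sum>r<k. arc_weight (N q r)) = W (fst q)" if "q \<in> Q" for q
  proof -
    obtain a \<rho> p where q: "q = (a, \<rho>, p)" "a \<in> A'" "\<rho> \<in> PiE {..<length (LL a)} (\<lambda>_. {..<k})" "p permutes {0..<k}"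
      using \<open>q \<in> Q\<close> by (auto simp: Q_def row_choices_def)
    have "(\<Sum>r<k. arc_weight (row_arcs (LL a) \<rho> r)) = arc_weight (\<Sum>r<k. row_arcs (LL a) \<rho> r)"
      by (induction k) auto
    also have "\<dots> = arc_weight (fst a)" by (simp only: sum_row_arcs[OF q(3)] LL)
    finally have arcs: "(\<Sum>r<k. arc_weight (row_arcs (LL a) \<rho> r)) = arc_weight (fst a)" .
    have "(\<Sum>r<k. srt a ! p r) = (\<Sum>r<k. srt a ! r)"
      using sum.permute[OF q(4), of "\<lambda>r. srt a ! r"] by (simp add: o_def atLeast0LessThan)
    also have "\<dots> = sum_list (srt a)" using srt(2)[OF q(2)] by (simp add: sum_list_sum_nth atLeast0LessThan)
    finally have total: "(\<Sum>r<k. srt a ! p r) = sum_list (srt a)" .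
    have "(\<Sum>r<k. arc_weight (N q r)) = (\<Sum>r<k. arc_weight (row_arcs (LL a) \<rho> r)) + (\<Sum>r<k. srt a ! p r * Suc n)"
      by (simp add: N_def q(1) sum.distrib del: mult_Suc_right)
    also have "\<dots> = W a"
      unfolding arcs sum_distrib_right[symmetric] total W_def srt_def[symmetric] by (simp only: mult.commute)
    finally show ?thesis by (simp add: q(1))
  qed
  have endp: "endpoints (N q r) = ct q r + {#Suc n#}" for q r
    by (simp add: N_def ct_def row_content_def)
  have ordered: "fst a' \<le> snd a'" if "q \<in> Q" "r < k" "a' \<in># N q r" for q r a'
  proof -
    obtain a \<rho> p where q: "q = (a, \<rho>, p)" "a \<in> A'" "p permutes {0..<k}" using \<open>q \<in> Q\<close> by (auto simp: Q_def row_choices_def)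
    show ?thesis
      using that(3) arc[OF q(2) row_sub] srt_range[OF q(2) that(2) q(3)] by (auto simp: N_def q(1))
  qed
  have nest0: "weak_nesting (N q0 r)" if r: "r < k" for r
  proof -
    have lay: "N q0 r = layer (fst a0) (Suc r) + {#(srt a0 ! r, Suc n)#}" by (simp add: N_def q0_def \<rho>0(2)[OF r])
    have "weak_nesting (layer (fst a0) (Suc r))" using arc[OF a0(1)] by (intro layer_nesting) blast
    moreover have "weakly_nested (srt a0 ! r, Suc n) a' \<and> weakly_nested a' (srt a0 ! r, Suc n)"
      if "a' \<in># layer (fst a0) (Suc r)" for a'
    proof -
      have "a' \<in># fst a0" using that layer_subset_remainder remainder_subset by (meson mset_subset_eqD)
      from arc[OF a0(1) this] have "fst a' \<le> snd a'" "snd a' \<le> n" by auto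
      moreover have "srt a0 ! r \<le> fst a'"
        using painted(5)[OF a0(1)] that r unfolding painting_rule_def srt_def
        by (cases a') (auto dest!: bspec[of _ _ "Suc r"])
      ultimately show ?thesis by (cases a') auto
    qed
    moreover have "srt a0 ! r \<le> Suc n" using srt_range[OF a0(1) r permutes_id] by simp
    ultimately show ?thesis unfolding lay weak_nesting_def by auto
  qed
  have Z_eq: "fst q = a0 \<and> snd (snd q) = id" if q: "q \<in> Z" for q
  proof -
    have qQ: "q \<in> Q" using q by (simp add: Z_def)
    obtain a \<rho> p where q': "q = (a, \<rho>, p)" "a \<in> A'" "\<rho> \<in> PiE {..<length (LL a)} (\<lambda>_. {..<k})" "p permutes {0..<k}"
      using qQ by (auto simp: Q_def row_choices_def)
    have "ct q r = ct q0 r" if r: "r < k" for r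
    proof (rule multiset_eqI)
      fix i show "count (ct q r) i = count (ct q0 r) i"
      proof (cases "i \<in> {1..n}")
        case True
        then show ?thesis using q r by (auto simp: Z_def)
      next
        case False
        then show ?thesis using ct_range[OF qQ r] ct_range[OF q0 r] by (metis not_in_iff subsetD)
      qed
    qed
    then have min: "arc_weight (N q0 r) < arc_weight (N q r) \<or> N q r = N q0 r" if "r < k" for r
      using nest0[OF that] ordered[OF q0 that] ordered[OF qQ that] endp that
      by (intro nesting_minimizes_arc_weight) auto
    have rows: "N q r = N q0 r" if r: "r < k" for r
    proof (rule ccontr)
      assume "N q r \<noteq> N q0 r"
      then have strict: "arc_weight (N q0 r) < arc_weight (N q r)" using min[OF r] by blast
      have "(\<Sum>r<k. arc_weight (N q0 r)) < (\<Sum>r<k. arc_weight (N q r))"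
      proof (rule sum_strict_mono_ex1)
        show "\<forall>r\<in>{..<k}. arc_weight (N q0 r) \<le> arc_weight (N q r)" using min by fastforce
        show "\<exists>r\<in>{..<k}. arc_weight (N q0 r) < arc_weight (N q r)" using strict r by blast
      qed simp
      then show False using weight[OF qQ] weight[OF q0] max[OF q'(2)] by (simp add: q'(1) q0_def)
    qed
    have split: "row_arcs (LL a) \<rho> r = row_arcs (LL a0) \<rho>0 r \<and> srt a ! p r = srt a0 ! r" if r: "r < k" for r
    proof -
      have filter: "{#x \<in># N q r. snd x = Suc n#} = {#(srt (fst q) ! snd (snd q) r, Suc n)#}" if "q \<in> Q" for q
      proof -
        obtain a \<rho> p where q: "q = (a, \<rho>, p)" "a \<in> A'" using \<open>q \<in> Q\<close> by (auto simp: Q_def row_choices_def)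
        have "snd x \<noteq> Suc n" if "x \<in># row_arcs (LL a) \<rho> r" for x
          using arc[OF q(2) row_sub[OF that]] by simp
        then have "{#x \<in># row_arcs (LL a) \<rho> r. snd x = Suc n#} = {#x \<in># row_arcs (LL a) \<rho> r. False#}"
          by (intro filter_mset_cong) simp_all
        then show ?thesis by (simp add: N_def q(1))
      qed
      have "srt a ! p r = srt a0 ! r"
        using filter[OF qQ] filter[OF q0] rows[OF r] by (simp add: q'(1) q0_def)
      then show ?thesis using rows[OF r] by (simp add: N_def q'(1) q0_def)
    qed
    have "fst a = (\<Sum>r<k. row_arcs (LL a) \<rho> r)" by (simp only: sum_row_arcs[OF q'(3)] LL)
    also have "\<dots> = (\<Sum>r<k. row_arcs (LL a0) \<rho>0 r)" using split by (intro sum.cong) auto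
    also have "\<dots> = fst a0" by (simp only: sum_row_arcs[OF \<rho>0(1)] LL)
    finally have M: "fst a = fst a0" .
    have "snd a0 \<subseteq> snd a"
    proof
      fix v assume "v \<in> snd a0"
      then obtain r where r: "r < k" "v = srt a0 ! r" using srt[OF a0(1)] by (metis in_set_conv_nth)
      have "p r < k" using permutes_in_image[OF q'(4), of r] r(1) by simp
      then show "v \<in> snd a" using split[OF r(1)] r(2) srt[OF q'(2)] by (metis nth_mem)
    qed
    then have S: "snd a0 = snd a"
      using painted(3,4)[OF a0(1)] painted(3,4)[OF q'(2)] by (intro card_subset_eq) (auto intro: finite_subset)
    then have "srt a = srt a0" by (simp add: srt_def)
    moreover have "distinct (srt a0)" by (simp add: srt_def)
    ultimately have "p r = r" if "r < k" for r
      using split[OF that] permutes_in_image[OF q'(4), of r] that srt(2)[OF a0(1)] by (simp add: nth_eq_iff_index_eq)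
    then have "p = id" using permutes_not_in[OF q'(4)] by (auto simp: fun_eq_iff)
    then show ?thesis using M S by (simp add: q'(1) prod_eq_iff)
  qed
  have "(\<Sum>q\<in>Z. c (fst q) * signof (snd (snd q))) = (\<Sum>q\<in>Z. c a0)"
    using Z_eq by (intro sum.cong) auto
  also have "\<dots> = of_nat (card Z) * c a0" by simp
  finally have "of_nat (card Z) * c a0 = 0" using sum0 by simp
  moreover have "card Z > 0"
  proof -
    have "q0 \<in> Z" "finite Z" using q0 finQ by (auto simp: Z_def)
    then show ?thesis by (auto simp: card_gt_0_iff)
  qed
  ultimately show False using a0(1) by (simp add: A'_def)
qed

end

section \<open>The basis theorem and the splitting of special orthogonal invariants\<close>

lemma basis_family_criterion:
  assumes indep: "\<And>A c a. finite A \<Longrightarrow> A \<subseteq> I \<Longrightarrow> (\<Sum>a\<in>A. fscale (c a) (F a)) = 0 \<Longrightarrow> a \<in> A \<Longrightarrow> c a = 0"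
    and span: "fun_space.span (F ` I) = W"
  shows "basis_family I F W"
proof -
  have inj: "inj_on F I"
  proof (rule inj_onI, rule ccontr)
    fix a b assume ab: "a \<in> I" "b \<in> I" "F a = F b" "a \<noteq> b"
    define c :: "'a \<Rightarrow> complex" where "c x = (if x = a then 1 else -1)" for x
    have "(\<Sum>x\<in>{a, b}. fscale (c x) (F x)) = 0"
      using ab(3,4) by (simp add: c_def fscale_def fun_eq_iff)
    then have "c a = 0" using ab(1,2) by (intro indep[of "{a, b}"]) auto
    then show False by (simp add: c_def)
  qed
  have "fun_space.independent (F ` I)"
    unfolding fun_space.independent_explicit_finite_subsets
  proof (intro allI impI ballI)
    fix S u v assume S: "S \<subseteq> F ` I" "finite S" "(\<Sum>v\<in>S. fscale (u v) v) = 0" "v \<in> S"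
    obtain A where A: "A \<subseteq> I" "finite A" "S = F ` A" using finite_subset_image[OF S(2,1)] by blast
    have "(\<Sum>a\<in>A. fscale (u (F a)) (F a)) = 0"
      using S(3) unfolding A(3) by (subst (asm) sum.reindex) (use inj A(1) in \<open>auto intro: inj_on_subset simp: o_def\<close>)
    then show "u v = 0" using indep[OF A(2,1), of "\<lambda>a. u (F a)"] S(4) A(3) by auto
  qed
  then show ?thesis using inj span by (simp add: basis_family_def)
qed

text \<open>
  For fixed \<open>w\<close> both sides of the scaling law are polynomials in \<open>c\<close>, and the coefficient of \<open>c\<^sup>d\<close> selects the
  terms of degree \<open>d\<close>.
\<close>

lemma homogeneous_part_in_span:
  assumes "f \<in> fun_space.span T" "\<And>t. t \<in> T \<Longrightarrow> \<exists>d. \<forall>c w. t (\<sigma> c w) = c ^ d * t w"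
    and f: "\<And>c w. f (\<sigma> c w) = c ^ d * f w"
  shows "f \<in> fun_space.span {t \<in> T. \<forall>c w. t (\<sigma> c w) = c ^ d * t w}"
proof -
  obtain A u where A: "finite A" "A \<subseteq> T" "f = (\<Sum>t\<in>A. fscale (u t) t)"
    using assms(1) unfolding fun_space.span_explicit by blast
  have "\<exists>deg. \<forall>t\<in>T. \<forall>c w. t (\<sigma> c w) = c ^ deg t * t w" using assms(2) by metis
  then obtain deg where deg: "\<And>t c w. t \<in> T \<Longrightarrow> t (\<sigma> c w) = c ^ deg t * t w" by blast
  have "f w = (\<Sum>t | t \<in> A \<and> deg t = d. fscale (u t) t) w" for w
  proof -
    define P where "P = (\<Sum>t\<in>A. monom (u t * t w) (deg t)) - monom (f w) d"
    have "poly P c = 0" for c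
    proof -
      have "(\<Sum>t\<in>A. u t * t w * c ^ deg t) = f (\<sigma> c w)"
        unfolding A(3) sum_fun_apply fscale_def using A(2) by (intro sum.cong refl) (auto simp: deg)
      then show ?thesis by (simp add: P_def poly_sum poly_monom f)
    qed
    then have "P = 0" using poly_all_0_iff_0 by blast
    then have "coeff P d = 0" by simp
    then have coeff: "(\<Sum>t\<in>A. if deg t = d then u t * t w else 0) = f w" by (simp add: P_def coeff_sum)
    have "(\<Sum>t | t \<in> A \<and> deg t = d. fscale (u t) t) w = (\<Sum>t | t \<in> A \<and> deg t = d. u t * t w)"
      by (simp only: sum_fun_apply fscale_def)
    also have "\<dots> = f w" unfolding coeff[symmetric] by (rule sum.inter_filter[OF A(1)])
    finally show ?thesis by (rule sym)
  qed
  then have "f = (\<Sum>t | t \<in> A \<and> deg t = d. fscale (u t) t)" by (rule ext)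
  also have "\<dots> \<in> fun_space.span {t \<in> T. \<forall>c w. t (\<sigma> c w) = c ^ d * t w}"
    using A(2) deg by (intro fun_space.span_sum fun_space.span_scale fun_space.span_base) auto
  finally show ?thesis .
qed

lemma polynomial_sum:
  assumes "\<And>i. i \<in> A \<Longrightarrow> f i \<in> polynomial_functions scale n"
  shows "(\<lambda>w. \<Sum>i\<in>A. f i w) \<in> polynomial_functions scale n"
  using assms by (induction A rule: infinite_finite_induct) (auto intro: polynomial_functions.intros)

lemma polynomial_prod:
  assumes "\<And>i. i \<in> A \<Longrightarrow> f i \<in> polynomial_functions scale n"
  shows "(\<lambda>w. \<Prod>i\<in>A. f i w) \<in> polynomial_functions scale n"
  using assms by (induction A rule: infinite_finite_induct) (auto intro: polynomial_functions.intros)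

lemma polynomial_scale:
  "f \<in> polynomial_functions scale n \<Longrightarrow> (\<lambda>w. c * f w) \<in> polynomial_functions scale n"
  by (intro polynomial_functions.mult polynomial_functions.const)

lemma polynomial_compose_linear:
  assumes "f \<in> polynomial_functions scale n" "Vector_Spaces.linear scale scale h"
  shows "(\<lambda>w. f (\<lambda>i. h (w i))) \<in> polynomial_functions scale n"
  using assms(1)
proof induction
  case (linear \<phi> i)
  have "Vector_Spaces.linear scale (*) (\<lambda>v. \<phi> (h v))"
    using linear(1) assms(2) by (simp add: Vector_Spaces.linear_iff)
  then show ?case using linear(2) by (rule polynomial_functions.linear)
qed (auto intro: polynomial_functions.intros)

context orthonormal_space begin

lemma diagram_term_homogeneous:
  assumes "length s = k"
  shows "diagram_term M s (\<lambda>i. c *s w i) = c ^ (2 * size M + k) * diagram_term M s w"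
proof -
  have "(\<Prod>(i, j)\<in>#M. b (c *s w i) (c *s w j)) = c ^ (2 * size M) * (\<Prod>(i, j)\<in>#M. b (w i) (w j))"
    by (induction M) (auto simp: b_scale_left b_scale_right power2_eq_square)
  moreover have "coord_det (\<lambda>r. c *s w (s ! r)) = c ^ k * coord_det (\<lambda>r. w (s ! r))"
    unfolding coord_det_leibniz sum_distrib_left by (intro sum.cong refl) (simp add: b_scale_right prod.distrib)
  ultimately show ?thesis by (simp add: diagram_term_def power_add)
qed

lemma diagram_term_polynomial:
  assumes "valid_term n M s"
  shows "diagram_term M s \<in> polynomial_functions scale n"
proof -
  have coord: "(\<lambda>w. b (e r) (w i)) \<in> polynomial_functions scale n" if "i \<in> {1..n}" for r i
    using form that by (intro polynomial_functions.linear) (simp_all add: symmetric_bilinear_form_def)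
  have "set_mset M \<subseteq> {1..n} \<times> {1..n}" using assms by (simp add: valid_term_def)
  then have "(\<lambda>w. \<Prod>(i, j)\<in>#M. b (w i) (w j)) \<in> polynomial_functions scale n"
  proof (induction M)
    case empty
    show ?case using polynomial_functions.const[of 1] by simp
  next
    case (add a M)
    obtain i j where a: "a = (i, j)" by fastforce
    have "(\<lambda>w. \<Sum>r<k. b (e r) (w i) * b (e r) (w j)) \<in> polynomial_functions scale n"
      using add.prems by (intro polynomial_sum polynomial_functions.mult coord) (auto simp: a)
    then have "(\<lambda>w. b (w i) (w j)) \<in> polynomial_functions scale n" by (simp only: b_eq_sum[symmetric])
    then show ?case using add by (simp add: a) (intro polynomial_functions.mult)
  qed
  moreover have "(\<lambda>w. coord_det (\<lambda>c. w (s ! c))) \<in> polynomial_functions scale n"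
  proof -
    have "s ! c \<in> {1..n}" if "c < k" for c
      using assms that nth_mem[of c s] unfolding valid_term_def by blast
    then show ?thesis
      unfolding coord_det_leibniz by (intro polynomial_sum polynomial_scale polynomial_prod coord) simp
  qed
  ultimately show ?thesis unfolding diagram_term_def[abs_def] by (rule polynomial_functions.mult)
qed

lemma diagram_term_semiinvariant:
  assumes "h \<in> orthogonal_group scale b"
  shows "diagram_term M s (\<lambda>i. h (w i)) = map_det h * diagram_term M s w"
  using assms coord_det_map[of h "\<lambda>c. w (s ! c)"] by (simp add: diagram_term_def orthogonal_group_def mult_ac)

lemma reflection_orthogonal: "b a a \<noteq> 0 \<Longrightarrow> reflection a \<in> orthogonal_group scale b"
  using reflection_linear reflection_isometry reflection_involution
  by (auto simp: orthogonal_group_def intro!: o_bij[of "reflection a"])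

context
  fixes es :: "'v list"
  assumes es: "ordered_basis scale es" "length es = k"
begin

lemma det_vectors_self: "det_vectors scale es es = 1"
proof -
  have "mat k k (\<lambda>(r, c). representation (set es) (es ! c) (es ! r)) = 1\<^sub>m k"
    using es by (intro eq_matI) (auto simp: ordered_basis_def representation_basis nth_eq_iff_index_eq)
  then show ?thesis by (simp add: det_vectors_def es(2))
qed

lemma det_vectors_eq: "\<exists>P. P \<noteq> 0 \<and> (\<forall>vs. length vs = k \<longrightarrow> det_vectors scale es vs = P * coord_det ((!) vs))"
proof -
  have B: "independent (set es)" "span (set es) = UNIV" using es(1) by (auto simp: ordered_basis_def)
  let ?A = "mat k k (\<lambda>(r, q). representation (set es) (e q) (es ! r))"
  have eq: "det_vectors scale es vs = det ?A * coord_det ((!) vs)" for vs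
  proof -
    let ?Y = "mat k k (\<lambda>(c, r). b (e r) (vs ! c))"
    have rep: "representation (set es) v x = (\<Sum>q<k. b (e q) v * representation (set es) (e q) x)" for v x
      by (rule additive_homogeneous_expand[where \<phi> = "\<lambda>v. representation (set es) v x"])
        (simp_all add: B representation_add representation_scale)
    have "mat k k (\<lambda>(r, c). representation (set es) (vs ! c) (es ! r)) = ?A * transpose_mat ?Y"
      by (rule eq_matI) (auto simp: scalar_prod_def atLeast0LessThan rep[of "vs ! _"] mult.commute)
    then have "det_vectors scale es vs = det (?A * transpose_mat ?Y)" by (simp add: det_vectors_def es(2))
    also have "\<dots> = det ?A * det ?Y"
      by (subst det_mult[of _ k]) (auto simp: det_transpose[of ?Y k])
    finally show ?thesis by (simp add: coord_det_def)
  qed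
  have "det ?A \<noteq> 0" using eq[of es] det_vectors_self by auto
  then show ?thesis using eq by blast
qed

lemma det_endo_eq:
  assumes "Vector_Spaces.linear scale scale h" shows "det_endo scale es h = map_det h"
proof -
  obtain P where P: "P \<noteq> 0" "\<And>vs. length vs = k \<Longrightarrow> det_vectors scale es vs = P * coord_det ((!) vs)"
    using det_vectors_eq by blast
  have one: "P * coord_det ((!) es) = 1" using P(2)[OF es(2)] det_vectors_self by simp
  have "det_endo scale es h = P * coord_det (\<lambda>c. h (es ! c))"
    unfolding det_endo_def using P(2)[of "map h es"] es(2) by (simp add: coord_det_cong[of "(!) (map h es)" "\<lambda>c. h (es ! c)"])
  also have "\<dots> = map_det h * (P * coord_det ((!) es))" by (simp add: coord_det_map[OF assms])
  finally show ?thesis by (simp add: one)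
qed

lemma orthogonal_det: "h \<in> orthogonal_group scale b \<Longrightarrow> det_endo scale es h = map_det h"
  by (simp add: orthogonal_group_def det_endo_eq)

lemma subspace_det_semiinvariants: "fun_space.subspace (det_semiinvariants scale es n G)"
  by (intro fun_space.subspaceI)
    (auto simp: det_semiinvariants_def zero_fun_def plus_fun_def fscale_def algebra_simps
      intro: polynomial_functions.intros polynomial_scale)

lemma subspace_invariants: "fun_space.subspace (invariants scale n G)"
  by (intro fun_space.subspaceI)
    (auto simp: invariants_def zero_fun_def plus_fun_def fscale_def
      intro: polynomial_functions.intros polynomial_scale)

lemma subspace_homogeneous:
  assumes A: "fun_space.subspace A"
  shows "fun_space.subspace (homogeneous_component scale d A)"
proof (rule fun_space.subspaceI)
  show "0 \<in> homogeneous_component scale d A"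
    using fun_space.subspace_0[OF A] by (simp add: homogeneous_component_def)
  fix f g assume fg: "f \<in> homogeneous_component scale d A" "g \<in> homogeneous_component scale d A"
  then show "f + g \<in> homogeneous_component scale d A"
    using fun_space.subspace_add[OF A, of f g] by (simp add: homogeneous_component_def distrib_left)
next
  fix c f assume "f \<in> homogeneous_component scale d A"
  then show "fscale c f \<in> homogeneous_component scale d A"
    using fun_space.subspace_scale[OF A, of f c] by (simp add: homogeneous_component_def) (simp add: fscale_def)
qed

theorem homogeneous_det_semiinvariants_span:
  "homogeneous_component scale d (det_semiinvariants scale es n (orthogonal_group scale b))
    = fun_space.span ((\<lambda>(M, S). diagram_term M (sorted_list_of_set S)) ` painted_diagrams k n d)"
    (is "?H = fun_space.span ?B")
proof
  have "?B \<subseteq> ?H"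
  proof
    fix t assume "t \<in> ?B"
    then obtain M S where MS: "(M, S) \<in> painted_diagrams k n d" "t = diagram_term M (sorted_list_of_set S)" by auto
    then have "finite S" by (auto simp: painted_diagrams_def intro: finite_subset)
    then have valid: "valid_term n M (sorted_list_of_set S)" and d: "2 * size M + k = d"
      using MS(1) total_degree_eq[of n M] by (auto simp: painted_diagrams_def valid_term_def arc_diagram_def)
    show "t \<in> ?H"
      using diagram_term_polynomial[OF valid] diagram_term_homogeneous[of "sorted_list_of_set S" M] valid
      unfolding homogeneous_component_def det_semiinvariants_def MS(2) d[symmetric]
      by (auto simp: diagram_term_semiinvariant orthogonal_det valid_term_def)
  qed
  then show "fun_space.span ?B \<subseteq> ?H"
    by (intro fun_space.span_minimal subspace_homogeneous subspace_det_semiinvariants)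
next
  show "?H \<subseteq> fun_space.span ?B"
  proof
    fix f assume "f \<in> ?H"
    then have f: "f \<in> polynomial_functions scale n" "\<And>c w. f (\<lambda>i. c *s w i) = c ^ d * f w"
      and semi: "\<And>h w. h \<in> orthogonal_group scale b \<Longrightarrow> f (\<lambda>i. h (w i)) = det_endo scale es h * f w"
      by (auto simp: homogeneous_component_def det_semiinvariants_def)
    have "reflection_semiinvariant f"
      unfolding reflection_semiinvariant_def
      using semi[OF reflection_orthogonal] by (simp add: orthogonal_det[OF reflection_orthogonal] map_det_reflection)
    from det_module_span_terms[OF first_fundamental_theorem[OF f(1) this]]
    have "f \<in> fun_space.span {diagram_term M s |M s. valid_term n M s}" .
    then have fT: "f \<in> fun_space.span {t \<in> {diagram_term M s |M s. valid_term n M s}. \<forall>c w. t (\<lambda>i. c *s w i) = c ^ d * t w}"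
    proof (rule homogeneous_part_in_span[where \<sigma> = "\<lambda>c w i. c *s w i", OF _ _ f(2)])
      fix t assume "t \<in> {diagram_term M s |M s. valid_term n M s}"
      then obtain M s where "t = diagram_term M s" "length s = k" by (auto simp only: valid_term_def)
      then show "\<exists>d. \<forall>c w. t (\<lambda>i. c *s w i) = c ^ d * t w" using diagram_term_homogeneous[of s M] by blast
    qed
    have "t \<in> fun_space.span ?B"
      if t: "t \<in> {t \<in> {diagram_term M s |M s. valid_term n M s}. \<forall>c w. t (\<lambda>i. c *s w i) = c ^ d * t w}" for t
    proof -
      obtain M s where Ms: "t = diagram_term M s" "valid_term n M s" using t by blast
      show ?thesis
      proof (cases "2 * size M + k = d")
        case True
        then show ?thesis using straightening[OF Ms(2)] Ms(1) by simp
      next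
        case False
        have "t w = 0" for w
        proof -
          have "(2 :: complex) ^ (2 * size M + k) * t w = 2 ^ d * t w"
            using that diagram_term_homogeneous[of s M 2 w] Ms by (auto simp: valid_term_def)
          moreover have "(2 :: complex) ^ (2 * size M + k) \<noteq> 2 ^ d"
          proof
            assume "(2 :: complex) ^ (2 * size M + k) = 2 ^ d"
            then have "of_nat (2 ^ (2 * size M + k)) = (of_nat (2 ^ d) :: complex)" by simp
            then have "(2 :: nat) ^ (2 * size M + k) = 2 ^ d" unfolding of_nat_eq_iff .
            then show False using False by (simp add: power_inject_exp)
          qed
          ultimately show ?thesis by simp
        qed
        then have "t = 0" by (simp add: fun_eq_iff)
        then show ?thesis by (simp add: fun_space.span_zero)
      qed
    qed
    then have "fun_space.span {t \<in> {diagram_term M s |M s. valid_term n M s}. \<forall>c w. t (\<lambda>i. c *s w i) = c ^ d * t w}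
        \<subseteq> fun_space.span ?B"
      by (intro fun_space.span_minimal fun_space.subspace_span) blast
    then show "f \<in> fun_space.span ?B" using fT by blast
  qed
qed

theorem painted_diagrams_basis:
  "basis_family (painted_diagrams k n d) (diagram_function scale es b)
    (homogeneous_component scale d (det_semiinvariants scale es n (orthogonal_group scale b)))"
proof -
  let ?I = "painted_diagrams k n d" and ?F = "diagram_function scale es b"
    and ?T = "\<lambda>(M, S). diagram_term M (sorted_list_of_set S)"
  obtain P where P: "P \<noteq> 0" "\<And>vs. length vs = k \<Longrightarrow> det_vectors scale es vs = P * coord_det ((!) vs)"
    using det_vectors_eq by blast
  have F: "?F a = fscale P (?T a)" if a: "a \<in> ?I" for a
  proof -
    obtain M S where MS: "a = (M, S)" by fastforce
    have len: "length (sorted_list_of_set S) = k" using a MS by (auto simp: painted_diagrams_def)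
    have "coord_det ((!) (map w (sorted_list_of_set S))) = coord_det (\<lambda>c. w (sorted_list_of_set S ! c))" for w
      using len by (intro coord_det_cong) simp
    then show ?thesis
      using P(2) len by (auto simp: fun_eq_iff MS diagram_function_def diagram_term_def fscale_def)
  qed
  have T: "?T a = fscale (1 / P) (?F a)" if "a \<in> ?I" for a
    using F[OF that] P(1) by (simp add: fun_eq_iff fscale_def)
  show ?thesis
  proof (rule basis_family_criterion)
    fix A c a assume A: "finite A" "A \<subseteq> ?I" "(\<Sum>a\<in>A. fscale (c a) (?F a)) = 0" "a \<in> A"
    have "(\<Sum>a\<in>A. c a * diagram_term (fst a) (sorted_list_of_set (snd a)) w) = 0" for w
    proof -
      have "P * (\<Sum>a\<in>A. c a * diagram_term (fst a) (sorted_list_of_set (snd a)) w) = (\<Sum>a\<in>A. fscale (c a) (?F a)) w"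
        unfolding sum_fun_apply sum_distrib_left
        by (intro sum.cong refl) (use A(2) F in \<open>auto simp: fscale_def case_prod_beta subset_iff\<close>)
      then show ?thesis using P(1) A(3) by simp
    qed
    from painted_terms_independent[OF A(1,2) this A(4)] show "c a = 0" .
  next
    have "?F a \<in> fun_space.span (?T ` ?I)" if "a \<in> ?I" for a
      unfolding F[OF that] using that by (intro fun_space.span_scale fun_space.span_base imageI)
    then have "?F ` ?I \<subseteq> fun_space.span (?T ` ?I)" by (rule image_subsetI)
    moreover have "?T a \<in> fun_space.span (?F ` ?I)" if "a \<in> ?I" for a
      unfolding T[OF that] using that by (intro fun_space.span_scale fun_space.span_base imageI)
    then have "?T ` ?I \<subseteq> fun_space.span (?F ` ?I)" by (rule image_subsetI)
    ultimately have "fun_space.span (?F ` ?I) = fun_space.span (?T ` ?I)"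
      by (intro equalityI fun_space.span_minimal fun_space.subspace_span)
    then show "fun_space.span (?F ` ?I) = homogeneous_component scale d (det_semiinvariants scale es n (orthogonal_group scale b))"
      by (simp only: homogeneous_det_semiinvariants_span)
  qed
qed

lemma orthogonal_group_compose:
  assumes "h \<in> orthogonal_group scale b" "g \<in> orthogonal_group scale b"
  shows "(\<lambda>v. h (g v)) \<in> orthogonal_group scale b" "map_det (\<lambda>v. h (g v)) = map_det h * map_det g"
proof -
  have "bij (h \<circ> g)" using assms by (intro bij_comp) (auto simp: orthogonal_group_def)
  then show "(\<lambda>v. h (g v)) \<in> orthogonal_group scale b"
    using assms by (auto simp: orthogonal_group_def Vector_Spaces.linear_iff o_def)
  show "map_det (\<lambda>v. h (g v)) = map_det h * map_det g"
    using assms(1) coord_det_map[of h "\<lambda>r. g (e r)"] by (simp add: map_det_def[of "\<lambda>v. h (g v)"] map_det_def[of g] orthogonal_group_def)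
qed

text \<open>
  For a reflection \<open>R\<close> every \<open>h\<close> with determinant \<open>- 1\<close> is \<open>R\<close> times an element of the special orthogonal group. Hence
  \<open>f \<circ> R\<close> is independent of the choice of \<open>R\<close>, and the elements of determinant \<open>- 1\<close> exchange \<open>f\<close> and \<open>f \<circ> R\<close>.
\<close>

theorem special_orthogonal_invariants_decomposition:
  assumes "1 \<le> k"
  shows "internal_direct_sum (invariants scale n (special_orthogonal_group scale es b))
    (invariants scale n (orthogonal_group scale b)) (det_semiinvariants scale es n (orthogonal_group scale b))"
proof -
  let ?O = "orthogonal_group scale b"
  let ?A = "invariants scale n ?O" and ?B = "det_semiinvariants scale es n ?O"
    and ?U = "invariants scale n (special_orthogonal_group scale es b)"
  define R where "R = reflection (e 0)"
  have e0: "b (e 0) (e 0) \<noteq> 0" using assms by (simp add: e_orthonormal)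
  have R: "R \<in> ?O" "map_det R = -1" "\<And>v. R (R v) = v"
    using reflection_orthogonal[OF e0] map_det_reflection[OF e0] reflection_involution[OF e0] by (auto simp: R_def)
  have SO: "h \<in> special_orthogonal_group scale es b \<longleftrightarrow> h \<in> ?O \<and> map_det h = 1" for h
    by (auto simp: special_orthogonal_group_def orthogonal_det)
  have disjoint: "?A \<inter> ?B = {0}"
  proof
    show "?A \<inter> ?B \<subseteq> {0}"
    proof
      fix f assume f: "f \<in> ?A \<inter> ?B"
      have "f w = 0" for w
      proof -
        have "f (\<lambda>i. R (w i)) = f w" using f R(1) by (auto simp: invariants_def)
        moreover have "f (\<lambda>i. R (w i)) = - f w" using f R(1,2) orthogonal_det[OF R(1)] by (auto simp: det_semiinvariants_def)
        ultimately show ?thesis by simp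
      qed
      then show "f \<in> {0}" by (simp add: fun_eq_iff)
    qed
    show "{0} \<subseteq> ?A \<inter> ?B"
      using fun_space.subspace_0[OF subspace_invariants] fun_space.subspace_0[OF subspace_det_semiinvariants] by blast
  qed
  have "f + g \<in> ?U" if "f \<in> ?A" "g \<in> ?B" for f g
    using that orthogonal_det
    by (auto simp: invariants_def det_semiinvariants_def SO intro: polynomial_functions.add simp: plus_fun_def)
  moreover have "\<exists>g1 g2. f = g1 + g2 \<and> g1 \<in> ?A \<and> g2 \<in> ?B" if "f \<in> ?U" for f
  proof -
    have f: "f \<in> polynomial_functions scale n" "\<And>h w. h \<in> ?O \<Longrightarrow> map_det h = 1 \<Longrightarrow> f (\<lambda>i. h (w i)) = f w"
      using that by (auto simp: invariants_def SO)
    define fR where "fR w = f (\<lambda>i. R (w i))" for w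
    have fR: "fR \<in> polynomial_functions scale n"
      unfolding fR_def[abs_def] R_def by (rule polynomial_compose_linear[OF f(1) reflection_linear])
    have pos: "fR (\<lambda>i. h (w i)) = fR w" if h: "h \<in> ?O" "map_det h = 1" for h w
    proof -
      have RhR: "(\<lambda>v. R (h (R v))) \<in> ?O" "map_det (\<lambda>v. R (h (R v))) = 1"
        using orthogonal_group_compose[OF R(1) orthogonal_group_compose(1)[OF h(1) R(1)]]
          orthogonal_group_compose(2)[OF h(1) R(1)] R(2) h(2) by simp_all
      show ?thesis using f(2)[OF RhR, of "\<lambda>i. R (w i)"] by (simp add: fR_def R(3))
    qed
    have neg: "f (\<lambda>i. h (w i)) = fR w" "fR (\<lambda>i. h (w i)) = f w" if h: "h \<in> ?O" "map_det h = -1" for h w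
    proof -
      have hR: "(\<lambda>v. h (R v)) \<in> ?O" "map_det (\<lambda>v. h (R v)) = 1"
        using orthogonal_group_compose[OF h(1) R(1)] R(2) h(2) by simp_all
      show "f (\<lambda>i. h (w i)) = fR w" using f(2)[OF hR, of "\<lambda>i. R (w i)"] by (simp add: fR_def R(3))
      have Rh: "(\<lambda>v. R (h v)) \<in> ?O" "map_det (\<lambda>v. R (h v)) = 1"
        using orthogonal_group_compose[OF R(1) h(1)] R(2) h(2) by simp_all
      show "fR (\<lambda>i. h (w i)) = f w" using f(2)[OF Rh, of w] by (simp add: fR_def)
    qed
    have cases: "map_det h = 1 \<or> map_det h = -1" if "h \<in> ?O" for h
      using that by (intro map_det_isometry) (auto simp: orthogonal_group_def)
    have "(\<lambda>w. (1 / 2) * (f w + fR w)) \<in> ?A"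
      unfolding invariants_def
    proof (intro CollectI conjI ballI allI)
      show "(\<lambda>w. (1 / 2) * (f w + fR w)) \<in> polynomial_functions scale n"
        by (intro polynomial_scale polynomial_functions.add f(1) fR)
      fix h w assume h: "h \<in> ?O"
      show "(1 / 2) * (f (\<lambda>i. h (w i)) + fR (\<lambda>i. h (w i))) = (1 / 2) * (f w + fR w)"
        using cases[OF h] f(2)[OF h] pos[OF h] neg[OF h] by auto
    qed
    moreover have "(\<lambda>w. (1 / 2) * (f w + (- 1) * fR w)) \<in> ?B"
      unfolding det_semiinvariants_def
    proof (intro CollectI conjI ballI allI)
      show "(\<lambda>w. (1 / 2) * (f w + (- 1) * fR w)) \<in> polynomial_functions scale n"
        by (intro polynomial_scale polynomial_functions.add f(1) fR)
      fix h w assume h: "h \<in> ?O"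
      show "(1 / 2) * (f (\<lambda>i. h (w i)) + (- 1) * fR (\<lambda>i. h (w i))) = det_endo scale es h * ((1 / 2) * (f w + (- 1) * fR w))"
        using cases[OF h] f(2)[OF h] pos[OF h] neg[OF h] orthogonal_det[OF h] by auto
    qed
    moreover have "f = (\<lambda>w. (1 / 2) * (f w + fR w)) + (\<lambda>w. (1 / 2) * (f w + (- 1) * fR w))"
      by (simp add: fun_eq_iff field_simps)
    ultimately show ?thesis by blast
  qed
  ultimately have "?U = {f + g |f g. f \<in> ?A \<and> g \<in> ?B}" by blast
  then show ?thesis
    unfolding internal_direct_sum_def using subspace_invariants subspace_det_semiinvariants disjoint by blast
qed

end

end

theorem proposition4p4p1:
  fixes scale :: "complex \<Rightarrow> 'v::ab_group_add \<Rightarrow> 'v"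
    and es :: "'v list"
    and b :: "'v \<Rightarrow> 'v \<Rightarrow> complex"
    and k n :: nat
  assumes "vector_space scale"
    and "vector_space.dim scale (UNIV :: 'v set) = k"
    and "ordered_basis scale es"
    and "symmetric_bilinear_form scale b"
    and "nondegenerate_form b"
  shows "(1 \<le> k \<longrightarrow>
            internal_direct_sum
              (invariants scale n (special_orthogonal_group scale es b))
              (invariants scale n (orthogonal_group scale b))
              (det_semiinvariants scale es n (orthogonal_group scale b))) \<and>
         (\<forall>d. basis_family (painted_diagrams k n d) (diagram_function scale es b)
            (homogeneous_component scale d
              (det_semiinvariants scale es n (orthogonal_group scale b))))"
proof -
  interpret vector_space scale by fact
  interpret form_space scale b by unfold_locales fact
  have B: "independent (set es)" "span (set es) = UNIV" "distinct es"
    using assms(3) by (auto simp: ordered_basis_def)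
  have card: "card (set es) = k"
    using dim_eq_card[of "set es" UNIV] B(1,2) assms(2) by simp
  then have len: "length es = k" using distinct_card[OF B(3)] by simp
  obtain ys where ys: "orthonormal ([] @ ys)" "length ([] @ ys) = card (set es)"
    "\<And>v. v = (\<Sum>r<card (set es). scale (b (([] @ ys) ! r) v) (([] @ ys) ! r))"
    by (rule orthonormal_extension[OF assms(5) _ B(1,2), of "[]"]) (simp_all add: orthonormal_def)
  interpret orthonormal_space scale b "(!) ys" k
  proof
    show "b (ys ! r) (ys ! s) = of_bool (r = s)" if "r < k" "s < k" for r s
      using ys(1,2) that by (simp add: orthonormal_def card)
    show "v = (\<Sum>r<k. scale (b (ys ! r) v) (ys ! r))" for v using ys(3)[of v] by (simp add: card)
  qed
  show ?thesis
    using special_orthogonal_invariants_decomposition[OF assms(3) len] painted_diagrams_basis[OF assms(3) len] by blast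
qed

end
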